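(* Let $p$ be a prime, let $k\in\mathbb{N}$ and let $X$ be a $k$-step $p$-homogeneous nilspace. Then for every $i\in\{1,\dots,k\}$, the structure group $Z_i(X)$ is an elementary abelian $p$-group. In particular, a ($k$-step) $p$-homogeneous compact nilspace is a cfr (compact finite-rank) nilspace if and only if it is a finite nilspace (i.e. its underlying set is finite).
   Context: Nilspaces. A nilspace is a (nonempty) set $X$ with sets $C^n(X)\subset X^{\{0,1\}^n}$, $n\ge0$ (the $n$-cubes), such that: (composition) $c\circ\phi\in C^m(X)$ for every $c\in C^n(X)$ and every discrete-cube morphism $\phi:\{0,1\}^m\to\{0,1\}^n$, i.e. map that is the restriction of an affine homomorphism $\mathbb{Z}^m\to\mathbb{Z}^n$; (ergodicity) $C^1(X)=X^{\{0,1\}}$; (completion) every $n$-corner, i.e. every map $c':\{0,1\}^n\setminus\{1^n\}\to X$ whose restriction to each face $\{v:v_i=0\}$ is an $(n-1)$-cube, extends to an element of $C^n(X)$ (here $1^n=(1,\dots,1)$). $X$ is $k$-step if every $(k+1)$-corner has a unique completion. A morphism $X\to Y$ is a map $f$ with $f\circ c\in C^n(Y)$ for all $n$ and $c\in C^n(X)$; $\hom(X,Y)$ is the set of morphisms. For an abelian group $A$ and $\ell\ge1$, $\mathcal{D}_\ell(A)$ is the nilspace on $A$ whose $n$-cubes are the maps $c:\{0,1\}^n\to A$ such that $\sum_{v\in\{0,1\}^{\ell+1}}(-1)^{v_1+\cdots+v_{\ell+1}}c(\phi(v))=0$ for every discrete-cube morphism $\phi:\{0,1\}^{\ell+1}\to\{0,1\}^n$.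 In particular the $n$-cubes of $\mathcal{D}_1(A)$ are the maps $v\mapsto x+v_1h_1+\dots+v_nh_n$ with $x,h_i\in A$. Structure groups. For a $k$-step nilspace $X$ and $0\le i\le k$, let $x\sim_i y$ iff the map equal to $y$ at $1^{i+1}$ and to $x$ elsewhere on $\{0,1\}^{i+1}$ is an $(i+1)$-cube; $X_i=X/\!\sim_i$ with quotient map $\pi_i$ and cubes $\pi_i\circ c$ ($c\in C^n(X)$) is an $i$-step nilspace ($X_k=X$, $X_0$ is a point). The $i$-th structure group $Z_i(X)$ is the abelian group, unique up to isomorphism, acting freely on $X_i$ (written additively) with orbits equal to the fibres of $X_i\to X_{i-1}$, and such that for every $c\in C^n(X_i)$ the cubes in $C^n(X_i)$ with the same image in $X_{i-1}$ as $c$ are exactly the maps $c+c'$, $c'\in C^n(\mathcal{D}_i(Z_i(X)))$. A nilspace is compact if its underlying set has a compact second-countable Hausdorff topology for which every $C^n(X)$ is closed in $X^{\{0,1\}^n}$; then the structure groups are compact abelian groups. A $k$-step compact nilspace is cfr if every structure group has finite rank (i.e. is a compact abelian Lie group). Finite nilspaces carry the discrete topology. An elementary abelian $p$-group is an abelian group in which $px=0$ for every $x$ (possibly trivial or infinite). A nilspace $X$ is $p$-homogeneous if for every $n\ge1$ and every $f\in\hom(\mathcal{D}_1(\mathbb{Z}^n),X)$, the restriction $f|_{[0,p-1]^n}$ is in $\hom(\mathcal{D}_1(\mathbb{Z}_p^n),X)$, where $[0,p-1]^n$ is identified with $\mathbb{Z}_p^n$ (addition mod $p$). *)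

theory Defs
  imports "HOL-Analysis.Analysis" "HOL-Algebra.FiniteProduct" "HOL-Algebra.Group_Action" "HOL-Algebra.Product_Groups"
    "HOL-Algebra.Elementary_Groups"
begin

section \<open>Discrete cubes\<close>

text \<open>The groups \<open>\<int>\<^sup>n\<close> and \<open>\<int>\<^sub>p\<^sup>n\<close> are product groups over the index set \<open>{..<n}\<close>, so that
  \<open>{0,1}\<^sup>n \<subseteq> [0,p-1]\<^sup>n = carrier (mod_lattice p n) \<subseteq> carrier (int_lattice n)\<close> hold literally.\<close>

definition int_lattice :: "nat \<Rightarrow> (nat \<Rightarrow> int) monoid" where
  "int_lattice n = product_group {..<n} (\<lambda>_. integer_group)"

definition mod_lattice :: "nat \<Rightarrow> nat \<Rightarrow> (nat \<Rightarrow> int) monoid" where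
  "mod_lattice p n = product_group {..<n} (\<lambda>_. integer_mod_group p)"

definition discrete_cube :: "nat \<Rightarrow> (nat \<Rightarrow> int) set" where
  "discrete_cube n = {..<n} \<rightarrow>\<^sub>E {0, 1}"

definition top_vertex :: "nat \<Rightarrow> nat \<Rightarrow> int" where
  "top_vertex n = (\<lambda>i\<in>{..<n}. 1)"

definition cube_morphism :: "nat \<Rightarrow> nat \<Rightarrow> ((nat \<Rightarrow> int) \<Rightarrow> (nat \<Rightarrow> int)) \<Rightarrow> bool" where
  "cube_morphism m n \<phi> \<longleftrightarrow>
     \<phi> \<in> discrete_cube m \<rightarrow> discrete_cube n \<and>
     (\<exists>b \<in> carrier (int_lattice n). \<exists>h \<in> hom (int_lattice m) (int_lattice n).
        \<forall>v \<in> discrete_cube m. \<phi> v = b \<otimes>\<^bsub>int_lattice n\<^esub> h v)"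

text \<open>For \<open>i < n\<close>, the bijection from \<open>{0,1}\<^sup>n\<^sup>-\<^sup>1\<close> onto the face \<open>{v. v i = 0}\<close> of \<open>{0,1}\<^sup>n\<close>
  which inserts a \<open>0\<close> as the \<open>i\<close>-th coordinate.\<close>

definition face_map :: "nat \<Rightarrow> nat \<Rightarrow> (nat \<Rightarrow> int) \<Rightarrow> (nat \<Rightarrow> int)" where
  "face_map n i w = (\<lambda>j\<in>{..<n}. if j < i then w j else if j = i then 0 else w (j - 1))"


section \<open>Nilspaces\<close>

definition corner ::
  "'a set \<Rightarrow> (nat \<Rightarrow> ((nat \<Rightarrow> int) \<Rightarrow> 'a) set) \<Rightarrow> nat \<Rightarrow> ((nat \<Rightarrow> int) \<Rightarrow> 'a) \<Rightarrow> bool" where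
  "corner X C n c' \<longleftrightarrow>
     c' \<in> (discrete_cube n - {top_vertex n}) \<rightarrow>\<^sub>E X \<and>
     (\<forall>i<n. restrict (c' \<circ> face_map n i) (discrete_cube (n - 1)) \<in> C (n - 1))"

definition completes ::
  "(nat \<Rightarrow> ((nat \<Rightarrow> int) \<Rightarrow> 'a) set) \<Rightarrow> nat \<Rightarrow> ((nat \<Rightarrow> int) \<Rightarrow> 'a) \<Rightarrow> ((nat \<Rightarrow> int) \<Rightarrow> 'a) \<Rightarrow> bool" where
  "completes C n c' c \<longleftrightarrow> c \<in> C n \<and> restrict c (discrete_cube n - {top_vertex n}) = c'"

locale nilspace =
  fixes X :: "'a set" and C :: "nat \<Rightarrow> ((nat \<Rightarrow> int) \<Rightarrow> 'a) set"
  assumes nonempty: "X \<noteq> {}"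
    and cubes: "C n \<subseteq> discrete_cube n \<rightarrow>\<^sub>E X"
    and composition: "\<lbrakk>c \<in> C n; cube_morphism m n \<phi>\<rbrakk> \<Longrightarrow> restrict (c \<circ> \<phi>) (discrete_cube m) \<in> C m"
    and ergodicity: "C 1 = discrete_cube 1 \<rightarrow>\<^sub>E X"
    and completion: "corner X C n c' \<Longrightarrow> \<exists>c. completes C n c' c"

definition step_nilspace :: "nat \<Rightarrow> 'a set \<Rightarrow> (nat \<Rightarrow> ((nat \<Rightarrow> int) \<Rightarrow> 'a) set) \<Rightarrow> bool" where
  "step_nilspace k X C \<longleftrightarrow>
     nilspace X C \<and> (\<forall>c'. corner X C (k + 1) c' \<longrightarrow> (\<exists>!c. completes C (k + 1) c' c))"

definition nilspace_hom ::
  "'a set \<Rightarrow> (nat \<Rightarrow> ((nat \<Rightarrow> int) \<Rightarrow> 'a) set) \<Rightarrow>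
   'b set \<Rightarrow> (nat \<Rightarrow> ((nat \<Rightarrow> int) \<Rightarrow> 'b) set) \<Rightarrow> ('a \<Rightarrow> 'b) set" where
  "nilspace_hom X C Y D =
     {f \<in> X \<rightarrow> Y. \<forall>n. \<forall>c \<in> C n. restrict (f \<circ> c) (discrete_cube n) \<in> D n}"

text \<open>The cubes of \<open>\<D>\<^sub>\<ell>(A)\<close>, whose underlying set is \<open>carrier A\<close>; the group \<open>A\<close> is written
  multiplicatively.\<close>

definition D_cubes :: "nat \<Rightarrow> 'z monoid \<Rightarrow> nat \<Rightarrow> ((nat \<Rightarrow> int) \<Rightarrow> 'z) set" where
  "D_cubes l A n =
     {c \<in> discrete_cube n \<rightarrow>\<^sub>E carrier A.
        \<forall>\<phi>. cube_morphism (l + 1) n \<phi> \<longrightarrow>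
          (\<Otimes>\<^bsub>A\<^esub>v\<in>discrete_cube (l + 1). c (\<phi> v) [^]\<^bsub>A\<^esub> ((- 1 :: int) ^ nat (\<Sum>j<l + 1. v j))) = \<one>\<^bsub>A\<^esub>}"

definition p_homogeneous ::
  "nat \<Rightarrow> 'a set \<Rightarrow> (nat \<Rightarrow> ((nat \<Rightarrow> int) \<Rightarrow> 'a) set) \<Rightarrow> bool" where
  "p_homogeneous p X C \<longleftrightarrow>
     (\<forall>n\<ge>1. \<forall>f \<in> nilspace_hom (carrier (int_lattice n)) (D_cubes 1 (int_lattice n)) X C.
        restrict f (carrier (mod_lattice p n))
          \<in> nilspace_hom (carrier (mod_lattice p n)) (D_cubes 1 (mod_lattice p n)) X C)"


section \<open>Factors and structure groups\<close>

definition factor_rel ::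
  "'a set \<Rightarrow> (nat \<Rightarrow> ((nat \<Rightarrow> int) \<Rightarrow> 'a) set) \<Rightarrow> nat \<Rightarrow> ('a \<times> 'a) set" where
  "factor_rel X C i =
     {(x, y) \<in> X \<times> X.
        (\<lambda>v \<in> discrete_cube (i + 1). if v = top_vertex (i + 1) then y else x) \<in> C (i + 1)}"

definition factor_map ::
  "'a set \<Rightarrow> (nat \<Rightarrow> ((nat \<Rightarrow> int) \<Rightarrow> 'a) set) \<Rightarrow> nat \<Rightarrow> 'a \<Rightarrow> 'a set" where
  "factor_map X C i x = factor_rel X C i `` {x}"

definition factor ::
  "'a set \<Rightarrow> (nat \<Rightarrow> ((nat \<Rightarrow> int) \<Rightarrow> 'a) set) \<Rightarrow> nat \<Rightarrow> 'a set set" where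
  "factor X C i = X // factor_rel X C i"

definition factor_cubes ::
  "'a set \<Rightarrow> (nat \<Rightarrow> ((nat \<Rightarrow> int) \<Rightarrow> 'a) set) \<Rightarrow> nat \<Rightarrow> nat \<Rightarrow> ((nat \<Rightarrow> int) \<Rightarrow> 'a set) set" where
  "factor_cubes X C i n = (\<lambda>c. restrict (factor_map X C i \<circ> c) (discrete_cube n)) ` C n"

text \<open>The map \<open>X\<^sub>i \<rightarrow> X\<^sub>i\<^sub>-\<^sub>1\<close>. As \<open>\<sim>\<^sub>i\<close> refines \<open>\<sim>\<^sub>i\<^sub>-\<^sub>1\<close>, the image of a \<open>\<sim>\<^sub>i\<close>-class under the relation
  \<open>\<sim>\<^sub>i\<^sub>-\<^sub>1\<close> is the \<open>\<sim>\<^sub>i\<^sub>-\<^sub>1\<close>-class containing it.\<close>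

definition factor_proj ::
  "'a set \<Rightarrow> (nat \<Rightarrow> ((nat \<Rightarrow> int) \<Rightarrow> 'a) set) \<Rightarrow> nat \<Rightarrow> 'a set \<Rightarrow> 'a set" where
  "factor_proj X C i q = factor_rel X C (i - 1) `` q"

text \<open>\<open>Z\<close>, acting on \<open>X\<^sub>i\<close> by \<open>act\<close>, is an \<open>i\<close>-th structure group of \<open>X\<close> (where \<open>i \<ge> 1\<close>). Such a group
  is unique up to isomorphism.\<close>

definition structure_group ::
  "'a set \<Rightarrow> (nat \<Rightarrow> ((nat \<Rightarrow> int) \<Rightarrow> 'a) set) \<Rightarrow> nat \<Rightarrow> 'z monoid \<Rightarrow> ('z \<Rightarrow> 'a set \<Rightarrow> 'a set) \<Rightarrow> bool"
  where
  "structure_group X C i Z act \<longleftrightarrow>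
     comm_group Z \<and>
     group_action Z (factor X C i) act \<and>
     (\<forall>q \<in> factor X C i. stabilizer Z act q = {\<one>\<^bsub>Z\<^esub>}) \<and>
     (\<forall>q \<in> factor X C i.
        orbit Z act q = {q' \<in> factor X C i. factor_proj X C i q' = factor_proj X C i q}) \<and>
     (\<forall>n. \<forall>c \<in> factor_cubes X C i n.
        {d \<in> factor_cubes X C i n.
           \<forall>v \<in> discrete_cube n. factor_proj X C i (d v) = factor_proj X C i (c v)}
        = {\<lambda>v \<in> discrete_cube n. act (c' v) (c v) | c'. c' \<in> D_cubes i Z n})"

definition elementary_abelian :: "nat \<Rightarrow> 'z monoid \<Rightarrow> bool" where
  "elementary_abelian p Z \<longleftrightarrow> comm_group Z \<and> (\<forall>z \<in> carrier Z. z [^]\<^bsub>Z\<^esub> p = \<one>\<^bsub>Z\<^esub>)"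


section \<open>Compact nilspaces\<close>

definition compact_nilspace ::
  "'a set \<Rightarrow> (nat \<Rightarrow> ((nat \<Rightarrow> int) \<Rightarrow> 'a) set) \<Rightarrow> 'a topology \<Rightarrow> bool" where
  "compact_nilspace X C T \<longleftrightarrow>
     nilspace X C \<and> topspace T = X \<and>
     compact_space T \<and> second_countable T \<and> Hausdorff_space T \<and>
     (\<forall>n. closedin (product_topology (\<lambda>_. T) (discrete_cube n)) (C n))"

definition factor_topology ::
  "'a set \<Rightarrow> (nat \<Rightarrow> ((nat \<Rightarrow> int) \<Rightarrow> 'a) set) \<Rightarrow> 'a topology \<Rightarrow> nat \<Rightarrow> 'a set topology" where
  "factor_topology X C T i =
     topology (\<lambda>U. U \<subseteq> factor X C i \<and> openin T {x \<in> X. factor_map X C i x \<in> U})"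

lemma openin_factor_topology:
  assumes "topspace T = X"
  shows "openin (factor_topology X C T i) U \<longleftrightarrow>
    U \<subseteq> factor X C i \<and> openin T {x \<in> X. factor_map X C i x \<in> U}"
proof -
  let ?f = "factor_map X C i"
  have "openin T {x \<in> X. ?f x \<in> S \<inter> S'}"
    if "openin T {x \<in> X. ?f x \<in> S}" "openin T {x \<in> X. ?f x \<in> S'}" for S S'
  proof -
    have "{x \<in> X. ?f x \<in> S \<inter> S'} = {x \<in> X. ?f x \<in> S} \<inter> {x \<in> X. ?f x \<in> S'}" by auto
    with that show ?thesis by (simp add: openin_Int)
  qed
  moreover have "openin T {x \<in> X. ?f x \<in> \<Union>\<K>}"
    if "\<forall>K\<in>\<K>. openin T {x \<in> X. ?f x \<in> K}" for \<K>
  proof -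
    have "{x \<in> X. ?f x \<in> \<Union>\<K>} = (\<Union>K\<in>\<K>. {x \<in> X. ?f x \<in> K})" by auto
    with that show ?thesis by auto
  qed
  ultimately have "istopology (\<lambda>U. U \<subseteq> factor X C i \<and> openin T {x \<in> X. ?f x \<in> U})"
    unfolding istopology_def by (auto simp del: Int_iff Union_iff)
  then show ?thesis by (simp add: factor_topology_def topology_inverse')
qed


section \<open>Lie groups\<close>

text \<open>\<open>g\<close> is \<open>r\<close> times continuously differentiable on the open set \<open>U\<close> of \<open>\<real>\<^sup>n\<close>, where \<open>\<real>\<^sup>n\<close> is the
  space of sequences vanishing from index \<open>n\<close> on. The functions \<open>g' i\<close> are the partial
  derivatives of \<open>g\<close>.\<close>

primrec C_on :: "nat \<Rightarrow> nat \<Rightarrow> (nat \<Rightarrow> real) set \<Rightarrow> ((nat \<Rightarrow> real) \<Rightarrow> real) \<Rightarrow> bool" where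
  "C_on 0 n U g = continuous_map (subtopology (Euclidean_space n) U) euclideanreal g"
| "C_on (Suc r) n U g =
     (continuous_map (subtopology (Euclidean_space n) U) euclideanreal g \<and>
      (\<exists>g'. \<forall>i<n.
         (\<forall>x \<in> U. ((\<lambda>t. g (x(i := t))) has_real_derivative g' i x) (at (x i))) \<and>
         C_on r n U (g' i)))"

definition smooth_map_on ::
  "nat \<Rightarrow> nat \<Rightarrow> (nat \<Rightarrow> real) set \<Rightarrow> ((nat \<Rightarrow> real) \<Rightarrow> (nat \<Rightarrow> real)) \<Rightarrow> bool" where
  "smooth_map_on n m U f \<longleftrightarrow> (\<forall>j<m. \<forall>r. C_on r n U (\<lambda>x. f x j))"

text \<open>A chart is given by its domain \<open>U\<close> and the map \<open>\<phi>\<close> on \<open>U\<close>.\<close>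

definition smooth_atlas :: "nat \<Rightarrow> 'z topology \<Rightarrow> ('z set \<times> ('z \<Rightarrow> nat \<Rightarrow> real)) set \<Rightarrow> bool" where
  "smooth_atlas n S \<A> \<longleftrightarrow>
     (\<Union>(U, \<phi>) \<in> \<A>. U) = topspace S \<and>
     (\<forall>(U, \<phi>) \<in> \<A>.
        openin S U \<and> openin (Euclidean_space n) (\<phi> ` U) \<and>
        homeomorphic_map (subtopology S U) (subtopology (Euclidean_space n) (\<phi> ` U)) \<phi>) \<and>
     (\<forall>(U, \<phi>) \<in> \<A>. \<forall>(V, \<psi>) \<in> \<A>. smooth_map_on n n (\<phi> ` (U \<inter> V)) (\<psi> \<circ> inv_into U \<phi>))"

text \<open>The two projections \<open>\<real>\<^sup>2\<^sup>n = \<real>\<^sup>n \<times> \<real>\<^sup>n \<rightarrow> \<real>\<^sup>n\<close>.\<close>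

definition left_half :: "nat \<Rightarrow> (nat \<Rightarrow> real) \<Rightarrow> (nat \<Rightarrow> real)" where
  "left_half n x = (\<lambda>i. if i < n then x i else 0)"

definition right_half :: "nat \<Rightarrow> (nat \<Rightarrow> real) \<Rightarrow> (nat \<Rightarrow> real)" where
  "right_half n x = (\<lambda>i. if i < n then x (n + i) else 0)"

definition smooth_inverse ::
  "nat \<Rightarrow> 'z monoid \<Rightarrow> ('z set \<times> ('z \<Rightarrow> nat \<Rightarrow> real)) set \<Rightarrow> bool" where
  "smooth_inverse n G \<A> \<longleftrightarrow>
     (\<forall>(U, \<phi>) \<in> \<A>. \<forall>(V, \<psi>) \<in> \<A>.
        smooth_map_on n n (\<phi> ` {a \<in> U. inv\<^bsub>G\<^esub> a \<in> V}) (\<lambda>x. \<psi> (inv\<^bsub>G\<^esub> (inv_into U \<phi> x))))"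

definition smooth_mult ::
  "nat \<Rightarrow> 'z monoid \<Rightarrow> ('z set \<times> ('z \<Rightarrow> nat \<Rightarrow> real)) set \<Rightarrow> bool" where
  "smooth_mult n G \<A> \<longleftrightarrow>
     (\<forall>(U, \<phi>) \<in> \<A>. \<forall>(V, \<psi>) \<in> \<A>. \<forall>(W, \<theta>) \<in> \<A>.
        smooth_map_on (2 * n) n
          {x \<in> topspace (Euclidean_space (2 * n)).
             left_half n x \<in> \<phi> ` U \<and> right_half n x \<in> \<psi> ` V \<and>
             inv_into U \<phi> (left_half n x) \<otimes>\<^bsub>G\<^esub> inv_into V \<psi> (right_half n x) \<in> W}
          (\<lambda>x. \<theta> (inv_into U \<phi> (left_half n x) \<otimes>\<^bsub>G\<^esub> inv_into V \<psi> (right_half n x))))"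

definition topological_group :: "'z monoid \<Rightarrow> 'z topology \<Rightarrow> bool" where
  "topological_group G S \<longleftrightarrow>
     group G \<and> topspace S = carrier G \<and>
     continuous_map (prod_topology S S) S (\<lambda>(a, b). a \<otimes>\<^bsub>G\<^esub> b) \<and>
     continuous_map S S (\<lambda>a. inv\<^bsub>G\<^esub> a)"

definition lie_group :: "'z monoid \<Rightarrow> 'z topology \<Rightarrow> bool" where
  "lie_group G S \<longleftrightarrow>
     topological_group G S \<and> Hausdorff_space S \<and> second_countable S \<and>
     (\<exists>n \<A>. smooth_atlas n S \<A> \<and> smooth_mult n G \<A> \<and> smooth_inverse n G \<A>)"


section \<open>Compact finite-rank nilspaces\<close>

text \<open>The topology \<open>S\<close> of the structure group of a compact nilspace is the compact Hausdorff group
  topology for which the action on \<open>X\<^sub>i\<close> (with the quotient topology) is continuous. It is unique: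
  since the action is free, every orbit map is then a homeomorphism onto a fibre.\<close>

definition compact_structure_group ::
  "'a set \<Rightarrow> (nat \<Rightarrow> ((nat \<Rightarrow> int) \<Rightarrow> 'a) set) \<Rightarrow> 'a topology \<Rightarrow> nat \<Rightarrow>
   'z monoid \<Rightarrow> ('z \<Rightarrow> 'a set \<Rightarrow> 'a set) \<Rightarrow> 'z topology \<Rightarrow> bool" where
  "compact_structure_group X C T i Z act S \<longleftrightarrow>
     structure_group X C i Z act \<and>
     topological_group Z S \<and> compact_space S \<and> Hausdorff_space S \<and>
     continuous_map (prod_topology S (factor_topology X C T i)) (factor_topology X C T i)
       (\<lambda>(z, q). act z q)"

text \<open>The carrier type \<open>'a set\<close> for the structure groups is no restriction, because a structure
  group is in bijection with a fibre of \<open>X\<^sub>i \<rightarrow> X\<^sub>i\<^sub>-\<^sub>1\<close>.\<close>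

definition cfr_nilspace ::
  "nat \<Rightarrow> 'a set \<Rightarrow> (nat \<Rightarrow> ((nat \<Rightarrow> int) \<Rightarrow> 'a) set) \<Rightarrow> 'a topology \<Rightarrow> bool" where
  "cfr_nilspace k X C T \<longleftrightarrow>
     step_nilspace k X C \<and> compact_nilspace X C T \<and>
     (\<forall>i \<in> {1..k}. \<exists>(Z :: 'a set monoid) act S.
        compact_structure_group X C T i Z act S \<and> lie_group Z S)"

end

theory Submission
  imports Defs
begin

text \<open>
  \<^bold>\<open>Exponent of the structure groups.\<close> Let \<open>z\<close> be an element of the \<open>i\<close>-th structure group \<open>Z\<close> and let
  \<open>x, y \<in> X\<close> be points whose classes in \<open>X\<^sub>i\<close> differ by \<open>z\<close>. Then the map with value \<open>y\<close> at \<open>1\<^sup>i\<close> and \<open>x\<close>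
  at the other vertices of \<open>{0,1}\<^sup>i\<close> is a cube. It extends to a morphism \<open>F\<close> from \<open>\<D>\<^sub>1(\<int>\<^sup>i)\<close> to \<open>X\<close>, and
  on nonnegative vectors \<open>F\<close> is constant modulo \<open>\<sim>\<^sub>i\<^sub>-\<^sub>1\<close> (\<open>spike_morphism\<close>). Measured from the class of \<open>x\<close>
  in \<open>X\<^sub>i\<close>, the restriction of \<open>F\<close> to \<open>[0,p-1]\<^sup>i\<close> becomes a function \<open>g\<close> with values in \<open>Z\<close>, and
  \<open>p\<close>-homogeneity says that the alternating sum of \<open>g\<close> over every \<open>(i+1)\<close>-cube of \<open>\<int>\<^sub>p\<^sup>i\<close> vanishes. So if
  \<open>H(t)\<close> is the alternating sum of \<open>g\<close> over \<open>{0,1}\<^sup>i\<^sup>-\<^sup>1 \<times> {t}\<close>, then \<open>H\<close> has constant differences on the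
  cycle \<open>\<int>\<^sub>p\<close>; this difference is \<open>\<plusminus>z\<close>, and going once around the cycle gives \<open>p z = 0\<close>
  (\<open>structure_group_exponent\<close>).

  \<^bold>\<open>Finite rank implies finite.\<close> In a chart around the unit \<open>a\<close> of a Lie group the multiplication is
  \<open>M(x, y) = y + (x - a) + o(|x - a|)\<close>. Hence the coordinates of the \<open>p\<close>-th power of \<open>x\<close> are
  \<open>a + p (x - a) + o(|x - a|)\<close>, so near the unit only the unit itself has trivial \<open>p\<close>-th power. A Lie group
  of finite exponent is thus discrete, and finite if it is compact (\<open>compact_lie_group_exponent_finite\<close>).
  Since \<open>X\<^sub>0\<close> is a point and the fibres of \<open>X\<^sub>i \<rightarrow> X\<^sub>i\<^sub>-\<^sub>1\<close> are orbits of finite groups, \<open>X = X\<^sub>k\<close> is finite.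

  \<^bold>\<open>Finite implies finite rank.\<close> A finite Hausdorff space is discrete, and a finite discrete group is a
  Lie group of dimension \<open>0\<close>. What has to be proved here is that structure groups exist
  (\<open>structure_group_exists\<close>). On \<open>X\<^sub>k\<close>, call the pairs \<open>(x, x')\<close> and \<open>(y, y')\<close> parallel if the map on
  \<open>{0,1}\<^sup>k\<^sup>+\<^sup>1\<close> is a cube which takes the values \<open>x'\<close> and \<open>y'\<close> at the top vertices of the two opposite faces
  \<open>v\<^sub>k = 0\<close> and \<open>v\<^sub>k = 1\<close>, and the values \<open>x\<close> and \<open>y\<close> elsewhere on these faces. Unique completion makes
  parallel transport from a base point a free action of a fibre, commutativity comes from moving two edges
  of a constant cube which share a vertex, and a function translates cubes to cubes iff its alternating sums over \<open>(k+1)\<close>-faces vanish (\<open>fibre_action_cubes\<close>).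

  \<^bold>\<open>The common tool.\<close> All constructions of cubes rest on one extension principle (\<open>lattice_extension\<close>): a
  map which is a morphism on a suitable part of \<open>\<int>\<^sup>n\<close> extends to a morphism \<open>\<D>\<^sub>1(\<int>\<^sup>n) \<rightarrow> X\<close>. The values are
  chosen one point at a time, in an order for which each new point is the last vertex of a box, so that
  the earlier values form a corner; its completion gives the new value. Besides \<open>F\<close> above, this yields the
  gluing of \<open>2\<^sup>n\<close> cubes around a common vertex (\<open>tricube\<close>), the equivalence relations \<open>\<sim>\<^sub>k\<close>, and the
  simultaneous lifting of corners from \<open>X\<^sub>k\<close> to \<open>X\<close> (\<open>pointwise_lift\<close>).
\<close>

section \<open>Affine maps between discrete cubes\<close>

abbreviation dc :: "nat \<Rightarrow> (nat \<Rightarrow> int) set" where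
  "dc \<equiv> discrete_cube"

definition affine_fun :: "nat \<Rightarrow> ((nat \<Rightarrow> int) \<Rightarrow> int) \<Rightarrow> bool" where
  "affine_fun m g \<longleftrightarrow> (\<exists>b h. \<forall>s \<in> dc m. g s = b + (\<Sum>j<m. h j * s j))"

lemma affine_fun_witness:
  "(\<And>s. s \<in> dc m \<Longrightarrow> g s = b + (\<Sum>j<m. h j * s j)) \<Longrightarrow> affine_fun m g"
  unfolding affine_fun_def by (rule exI[of _ b], rule exI[of _ h]) simp

lemma discrete_cube_iff: "s \<in> dc m \<longleftrightarrow> s \<in> extensional {..<m} \<and> (\<forall>j<m. s j = 0 \<or> s j = 1)"
  by (auto simp: discrete_cube_def PiE_iff)

lemma discrete_cube_cases: "s \<in> dc m \<Longrightarrow> j < m \<Longrightarrow> s j = 0 \<or> s j = 1"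
  by (auto simp: discrete_cube_iff)

lemma restrict_in_discrete_cube [simp]:
  "(\<lambda>l\<in>{..<n}. f l) \<in> dc n \<longleftrightarrow> (\<forall>l<n. f l = 0 \<or> f l = 1)"
  by (auto simp: discrete_cube_iff)

lemma discrete_cube_upd: "s \<in> dc m \<Longrightarrow> j < m \<Longrightarrow> a = 0 \<or> a = 1 \<Longrightarrow> s(j := a) \<in> dc m"
  by (auto simp: discrete_cube_iff extensional_def)

lemma discrete_cube_eqI:
  "s \<in> dc m \<Longrightarrow> t \<in> dc m \<Longrightarrow> (\<And>j. j < m \<Longrightarrow> s j = t j) \<Longrightarrow> s = t"
  by (rule extensionalityI[of _ "{..<m}"]) (auto simp: discrete_cube_iff)

lemma finite_discrete_cube [simp]: "finite (dc m)"
  by (auto simp: discrete_cube_def intro: finite_PiE)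

lemma top_vertex_in [simp]: "top_vertex n \<in> dc n"
  by (simp add: top_vertex_def)

lemma eq_top_vertex_iff: "s \<in> dc n \<Longrightarrow> s = top_vertex n \<longleftrightarrow> (\<forall>l<n. s l = 1)"
  by (auto simp: top_vertex_def intro!: discrete_cube_eqI[of s n])

lemma affine_fun_cong: "(\<And>s. s \<in> dc m \<Longrightarrow> f s = g s) \<Longrightarrow> affine_fun m f \<longleftrightarrow> affine_fun m g"
  by (simp add: affine_fun_def)

lemma affine_fun_const [simp]: "affine_fun m (\<lambda>s. c)"
  unfolding affine_fun_def by (rule exI[of _ c], rule exI[of _ "\<lambda>_. 0"]) simp

lemma affine_fun_coord [simp]: "j < m \<Longrightarrow> affine_fun m (\<lambda>s. s j)"
  unfolding affine_fun_def
  by (rule exI[of _ 0], rule exI[of _ "\<lambda>i. if i = j then 1 else 0"])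
    (simp add: if_distrib[of "\<lambda>x. x * _"] sum.delta cong: if_cong)

lemma affine_fun_add [simp]:
  assumes "affine_fun m f" "affine_fun m g" shows "affine_fun m (\<lambda>s. f s + g s)"
proof -
  obtain b h b' h' where "\<forall>s\<in>dc m. f s = b + (\<Sum>j<m. h j * s j)" "\<forall>s\<in>dc m. g s = b' + (\<Sum>j<m. h' j * s j)"
    using assms unfolding affine_fun_def by blast
  then have "\<forall>s\<in>dc m. f s + g s = (b + b') + (\<Sum>j<m. (h j + h' j) * s j)"
    by (simp add: sum.distrib distrib_right)
  then show ?thesis by (intro affine_fun_witness) auto
qed

lemma affine_fun_mult [simp]:
  assumes "affine_fun m f" shows "affine_fun m (\<lambda>s. c * f s)"
proof -
  obtain b h where "\<forall>s\<in>dc m. f s = b + (\<Sum>j<m. h j * s j)"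
    using assms unfolding affine_fun_def by blast
  then have "\<forall>s\<in>dc m. c * f s = c * b + (\<Sum>j<m. (c * h j) * s j)"
    by (simp add: distrib_left sum_distrib_left mult.assoc)
  then show ?thesis by (intro affine_fun_witness) auto
qed

lemma affine_fun_mult_right [simp]: "affine_fun m f \<Longrightarrow> affine_fun m (\<lambda>s. f s * c)"
  using affine_fun_mult[of m f c] by (simp add: mult.commute)

lemma affine_fun_diff [simp]:
  assumes "affine_fun m f" "affine_fun m g" shows "affine_fun m (\<lambda>s. f s - g s)"
  using affine_fun_add[OF assms(1) affine_fun_mult[OF assms(2), of "-1"]] by simp

lemma affine_fun_sum [simp]:
  "(\<And>i. i \<in> I \<Longrightarrow> affine_fun m (f i)) \<Longrightarrow> affine_fun m (\<lambda>s. \<Sum>i\<in>I. f i s)"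
  by (induction I rule: infinite_finite_induct) auto

lemma affine_fun_compose:
  assumes "affine_fun n g" "\<phi> \<in> dc m \<rightarrow> dc n" "\<And>l. l < n \<Longrightarrow> affine_fun m (\<lambda>s. \<phi> s l)"
  shows "affine_fun m (\<lambda>s. g (\<phi> s))"
proof -
  obtain b h where g: "\<forall>s\<in>dc n. g s = b + (\<Sum>j<n. h j * s j)"
    using assms(1) unfolding affine_fun_def by blast
  have "affine_fun m (\<lambda>s. b + (\<Sum>j<n. h j * \<phi> s j))"
    by (intro affine_fun_add affine_fun_sum affine_fun_mult affine_fun_const assms(3)) simp
  then show ?thesis
    by (rule affine_fun_cong[THEN iffD1, rotated]) (use g assms(2) in \<open>auto simp: Pi_iff\<close>)
qed

text \<open>Every vertex arises from the origin by switching coordinates from \<open>0\<close> to \<open>1\<close>, so it suffices that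
  each switch changes the value by an amount depending on its position only.\<close>

lemma affine_funI:
  assumes "\<And>w j. w \<in> dc m \<Longrightarrow> j < m \<Longrightarrow> w j = 0 \<Longrightarrow> g (w(j := 1)) = g w + h j"
  shows "affine_fun m g"
proof -
  define ind where "ind S = (\<lambda>i\<in>{..<m}. if i \<in> S then 1 else 0 :: int)" for S :: "nat set"
  have *: "S \<subseteq> {..<m} \<Longrightarrow> g (ind S) = g (ind {}) + (\<Sum>j\<in>S. h j)" if "finite S" for S
    using that
  proof (induction S)
    case (insert x S)
    have "ind (insert x S) = (ind S)(x := 1)"
      using insert by (auto simp: ind_def)
    moreover have "g ((ind S)(x := 1)) = g (ind S) + h x"
      by (rule assms) (use insert in \<open>auto simp: ind_def\<close>)
    ultimately have "g (ind (insert x S)) = g (ind S) + h x" by metis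
    then show ?case using insert by simp
  qed simp
  have "g s = g (ind {}) + (\<Sum>j<m. h j * s j)" if "s \<in> dc m" for s
  proof -
    have "s = ind {j. j < m \<and> s j = 1}"
      by (rule discrete_cube_eqI[OF that]) (use that in \<open>auto simp: ind_def discrete_cube_iff\<close>)
    then have "g s = g (ind {}) + (\<Sum>j | j < m \<and> s j = 1. h j)"
      using *[of "{j. j < m \<and> s j = 1}"] by auto
    also have "(\<Sum>j | j < m \<and> s j = 1. h j) = (\<Sum>j<m. h j * s j)"
      by (rule sum.mono_neutral_cong_left) (use that in \<open>auto simp: discrete_cube_iff\<close>)
    finally show ?thesis .
  qed
  then show ?thesis by (rule affine_fun_witness)
qed

lemma carrier_int_lattice: "carrier (int_lattice n) = {..<n} \<rightarrow>\<^sub>E UNIV"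
  by (simp add: int_lattice_def)

lemma mult_int_lattice: "x \<otimes>\<^bsub>int_lattice n\<^esub> y = (\<lambda>l\<in>{..<n}. x l + y l)"
  by (simp add: int_lattice_def)

lemma dc_subset_lattice: "dc n \<subseteq> carrier (int_lattice n)"
  by (auto simp: carrier_int_lattice discrete_cube_def)

text \<open>The linear part of a discrete-cube morphism is a homomorphism of lattices. Additivity fixes the effect of
  switching one coordinate, so each component is affine; conversely the coefficients of the components define
  a homomorphism.\<close>

lemma cube_morphism_iff:
  "cube_morphism m n \<phi> \<longleftrightarrow> \<phi> \<in> dc m \<rightarrow> dc n \<and> (\<forall>l<n. affine_fun m (\<lambda>s. \<phi> s l))"
proof
  assume L: "cube_morphism m n \<phi>"
  then obtain b h where h: "h \<in> hom (int_lattice m) (int_lattice n)"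
    and b: "\<And>v. v \<in> dc m \<Longrightarrow> \<phi> v = b \<otimes>\<^bsub>int_lattice n\<^esub> h v"
    unfolding cube_morphism_def by blast
  have "affine_fun m (\<lambda>s. \<phi> s l)" if "l < n" for l
  proof (rule affine_funI)
    fix w j assume w: "w \<in> dc m" "j < m" "w j = 0"
    define e where "e = (\<lambda>i\<in>{..<m}. if i = j then 1 else 0 :: int)"
    have e: "w(j := 1) = w \<otimes>\<^bsub>int_lattice m\<^esub> e" "e \<in> carrier (int_lattice m)"
      using w by (auto simp: e_def mult_int_lattice carrier_int_lattice discrete_cube_iff extensional_def)
    have wc: "w \<in> carrier (int_lattice m)" using w dc_subset_lattice by blast
    have "h (w(j := 1)) = h w \<otimes>\<^bsub>int_lattice n\<^esub> h e"
      using hom_mult[OF h wc e(2)] e(1) by simp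
    then show "\<phi> (w(j := 1)) l = \<phi> w l + h e l"
      using b[OF w(1)] b[OF discrete_cube_upd[OF w(1,2), of 1]] that
      by (simp add: mult_int_lattice)
  qed
  with L show "\<phi> \<in> dc m \<rightarrow> dc n \<and> (\<forall>l<n. affine_fun m (\<lambda>s. \<phi> s l))"
    by (simp add: cube_morphism_def)
next
  assume R: "\<phi> \<in> dc m \<rightarrow> dc n \<and> (\<forall>l<n. affine_fun m (\<lambda>s. \<phi> s l))"
  then have "\<forall>l. \<exists>bh. l < n \<longrightarrow> (\<forall>s\<in>dc m. \<phi> s l = fst bh + (\<Sum>j<m. snd bh j * s j))"
    unfolding affine_fun_def by fastforce
  from choice[OF this] obtain bh where
    bh': "\<forall>l. l < n \<longrightarrow> (\<forall>s\<in>dc m. \<phi> s l = fst (bh l) + (\<Sum>j<m. snd (bh l) j * s j))" by blast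
  define b h where "b l = fst (bh l)" and "h l = snd (bh l)" for l
  have bh: "\<phi> s l = b l + (\<Sum>j<m. h l j * s j)" if "l < n" "s \<in> dc m" for l s
    using bh' that by (simp add: b_def h_def)
  define H where "H s = (\<lambda>l\<in>{..<n}. \<Sum>j<m. h l j * s j)" for s :: "nat \<Rightarrow> int"
  have "H \<in> hom (int_lattice m) (int_lattice n)"
  proof (rule homI)
    show "H x \<in> carrier (int_lattice n)" for x
      by (simp add: H_def carrier_int_lattice)
    show "H (x \<otimes>\<^bsub>int_lattice m\<^esub> y) = H x \<otimes>\<^bsub>int_lattice n\<^esub> H y" for x y
    proof (rule ext)
      fix l
      have "(\<Sum>j<m. h l j * (\<lambda>i\<in>{..<m}. x i + y i) j) = (\<Sum>j<m. h l j * x j) + (\<Sum>j<m. h l j * y j)"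
        unfolding sum.distrib[symmetric] by (rule sum.cong) (auto simp: distrib_left)
      then show "H (x \<otimes>\<^bsub>int_lattice m\<^esub> y) l = (H x \<otimes>\<^bsub>int_lattice n\<^esub> H y) l"
        by (simp add: H_def mult_int_lattice)
    qed
  qed
  moreover have "\<phi> s = restrict b {..<n} \<otimes>\<^bsub>int_lattice n\<^esub> H s" if "s \<in> dc m" for s
    by (rule extensionalityI[of _ "{..<n}"])
      (use R that bh in \<open>auto simp: mult_int_lattice H_def discrete_cube_iff Pi_iff\<close>)
  moreover have "restrict b {..<n} \<in> carrier (int_lattice n)"
    by (simp add: carrier_int_lattice)
  ultimately show "cube_morphism m n \<phi>"
    unfolding cube_morphism_def using R by blast
qed

lemma cube_morphismI:
  assumes "\<And>s. s \<in> dc m \<Longrightarrow> \<phi> s \<in> dc n" "\<And>l. l < n \<Longrightarrow> affine_fun m (\<lambda>s. \<phi> s l)"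
  shows "cube_morphism m n \<phi>"
  using assms by (auto simp: cube_morphism_iff)

lemma cube_morphism_in: "cube_morphism m n \<phi> \<Longrightarrow> s \<in> dc m \<Longrightarrow> \<phi> s \<in> dc n"
  by (auto simp: cube_morphism_iff)

lemma face_map_morphism: "i < n \<Longrightarrow> cube_morphism (n - 1) n (face_map n i)"
proof (rule cube_morphismI)
  fix s assume "i < n" "s \<in> dc (n - 1)"
  then show "face_map n i s \<in> dc n"
    by (auto simp: face_map_def discrete_cube_iff)
next
  fix l assume *: "i < n" "l < n"
  consider "l < i" | "l = i" | "l > i" by linarith
  then show "affine_fun (n - 1) (\<lambda>s. face_map n i s l)"
    by cases (use * in \<open>simp_all add: face_map_def\<close>)
qed

text \<open>As long as an affine function with values in \<open>[0, N]\<close> is not constant, some coordinate function \<open>s\<^sub>j\<close>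
  or \<open>1 - s\<^sub>j\<close> can be split off without leaving \<open>[0, N - 1]\<close>; from a constant, split off \<open>0\<close> or \<open>1\<close>.\<close>

lemma affine_fun_split:
  assumes "finite J" "affine_fun m g" "\<And>s. s \<in> dc m \<Longrightarrow> 0 \<le> g s \<and> g s \<le> int (card J)"
  shows "\<exists>\<phi>. (\<forall>j\<in>J. affine_fun m (\<phi> j) \<and> (\<forall>s\<in>dc m. \<phi> j s = 0 \<or> \<phi> j s = 1)) \<and>
           (\<forall>s\<in>dc m. g s = (\<Sum>j\<in>J. \<phi> j s))"
  using assms
proof (induction J arbitrary: g)
  case empty
  then show ?case by force
next
  case (insert x J)
  obtain b h where g: "\<And>s. s \<in> dc m \<Longrightarrow> g s = b + (\<Sum>j<m. h j * s j)"
    using insert.prems(1) unfolding affine_fun_def by blast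
  have flip: "g (s(i := 1)) = g (s(i := 0)) + h i" if s: "s \<in> dc m" "i < m" for s i
  proof -
    have "(\<Sum>j<m. h j * (s(i := a)) j) = h i * a + (\<Sum>j\<in>{..<m} - {i}. h j * s j)" for a
      using s(2) by (subst sum.remove[of _ i]) auto
    then show ?thesis
      using s by (simp add: g discrete_cube_upd)
  qed
  have cardx: "int (card (insert x J)) = int (card J) + 1"
    using insert.hyps by simp
  have "\<exists>\<psi>. affine_fun m \<psi> \<and> (\<forall>s\<in>dc m. \<psi> s = 0 \<or> \<psi> s = 1) \<and>
          (\<forall>s\<in>dc m. 0 \<le> g s - \<psi> s \<and> g s - \<psi> s \<le> int (card J))"
  proof (cases "\<forall>i<m. h i = 0")
    case True
    then have "g s = b" if "s \<in> dc m" for s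
      using g[OF that] by simp
    moreover have "0 \<le> b \<and> b \<le> int (card J) + 1"
      using insert.prems(2)[OF top_vertex_in] insert.hyps calculation[OF top_vertex_in] by simp
    ultimately show ?thesis
      by (intro exI[of _ "\<lambda>_. if b > 0 then 1 else 0"]) auto
  next
    case False
    then obtain i where i: "i < m" "h i \<noteq> 0" by blast
    define \<psi> :: "(nat \<Rightarrow> int) \<Rightarrow> int" where "\<psi> s = (if h i > 0 then s i else 1 - s i)" for s
    have "affine_fun m \<psi>"
      using i by (cases "h i > 0") (simp_all add: \<psi>_def[abs_def])
    moreover have "(\<psi> s = 0 \<or> \<psi> s = 1) \<and> 0 \<le> g s - \<psi> s \<and> g s - \<psi> s \<le> int (card J)"
      if s: "s \<in> dc m" for s
    proof -
      have b0: "0 \<le> g (s(i := a)) \<and> g (s(i := a)) \<le> int (card J) + 1" if "a = 0 \<or> a = 1" for a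
        unfolding cardx[symmetric] by (rule insert.prems(2)[OF discrete_cube_upd[OF s i(1) that]])
      have "s(i := s i) = s" by simp
      then show ?thesis
        using discrete_cube_cases[OF s i(1)] flip[OF s i(1)] b0[of 0] b0[of 1] i(2)
        unfolding \<psi>_def by (smt (verit))
    qed
    ultimately show ?thesis by blast
  qed
  then obtain \<psi> where \<psi>: "affine_fun m \<psi>" "\<forall>s\<in>dc m. \<psi> s = 0 \<or> \<psi> s = 1"
    "\<And>s. s\<in>dc m \<Longrightarrow> 0 \<le> g s - \<psi> s \<and> g s - \<psi> s \<le> int (card J)"
    by blast
  obtain \<phi> where \<phi>: "\<forall>j\<in>J. affine_fun m (\<phi> j) \<and> (\<forall>s\<in>dc m. \<phi> j s = 0 \<or> \<phi> j s = 1)"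
      "\<forall>s\<in>dc m. g s - \<psi> s = (\<Sum>j\<in>J. \<phi> j s)"
    using insert.IH[of "\<lambda>s. g s - \<psi> s", OF _ \<psi>(3)] insert.prems(1) \<psi>(1) by auto
  have "\<forall>s\<in>dc m. g s = (\<Sum>j\<in>insert x J. (\<phi>(x := \<psi>)) j s)"
  proof
    fix s assume "s \<in> dc m"
    moreover have "(\<Sum>j\<in>J. (\<phi>(x := \<psi>)) j s) = (\<Sum>j\<in>J. \<phi> j s)"
      by (rule sum.cong) (use insert.hyps in auto)
    ultimately show "g s = (\<Sum>j\<in>insert x J. (\<phi>(x := \<psi>)) j s)"
      using insert.hyps \<phi>(2) by (simp add: algebra_simps)
  qed
  with \<phi>(1) \<psi>(1,2) show ?case
    by (intro exI[of _ "\<phi>(x := \<psi>)"]) auto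
qed

section \<open>Extending partial morphisms on a lattice\<close>

text \<open>The rank of an integer is its position in the enumeration \<open>0, 1, -1, 2, -2, \<dots>\<close>. Every initial
  segment of this enumeration is an interval having its last element as an endpoint.\<close>

definition zrank :: "int \<Rightarrow> nat" where
  "zrank v = (if v > 0 then nat (2 * v - 1) else nat (- 2 * v))"

text \<open>By the choice of the enumeration this is a product of intervals. It has \<open>v\<close> as a vertex, and \<open>v\<close> is its
  only point of maximal rank sum.\<close>

definition lattice_box :: "nat \<Rightarrow> (nat \<Rightarrow> int) \<Rightarrow> (nat \<Rightarrow> int) set" where
  "lattice_box n v = {u \<in> carrier (int_lattice n). \<forall>l<n. zrank (u l) \<le> zrank (v l)}"

text \<open>The direction pointing to \<open>v\<close> from the rest of the interval \<open>{u. zrank u \<le> zrank v}\<close>.\<close>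

definition zsign :: "int \<Rightarrow> int" where
  "zsign v = (if v > 0 then 1 else - 1)"

lemma zrank_le_iff:
  "zrank u \<le> zrank w \<longleftrightarrow> 0 \<le> zsign w * (w - u) \<and> zsign w * (w - u) \<le> int (zrank w)"
  unfolding zrank_def zsign_def by (auto split: if_splits)

lemma zrank_inject: "zrank u = zrank w \<Longrightarrow> u = w"
proof -
  assume eq: "zrank u = zrank w"
  have *: "int (zrank x) = (if x > 0 then 2 * x - 1 else - 2 * x)" for x
    by (simp add: zrank_def)
  show "u = w"
    using arg_cong[OF eq, of int] unfolding * by (simp split: if_splits) presburger+
qed

lemma zrank_0 [simp]: "zrank 0 = 0"
  by (simp add: zrank_def)

lemma zrank_uminus_int: "zrank (- int k) = 2 * k"
  by (simp add: zrank_def)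

lemma zrank_1 [simp]: "zrank 1 = 1"
  by (simp add: zrank_def)

lemma zrank_eq_0_iff [simp]: "zrank u = 0 \<longleftrightarrow> u = 0"
  using zrank_inject[of u 0] by auto

lemma zrank_le_1_iff: "zrank u \<le> 1 \<longleftrightarrow> u = 0 \<or> u = 1"
  unfolding zrank_def by auto

lemma zrank_pred: "w \<noteq> 0 \<Longrightarrow> \<exists>w'. zrank w' = zrank w - 1"
  by (intro exI[of _ "if w > 0 then 1 - w else - w"]) (auto simp: zrank_def split: if_splits)

lemma lattice_box_refl: "v \<in> carrier (int_lattice n) \<Longrightarrow> v \<in> lattice_box n v"
  by (simp add: lattice_box_def)

lemma lattice_box_rank:
  assumes "u \<in> lattice_box n v" "v \<in> carrier (int_lattice n)" "u \<noteq> v"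
  shows "(\<Sum>l<n. zrank (u l)) < (\<Sum>l<n. zrank (v l))"
proof -
  obtain l where l: "l < n" "u l \<noteq> v l"
    using assms extensionalityI[of u "{..<n}" v]
    by (auto simp: lattice_box_def carrier_int_lattice PiE_iff)
  show ?thesis
    by (rule sum_strict_mono_ex1)
      (use assms l zrank_inject[of "u l" "v l"] in \<open>auto simp: lattice_box_def le_less\<close>)
qed

text \<open>In other words, the restriction of \<open>f\<close> to the box of \<open>v\<close> is a morphism, where the cubes of the box are
  the affine maps into it.\<close>

definition good_at ::
  "(nat \<Rightarrow> ((nat \<Rightarrow> int) \<Rightarrow> 'a) set) \<Rightarrow> nat \<Rightarrow> ((nat \<Rightarrow> int) \<Rightarrow> 'a) \<Rightarrow> (nat \<Rightarrow> int) \<Rightarrow> bool" where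
  "good_at C n f v \<longleftrightarrow>
     (\<forall>m a. a \<in> dc m \<rightarrow> lattice_box n v \<longrightarrow> (\<forall>l<n. affine_fun m (\<lambda>s. a s l)) \<longrightarrow>
        restrict (f \<circ> a) (dc m) \<in> C m)"

lemma good_atD:
  assumes "good_at C n f v" "\<And>s. s \<in> dc m \<Longrightarrow> a s \<in> lattice_box n v"
    "\<And>l. l < n \<Longrightarrow> affine_fun m (\<lambda>s. a s l)"
  shows "(\<lambda>s\<in>dc m. f (a s)) \<in> C m"
  using assms(1)[unfolded good_at_def, rule_format, of a m] assms(2,3) by (auto simp: comp_def)

lemma good_at_cong:
  assumes "\<And>u. u \<in> lattice_box n v \<Longrightarrow> f u = g u"
  shows "good_at C n f v \<longleftrightarrow> good_at C n g v"
proof -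
  have "restrict (f \<circ> a) (dc m) = restrict (g \<circ> a) (dc m)" if "a \<in> dc m \<rightarrow> lattice_box n v" for a m
    using that assms by (intro restrict_ext) (auto simp: Pi_iff)
  then show ?thesis
    unfolding good_at_def by metis
qed

text \<open>Splits the coordinates of \<open>{0,1}\<^sup>N\<close> into \<open>n\<close> blocks of prescribed lengths, one for each direction of a box.\<close>

lemma ex_block_map:
  "\<exists>\<beta> :: nat \<Rightarrow> nat. \<beta> \<in> {..<\<Sum>l<n. r l} \<rightarrow> {..<n} \<and>
     (\<forall>l<n. card {j. j < (\<Sum>l<n. r l) \<and> \<beta> j = l} = r l)"
proof -
  define M where "M = (SIGMA l:{..<n}. {..<r l :: nat})"
  have fin: "finite M" and card: "card M = (\<Sum>l<n. r l)"
    by (auto simp: M_def)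
  then obtain h where h: "bij_betw h {0..<\<Sum>l<n. r l} M"
    using ex_bij_betw_nat_finite[OF fin] by auto
  have "card {j. j < (\<Sum>l<n. r l) \<and> (fst \<circ> h) j = l} = r l" if "l < n" for l
  proof -
    have "h ` {j. j < (\<Sum>l<n. r l) \<and> (fst \<circ> h) j = l} = {l} \<times> {..<r l}"
    proof (intro equalityI subsetI)
      fix x assume "x \<in> h ` {j. j < (\<Sum>l<n. r l) \<and> (fst \<circ> h) j = l}"
      then obtain j where j: "j < (\<Sum>l<n. r l)" "x = h j" "fst x = l" by auto
      then have "x \<in> M" using h by (auto simp: bij_betw_def)
      with j show "x \<in> {l} \<times> {..<r l}" by (auto simp: M_def)
    next
      fix x assume x: "x \<in> {l} \<times> {..<r l}"
      then have "x \<in> M" using that by (auto simp: M_def)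
      then have "x \<in> h ` {0..<\<Sum>l<n. r l}"
        using bij_betw_imp_surj_on[OF h] by blast
      then obtain j where "j < (\<Sum>l<n. r l)" "x = h j" by auto
      with x show "x \<in> h ` {j. j < (\<Sum>l<n. r l) \<and> (fst \<circ> h) j = l}"
        by auto
    qed
    then have im: "card (h ` {j. j < (\<Sum>l<n. r l) \<and> (fst \<circ> h) j = l}) = r l" by simp
    have inj: "inj_on h {j. j < (\<Sum>l<n. r l) \<and> (fst \<circ> h) j = l}"
      by (rule inj_on_subset[OF bij_betw_imp_inj_on[OF h]]) auto
    show ?thesis
      using card_image[OF inj] unfolding im by (rule sym)
  qed
  moreover have "(fst \<circ> h) \<in> {..<\<Sum>l<n. r l} \<rightarrow> {..<n}"
  proof
    fix j assume "j \<in> {..<\<Sum>l<n. r l}"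
    then have "h j \<in> M" using h by (auto simp: bij_betw_def)
    then show "(fst \<circ> h) j \<in> {..<n}" by (auto simp: M_def)
  qed
  ultimately show ?thesis by blast
qed

context nilspace
begin

lemma cube_compose: "c \<in> C n \<Longrightarrow> cube_morphism m n \<phi> \<Longrightarrow> (\<lambda>s\<in>dc m. c (\<phi> s)) \<in> C m"
  using composition[of c n m \<phi>] by (simp add: comp_def)

lemma cube_in: "c \<in> C n \<Longrightarrow> s \<in> dc n \<Longrightarrow> c s \<in> X"
  using cubes by blast

lemma cube_ext: "c \<in> C n \<Longrightarrow> c \<in> extensional (dc n)"
  using subsetD[OF cubes] by (metis PiE_iff)

lemma const_cube: "x \<in> X \<Longrightarrow> (\<lambda>s\<in>dc n. x) \<in> C n"
proof -
  assume "x \<in> X"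
  then have "(\<lambda>s\<in>dc 1. x) \<in> C 1" by (subst ergodicity) auto
  moreover have "cube_morphism n 1 (\<lambda>s. top_vertex 1)"
    by (rule cube_morphismI) auto
  ultimately show ?thesis
    using cube_compose by fastforce
qed

lemma corner_completion:
  assumes "\<And>s. s \<in> dc n \<Longrightarrow> s \<noteq> top_vertex n \<Longrightarrow> g s \<in> X"
    and "\<And>i. i < n \<Longrightarrow> (\<lambda>s\<in>dc (n - 1). g (face_map n i s)) \<in> C (n - 1)"
  shows "\<exists>y. (\<lambda>s\<in>dc n. if s = top_vertex n then y else g s) \<in> C n"
proof -
  let ?c = "\<lambda>s\<in>dc n - {top_vertex n}. g s"
  have "corner X C n ?c"
    unfolding corner_def
  proof (intro conjI allI impI)
    show "?c \<in> (dc n - {top_vertex n}) \<rightarrow>\<^sub>E X" using assms(1) by auto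
  next
    fix i assume i: "i < n"
    have "face_map n i s \<in> dc n \<and> face_map n i s \<noteq> top_vertex n" if "s \<in> dc (n - 1)" for s
    proof -
      have "face_map n i s i = 0" using i by (simp add: face_map_def)
      moreover have "top_vertex n i = 1" using i by (simp add: top_vertex_def)
      ultimately show ?thesis
        using cube_morphism_in[OF face_map_morphism[OF i] that] by auto
    qed
    then have "restrict (?c \<circ> face_map n i) (dc (n - 1)) = (\<lambda>s\<in>dc (n - 1). g (face_map n i s))"
      by (auto intro!: restrict_ext)
    then show "restrict (?c \<circ> face_map n i) (dc (n - 1)) \<in> C (n - 1)"
      using assms(2)[OF i] by simp
  qed
  then obtain c where c: "c \<in> C n" "restrict c (dc n - {top_vertex n}) = ?c"
    using completion unfolding completes_def by blast
  have "c = (\<lambda>s\<in>dc n. if s = top_vertex n then c (top_vertex n) else g s)"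
  proof (rule extensionalityI[OF cube_ext[OF c(1)]])
    fix s assume "s \<in> dc n"
    then show "c s = (\<lambda>s\<in>dc n. if s = top_vertex n then c (top_vertex n) else g s) s"
      using fun_cong[OF c(2), of s] by auto
  qed auto
  with c(1) show ?thesis by metis
qed

text \<open>The box of \<open>v\<close> is the image of a cube \<open>{0,1}\<^sup>N\<close> under an affine map \<open>\<kappa>\<close> which sends only \<open>1\<^sup>N\<close> to
  \<open>v\<close>, so that a value at \<open>v\<close> amounts to a completion of an \<open>N\<close>-corner; and every affine cube in the
  box factors through \<open>\<kappa>\<close>.\<close>

lemma one_point_extension:
  assumes v: "v \<in> carrier (int_lattice n)"
    and f: "\<And>u. u \<in> lattice_box n v \<Longrightarrow> u \<noteq> v \<Longrightarrow> good_at C n f u"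
  shows "\<exists>y. good_at C n (f(v := y)) v"
proof -
  define N where "N = (\<Sum>l<n. zrank (v l))"
  obtain \<beta> :: "nat \<Rightarrow> nat" where \<beta>: "\<And>j. j < N \<Longrightarrow> \<beta> j < n"
    and card\<beta>: "\<And>l. l < n \<Longrightarrow> card {j. j < N \<and> \<beta> j = l} = zrank (v l)"
    using ex_block_map[where n = n and r = "\<lambda>l. zrank (v l)"] unfolding N_def by blast
  define J where "J l = {j. j < N \<and> \<beta> j = l}" for l
  have finJ: "finite (J l)" for l by (simp add: J_def)
  have cardJ: "l < n \<Longrightarrow> card (J l) = zrank (v l)" for l
    using card\<beta> by (simp add: J_def)
  \<comment> \<open>In direction \<open>l\<close>, \<open>\<kappa>\<close> starts at the end of the interval opposite to \<open>v l\<close> and moves one step towards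
    \<open>v l\<close> for each coordinate of block \<open>l\<close> which equals \<open>1\<close>.\<close>
  define \<kappa> where "\<kappa> s = (\<lambda>l\<in>{..<n}. v l - zsign (v l) * (int (zrank (v l)) - (\<Sum>j\<in>J l. s j)))"
    for s :: "nat \<Rightarrow> int"
  have zz: "zsign x * zsign x = 1" for x by (simp add: zsign_def)
  have sgk: "zsign (v l) * (v l - \<kappa> s l) = int (zrank (v l)) - (\<Sum>j\<in>J l. s j)" if "l < n" for s l
  proof -
    have "zsign (v l) * (v l - \<kappa> s l) = (zsign (v l) * zsign (v l)) * (int (zrank (v l)) - (\<Sum>j\<in>J l. s j))"
      using that by (simp add: \<kappa>_def)
    then show ?thesis by (simp add: zz)
  qed
  have sumJ: "0 \<le> (\<Sum>j\<in>J l. s j) \<and> (\<Sum>j\<in>J l. s j) \<le> int (zrank (v l))" if "s \<in> dc N" "l < n" for s l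
  proof -
    have s01: "0 \<le> s j \<and> s j \<le> 1" if "j \<in> J l" for j
      using discrete_cube_cases[OF \<open>s \<in> dc N\<close>, of j] that by (auto simp: J_def)
    have "(\<Sum>j\<in>J l. s j) \<le> (\<Sum>j\<in>J l. 1)"
      by (rule sum_mono) (use s01 in auto)
    then show ?thesis using cardJ[OF that(2)] sum_nonneg[of "J l" s] s01 by auto
  qed
  have \<kappa>_carrier: "\<kappa> s \<in> carrier (int_lattice n)" for s
    by (simp add: \<kappa>_def carrier_int_lattice)
  have \<kappa>_box: "\<kappa> s \<in> lattice_box n v" if "s \<in> dc N" for s
    using \<kappa>_carrier sgk sumJ[OF that] by (auto simp: lattice_box_def zrank_le_iff)
  have \<kappa>_lower: "\<kappa> s (\<beta> j) \<noteq> v (\<beta> j)" if "s \<in> dc N" "j < N" "s j = 0" for s j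
  proof
    assume eq: "\<kappa> s (\<beta> j) = v (\<beta> j)"
    have jJ: "j \<in> J (\<beta> j)" using that by (simp add: J_def)
    have s1: "s i \<le> 1" if "i \<in> J (\<beta> j)" for i
      using discrete_cube_cases[OF \<open>s \<in> dc N\<close>, of i] that by (auto simp: J_def)
    have "(\<Sum>i\<in>J (\<beta> j). s i) < (\<Sum>i\<in>J (\<beta> j). 1)"
      by (rule sum_strict_mono_ex1) (use s1 jJ that finJ in \<open>auto intro!: bexI[of _ j]\<close>)
    then show False
      using sgk[OF \<beta>[OF that(2)], of s] eq cardJ[OF \<beta>[OF that(2)]] by simp
  qed
  have \<kappa>_neq: "\<kappa> s \<noteq> v" if "s \<in> dc N" "s \<noteq> top_vertex N" for s
    using eq_top_vertex_iff[OF that(1)] that \<kappa>_lower[OF that(1)] discrete_cube_cases[OF that(1)] by metis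
  have \<kappa>_affine: "affine_fun N (\<lambda>s. \<kappa> s l)" if "l < n" for l
  proof -
    have "affine_fun N (\<lambda>s. v l - zsign (v l) * (int (zrank (v l)) - (\<Sum>j\<in>J l. s j)))"
      by (intro affine_fun_diff affine_fun_mult affine_fun_sum affine_fun_const affine_fun_coord)
        (auto simp: J_def)
    then show ?thesis using that by (simp add: \<kappa>_def)
  qed
  have "\<exists>y. (\<lambda>s\<in>dc N. if s = top_vertex N then y else f (\<kappa> s)) \<in> C N"
  proof (rule corner_completion)
    fix s assume s: "s \<in> dc N" "s \<noteq> top_vertex N"
    have "good_at C n f (\<kappa> s)" using f \<kappa>_box \<kappa>_neq s by blast
    then have "(\<lambda>_\<in>dc 0. f (\<kappa> s)) \<in> C 0"
      by (rule good_atD) (use lattice_box_refl[OF \<kappa>_carrier] in auto)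
    then show "f (\<kappa> s) \<in> X" using cube_in[of _ 0 "top_vertex 0"] by fastforce
  next
    fix i assume i: "i < N"
    have b: "\<beta> i < n" using \<beta>[OF i] .
    have "J (\<beta> i) \<noteq> {}" using i by (auto simp: J_def)
    then have "zrank (v (\<beta> i)) \<noteq> 0" using cardJ[OF b] finJ by (metis card_0_eq)
    then obtain w where w: "zrank w = zrank (v (\<beta> i)) - 1" "zrank w < zrank (v (\<beta> i))"
      using zrank_pred[of "v (\<beta> i)"] by auto
    \<comment> \<open>Fixing a coordinate of block \<open>\<beta> i\<close> to be \<open>0\<close> removes the endpoint \<open>v (\<beta> i)\<close> from the interval, and
      what remains is the interval of the preceding rank.\<close>
    define u where "u = v(\<beta> i := w)"
    have u: "u \<in> lattice_box n v" "u \<noteq> v"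
      using w v b by (auto simp: u_def lattice_box_def carrier_int_lattice PiE_iff extensional_def fun_eq_iff)
    have "\<kappa> (face_map N i s) \<in> lattice_box n u" if s: "s \<in> dc (N - 1)" for s
    proof -
      let ?t = "face_map N i s"
      have t: "?t \<in> dc N" using cube_morphism_in[OF face_map_morphism[OF i] s] .
      have "\<kappa> ?t (\<beta> i) \<noteq> v (\<beta> i)"
        by (rule \<kappa>_lower[OF t i]) (use i in \<open>simp add: face_map_def\<close>)
      then have "zrank (\<kappa> ?t (\<beta> i)) \<noteq> zrank (v (\<beta> i))"
        using zrank_inject by blast
      then show ?thesis
        using \<kappa>_box[OF t] w b by (auto simp: lattice_box_def u_def)
    qed
    moreover have "affine_fun (N - 1) (\<lambda>s. \<kappa> (face_map N i s) l)" if "l < n" for l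
      by (rule affine_fun_compose[OF \<kappa>_affine[OF that]])
        (use face_map_morphism[OF i] in \<open>auto simp: cube_morphism_iff\<close>)
    ultimately show "(\<lambda>s\<in>dc (N - 1). f (\<kappa> (face_map N i s))) \<in> C (N - 1)"
      by (intro good_atD[OF f[OF u]]) auto
  qed
  then obtain y where y: "(\<lambda>s\<in>dc N. if s = top_vertex N then y else f (\<kappa> s)) \<in> C N" by blast
  have \<kappa>_top: "\<kappa> (top_vertex N) = v"
  proof -
    have "(\<Sum>j\<in>J l. top_vertex N j) = int (card (J l))" for l
    proof -
      have "(\<Sum>j\<in>J l. top_vertex N j) = (\<Sum>j\<in>J l. 1)"
        by (rule sum.cong) (auto simp: top_vertex_def J_def)
      then show ?thesis by simp
    qed
    then show ?thesis
      using v cardJ by (auto simp: \<kappa>_def fun_eq_iff carrier_int_lattice PiE_iff extensional_def)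
  qed
  have "good_at C n (f(v := y)) v"
    unfolding good_at_def
  proof (intro allI impI)
    fix m a assume a: "a \<in> dc m \<rightarrow> lattice_box n v" and aff: "\<forall>l<n. affine_fun m (\<lambda>s. a s l)"
    define g where "g l s = int (zrank (v l)) - zsign (v l) * (v l - a s l)" for l s
    have "\<exists>\<phi>. (\<forall>j\<in>J l. affine_fun m (\<phi> j) \<and> (\<forall>s\<in>dc m. \<phi> j s = 0 \<or> \<phi> j s = 1)) \<and>
           (\<forall>s\<in>dc m. g l s = (\<Sum>j\<in>J l. \<phi> j s))" if "l < n" for l
    proof (rule affine_fun_split[OF finJ])
      show "affine_fun m (g l)" using aff that by (auto simp: g_def[abs_def])
    next
      fix s assume "s \<in> dc m"
      then have "zrank (a s l) \<le> zrank (v l)" using a that by (auto simp: lattice_box_def)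
      then show "0 \<le> g l s \<and> g l s \<le> int (card (J l))"
        unfolding zrank_le_iff g_def cardJ[OF that] by linarith
    qed
    then obtain \<Phi> where \<Phi>: "\<And>l. l < n \<Longrightarrow> (\<forall>j\<in>J l. affine_fun m (\<Phi> l j) \<and> (\<forall>s\<in>dc m. \<Phi> l j s = 0 \<or> \<Phi> l j s = 1)) \<and>
           (\<forall>s\<in>dc m. g l s = (\<Sum>j\<in>J l. \<Phi> l j s))"
      by metis
    define \<phi> where "\<phi> s = (\<lambda>j\<in>{..<N}. \<Phi> (\<beta> j) j s)" for s
    have J\<beta>: "j < N \<Longrightarrow> j \<in> J (\<beta> j)" for j by (simp add: J_def)
    have mor: "cube_morphism m N \<phi>"
      by (rule cube_morphismI) (use \<Phi>[OF \<beta>] J\<beta> in \<open>auto simp: \<phi>_def\<close>)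
    have fac: "\<kappa> (\<phi> s) = a s" if s: "s \<in> dc m" for s
    proof (rule extensionalityI[of _ "{..<n}"])
      show "\<kappa> (\<phi> s) \<in> extensional {..<n}" "a s \<in> extensional {..<n}"
        using a s by (auto simp: \<kappa>_def lattice_box_def carrier_int_lattice PiE_iff Pi_iff)
    next
      fix l assume "l \<in> {..<n}"
      then have l: "l < n" by simp
      have "(\<Sum>j\<in>J l. \<phi> s j) = (\<Sum>j\<in>J l. \<Phi> l j s)"
        by (rule sum.cong) (auto simp: \<phi>_def J_def)
      moreover have gs: "g l s = (\<Sum>j\<in>J l. \<Phi> l j s)"
        using \<Phi>[OF l] s by blast
      ultimately have "zsign (v l) * (v l - \<kappa> (\<phi> s) l) = zsign (v l) * (v l - a s l)"
        using sgk[OF l, of "\<phi> s"] gs unfolding g_def by linarith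
      then show "\<kappa> (\<phi> s) l = a s l" by (simp add: zsign_def split: if_splits)
    qed
    have "restrict (f(v := y) \<circ> a) (dc m) =
        (\<lambda>s\<in>dc m. (\<lambda>s\<in>dc N. if s = top_vertex N then y else f (\<kappa> s)) (\<phi> s))"
    proof (rule restrict_ext)
      fix s assume s: "s \<in> dc m"
      have "\<phi> s \<in> dc N" using cube_morphism_in[OF mor s] .
      then show "(f(v := y) \<circ> a) s = (\<lambda>s\<in>dc N. if s = top_vertex N then y else f (\<kappa> s)) (\<phi> s)"
        using fac[OF s] \<kappa>_neq[of "\<phi> s"] \<kappa>_top by auto
    qed
    then show "restrict (f(v := y) \<circ> a) (dc m) \<in> C m"
      using cube_compose[OF y mor] by simp
  qed
  then show ?thesis by blast
qed

text \<open>The values off \<open>D\<close> are chosen by well-founded recursion on the sum of the ranks of the coordinates, using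
  \<open>one_point_extension\<close>. Every affine cube in \<open>\<int>\<^sup>n\<close> lies in the box of some \<open>v\<close>.\<close>

theorem lattice_extension:
  assumes D: "D \<subseteq> carrier (int_lattice n)" "\<And>v. v \<in> D \<Longrightarrow> lattice_box n v \<subseteq> D"
    and f: "\<And>v. v \<in> D \<Longrightarrow> good_at C n f v"
  obtains F where "\<And>v. v \<in> D \<Longrightarrow> F v = f v"
    "\<And>m a. a \<in> dc m \<rightarrow> carrier (int_lattice n) \<Longrightarrow> (\<And>l. l < n \<Longrightarrow> affine_fun m (\<lambda>s. a s l)) \<Longrightarrow>
       (\<lambda>s\<in>dc m. F (a s)) \<in> C m"
proof -
  define Zn where "Zn = carrier (int_lattice n)"
  define R where "R = {(u, v). v \<in> Zn \<and> u \<in> lattice_box n v \<and> u \<noteq> v}"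
  define P where "P F v y \<longleftrightarrow> v \<in> Zn \<longrightarrow> (v \<in> D \<longrightarrow> y = f v) \<and> good_at C n (F(v := y)) v"
    for F :: "(nat \<Rightarrow> int) \<Rightarrow> 'a" and v y
  have "wf R"
    by (rule wf_subset[OF wf_measure[of "\<lambda>v. \<Sum>l<n. zrank (v l)"]])
      (auto simp: R_def Zn_def intro: lattice_box_rank)
  then have "\<exists>F. \<forall>v. P F v (F v)"
  proof (rule dependent_wf_choice)
    fix F G :: "(nat \<Rightarrow> int) \<Rightarrow> 'a" and v y
    assume "\<And>u. (u, v) \<in> R \<Longrightarrow> F u = G u"
    then have "v \<in> Zn \<Longrightarrow> good_at C n (F(v := y)) v = good_at C n (G(v := y)) v"
      by (intro good_at_cong) (auto simp: R_def)
    then show "P F v y = P G v y" by (auto simp: P_def)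
  next
    fix F :: "(nat \<Rightarrow> int) \<Rightarrow> 'a" and v
    assume H: "\<And>u. (u, v) \<in> R \<Longrightarrow> P F u (F u)"
    show "\<exists>y. P F v y"
    proof (cases "v \<in> Zn")
      case v: True
      have H': "good_at C n F u \<and> (u \<in> D \<longrightarrow> F u = f u)" if "u \<in> lattice_box n v" "u \<noteq> v" for u
        using H[of u] that v by (simp add: R_def P_def Zn_def lattice_box_def)
      show ?thesis
      proof (cases "v \<in> D")
        case True
        have "good_at C n (F(v := f v)) v \<longleftrightarrow> good_at C n f v"
          using D(2)[OF True] H' by (intro good_at_cong) auto
        then show ?thesis using f[OF True] by (auto simp: P_def)
      next
        case False
        then show ?thesis
          using one_point_extension[of v n F] H' v unfolding P_def Zn_def by blast
      qed
    qed (simp add: P_def)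
  qed
  then obtain F where F: "\<And>v. v \<in> Zn \<Longrightarrow> (v \<in> D \<longrightarrow> F v = f v) \<and> good_at C n F v"
    unfolding P_def by auto
  show thesis
  proof (rule that)
    show "F v = f v" if "v \<in> D" for v using F D that by (auto simp: Zn_def)
  next
    fix m a assume a: "a \<in> dc m \<rightarrow> carrier (int_lattice n)" "\<And>l. l < n \<Longrightarrow> affine_fun m (\<lambda>s. a s l)"
    \<comment> \<open>The rank of \<open>-k\<close> is \<open>2 k\<close>, so the box of this \<open>v\<close> contains the image of \<open>a\<close>.\<close>
    define v where "v = (\<lambda>l\<in>{..<n}. - int (\<Sum>s\<in>dc m. zrank (a s l)))"
    have "zrank (a s l) \<le> zrank (v l)" if "s \<in> dc m" "l < n" for s l
    proof -
      have "zrank (a s l) \<le> (\<Sum>s\<in>dc m. zrank (a s l))"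
        using that by (intro member_le_sum) auto
      also have "\<dots> \<le> zrank (- int (\<Sum>s\<in>dc m. zrank (a s l)))"
        by (subst zrank_uminus_int) simp
      also have "\<dots> = zrank (v l)" using that by (simp add: v_def)
      finally show ?thesis .
    qed
    then have "a \<in> dc m \<rightarrow> lattice_box n v" using a(1) by (auto simp: lattice_box_def)
    moreover have "v \<in> Zn" by (simp add: v_def Zn_def carrier_int_lattice)
    ultimately show "(\<lambda>s\<in>dc m. F (a s)) \<in> C m"
      using F a(2) by (intro good_atD[of C n F v]) auto
  qed
qed

end

section \<open>Replacing vertices of cubes\<close>

lemma mult_sign_discrete_cube:
  "s \<in> dc n \<Longrightarrow> l < n \<Longrightarrow> \<sigma> = 1 \<or> \<sigma> = - 1 \<Longrightarrow> \<bar>\<sigma> * s l\<bar> = s l"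
  by (auto dest!: discrete_cube_cases)

text \<open>The projection of \<open>{0,1}\<^sup>n\<close> to the face on which the coordinates in \<open>L\<close> vanish.\<close>

definition zero_on :: "nat \<Rightarrow> nat set \<Rightarrow> (nat \<Rightarrow> int) \<Rightarrow> (nat \<Rightarrow> int)" where
  "zero_on n L s = (\<lambda>l\<in>{..<n}. if l \<in> L then 0 else s l)"

context nilspace
begin

lemma cube_compose_affine:
  assumes "c \<in> C n" "\<And>s l. s \<in> dc m \<Longrightarrow> l < n \<Longrightarrow> \<phi> s l = 0 \<or> \<phi> s l = 1"
    "\<And>l. l < n \<Longrightarrow> affine_fun m (\<lambda>s. \<phi> s l)"
    "\<And>s. s \<in> dc m \<Longrightarrow> g s = c (\<lambda>l\<in>{..<n}. \<phi> s l)"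
  shows "(\<lambda>s\<in>dc m. g s) \<in> C m"
proof -
  have "cube_morphism m n (\<lambda>s. \<lambda>l\<in>{..<n}. \<phi> s l)"
    using assms(2,3) by (intro cube_morphismI) auto
  from cube_compose[OF assms(1) this] have "(\<lambda>s\<in>dc m. c (\<lambda>l\<in>{..<n}. \<phi> s l)) \<in> C m" .
  moreover have "(\<lambda>s\<in>dc m. g s) = (\<lambda>s\<in>dc m. c (\<lambda>l\<in>{..<n}. \<phi> s l))"
    using assms(4) by (intro restrict_ext)
  ultimately show ?thesis by simp
qed

lemma restrict_cube: "c \<in> C n \<Longrightarrow> (\<And>s. s \<in> dc n \<Longrightarrow> c s = g s) \<Longrightarrow> (\<lambda>s\<in>dc n. g s) \<in> C n"
proof -
  assume c: "c \<in> C n" "\<And>s. s \<in> dc n \<Longrightarrow> c s = g s"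
  have "c = (\<lambda>s\<in>dc n. g s)"
    by (rule extensionalityI[OF cube_ext[OF c(1)]]) (use c(2) in auto)
  with c(1) show ?thesis by simp
qed

text \<open>The cube \<open>{-1,0,1}\<^sup>n\<close> embeds into \<open>{0,1}\<^sup>2\<^sup>n\<close> by encoding \<open>-1, 0, 1\<close> in a pair of coordinates as \<open>(1,0)\<close>,
  \<open>(0,0)\<close>, \<open>(0,1)\<close>. Its image \<open>D\<close> consists of the vectors having no pair \<open>(1,1)\<close>; it is closed downwards, and the
  maximal faces in it are the \<open>2\<^sup>n\<close> subcubes at the centre on which \<open>t\<close> is assumed to be a cube. So \<open>t\<close> extends
  to a cube on \<open>{0,1}\<^sup>2\<^sup>n\<close>, and the outer vertices form the image of the morphism \<open>s \<mapsto> (1 - s, s)\<close>.\<close>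

theorem tricube:
  assumes t: "\<And>\<sigma>. (\<And>l. l < n \<Longrightarrow> \<sigma> l = 1 \<or> \<sigma> l = - 1) \<Longrightarrow>
      (\<lambda>s\<in>dc n. t (\<lambda>l\<in>{..<n}. \<sigma> l * s l)) \<in> C n"
  shows "(\<lambda>s\<in>dc n. t (\<lambda>l\<in>{..<n}. 2 * s l - 1)) \<in> C n"
proof -
  define D where "D = {u \<in> dc (2 * n). \<forall>l<n. u l = 0 \<or> u (n + l) = 0}"
  define f where "f u = t (\<lambda>l\<in>{..<n}. u (n + l) - u l)" for u
  have dn: "u \<in> D" if "u \<in> lattice_box (2 * n) v" "v \<in> D" for u v
  proof -
    have le: "zrank (u l) \<le> zrank (v l)" if "l < 2 * n" for l
      using \<open>u \<in> lattice_box _ _\<close> that by (auto simp: lattice_box_def)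
    have "zrank (v l) \<le> 1" if "l < 2 * n" for l
      using \<open>v \<in> D\<close> discrete_cube_cases[of v "2 * n" l] that by (auto simp: D_def)
    then have "u l = 0 \<or> u l = 1" if "l < 2 * n" for l
      using le[OF that] that zrank_le_1_iff order_trans by blast
    moreover have "u \<in> extensional {..<2 * n}"
      using \<open>u \<in> lattice_box _ _\<close> by (auto simp: lattice_box_def carrier_int_lattice PiE_iff)
    moreover have "u l = 0 \<or> u (n + l) = 0" if "l < n" for l
      using le[of l] le[of "n + l"] \<open>v \<in> D\<close> that by (auto simp: D_def)
    ultimately show ?thesis by (auto simp: D_def discrete_cube_iff)
  qed
  have good: "good_at C (2 * n) f v" if v: "v \<in> D" for v
    unfolding good_at_def
  proof (intro allI impI)
    fix m a assume a: "a \<in> dc m \<rightarrow> lattice_box (2 * n) v" and aff: "\<forall>l<2*n. affine_fun m (\<lambda>s. a s l)"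
    define \<sigma> where "\<sigma> l = (if v l = 0 then 1 else - 1 :: int)" for l
    have aD: "a s \<in> D" if "s \<in> dc m" for s using dn[OF _ v] a that by auto
    have "(\<lambda>s\<in>dc m. f (a s)) \<in> C m"
    proof (rule cube_compose_affine[OF t[of \<sigma>]])
      show "\<sigma> l = 1 \<or> \<sigma> l = - 1" for l by (simp add: \<sigma>_def)
    next
      fix s l assume s: "s \<in> dc m" "l < n"
      then show "(if v l = 0 then a s (n + l) else a s l) = 0 \<or> (if v l = 0 then a s (n + l) else a s l) = 1"
        using discrete_cube_cases[of "a s" "2 * n"] aD[OF s(1)] by (auto simp: D_def)
    next
      fix l assume l: "l < n"
      show "affine_fun m (\<lambda>s. if v l = 0 then a s (n + l) else a s l)"
        using aff l by (cases "v l = 0") auto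
    next
      fix s assume s: "s \<in> dc m"
      have 1: "(\<lambda>l\<in>{..<n}. if v l = 0 then a s (n + l) else a s l) \<in> dc n"
        using discrete_cube_cases[of "a s" "2 * n"] aD[OF s(1)] by (auto simp: D_def)
      have "a s (n + l) - a s l = \<sigma> l * (if v l = 0 then a s (n + l) else a s l)" if "l < n" for l
      proof -
        have le: "zrank (a s j) \<le> zrank (v j)" if "j < 2 * n" for j
          using a s that by (auto simp: lattice_box_def)
        have "v l = 0 \<or> v (n + l) = 0" using v that by (auto simp: D_def)
        then show ?thesis
          using le[of l] le[of "n + l"] that by (auto simp: \<sigma>_def)
      qed
      then have "(\<lambda>l\<in>{..<n}. a s (n + l) - a s l) =
          (\<lambda>l\<in>{..<n}. \<sigma> l * (\<lambda>l\<in>{..<n}. if v l = 0 then a s (n + l) else a s l) l)"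
        by (intro restrict_ext) auto
      with 1 show "f (a s) = (\<lambda>s\<in>dc n. t (\<lambda>l\<in>{..<n}. \<sigma> l * s l))
         (\<lambda>l\<in>{..<n}. if v l = 0 then a s (n + l) else a s l)"
        unfolding f_def by simp
    qed
    then show "restrict (f \<circ> a) (dc m) \<in> C m" by (simp add: comp_def)
  qed
  have "D \<subseteq> carrier (int_lattice (2 * n))"
    using dc_subset_lattice by (auto simp: D_def)
  then obtain F where F: "\<And>v. v \<in> D \<Longrightarrow> F v = f v"
    "\<And>m a. a \<in> dc m \<rightarrow> carrier (int_lattice (2 * n)) \<Longrightarrow>
       (\<And>l. l < 2 * n \<Longrightarrow> affine_fun m (\<lambda>s. a s l)) \<Longrightarrow> (\<lambda>s\<in>dc m. F (a s)) \<in> C m"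
    using lattice_extension[of D "2 * n" f] dn good by blast
  define a where "a s = (\<lambda>l\<in>{..<2 * n}. if l < n then 1 - s l else s (l - n))" for s :: "nat \<Rightarrow> int"
  have aD: "a s \<in> D" if "s \<in> dc n" for s
    using discrete_cube_cases[OF that] by (auto simp: D_def a_def)
  have "(\<lambda>s\<in>dc n. F (a s)) \<in> C n"
  proof (rule F(2))
    show "a \<in> dc n \<rightarrow> carrier (int_lattice (2 * n))"
      by (auto simp: a_def carrier_int_lattice)
  next
    fix l assume "l < 2 * n"
    then show "affine_fun n (\<lambda>s. a s l)"
      by (cases "l < n") (auto simp: a_def)
  qed
  then show ?thesis
  proof (rule restrict_cube)
    fix s assume s: "s \<in> dc n"
    have "(\<lambda>l\<in>{..<n}. a s (n + l) - a s l) = (\<lambda>l\<in>{..<n}. 2 * s l - 1)"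
      by (rule restrict_ext) (auto simp: a_def)
    then show "(\<lambda>s\<in>dc n. F (a s)) s = t (\<lambda>l\<in>{..<n}. 2 * s l - 1)"
      using s F(1)[OF aD[OF s]] by (simp add: f_def)
  qed
qed

text \<open>All outer vertices of the tricube \<open>w \<mapsto> c(|w|)\<close> carry the value \<open>c(1,\<dots>,1)\<close>, and each of its subcubes is a
  copy of \<open>c\<close> with its top vertex outside. Replace one of these copies by \<open>c'\<close>.\<close>

lemma top_swap:
  assumes c: "c \<in> C n" "c' \<in> C n" and eq: "\<And>s. s \<in> dc n \<Longrightarrow> s \<noteq> top_vertex n \<Longrightarrow> c s = c' s"
  shows "(\<lambda>s\<in>dc n. if s = top_vertex n then c' (top_vertex n) else c (top_vertex n)) \<in> C n"
proof -
  define t where "t w = (if \<forall>l<n. w l = 1 then c' (top_vertex n) else c (\<lambda>l\<in>{..<n}. \<bar>w l\<bar>))"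
    for w :: "nat \<Rightarrow> int"
  have "(\<lambda>s\<in>dc n. t (\<lambda>l\<in>{..<n}. 2 * s l - 1)) \<in> C n"
  proof (rule tricube)
    fix \<sigma> :: "nat \<Rightarrow> int" assume \<sigma>: "\<And>l. l < n \<Longrightarrow> \<sigma> l = 1 \<or> \<sigma> l = - 1"
    have abs: "(\<lambda>l\<in>{..<n}. \<bar>(\<lambda>l\<in>{..<n}. \<sigma> l * s l) l\<bar>) = s" if "s \<in> dc n" for s
    proof (rule extensionalityI[of _ "{..<n}"])
      show "s \<in> extensional {..<n}" using that by (simp add: discrete_cube_iff)
    qed (use that mult_sign_discrete_cube \<sigma> in auto)
    show "(\<lambda>s\<in>dc n. t (\<lambda>l\<in>{..<n}. \<sigma> l * s l)) \<in> C n"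
    proof (cases "\<forall>l<n. \<sigma> l = 1")
      case True
      show ?thesis
      proof (rule restrict_cube[OF c(2)])
        fix s assume s: "s \<in> dc n"
        show "c' s = t (\<lambda>l\<in>{..<n}. \<sigma> l * s l)"
          using True abs[OF s] eq[OF s] eq_top_vertex_iff[OF s] unfolding t_def by auto
      qed
    next
      case False
      show ?thesis
      proof (rule restrict_cube[OF c(1)])
        fix s assume s: "s \<in> dc n"
        obtain l where l: "l < n" "\<sigma> l = - 1" using False \<sigma> by blast
        then have "\<sigma> l * s l \<noteq> 1" using discrete_cube_cases[OF s l(1)] by auto
        then have "\<not> (\<forall>l<n. (\<lambda>l\<in>{..<n}. \<sigma> l * s l) l = 1)"
          using l(1) by auto
        then show "c s = t (\<lambda>l\<in>{..<n}. \<sigma> l * s l)"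
          unfolding t_def abs[OF s] by (simp only: if_False)
      qed
    qed
  qed
  then show ?thesis
  proof (rule restrict_cube)
    fix s assume s: "s \<in> dc n"
    have "(\<lambda>l\<in>{..<n}. \<bar>(\<lambda>l\<in>{..<n}. 2 * s l - 1) l\<bar>) = top_vertex n"
      unfolding top_vertex_def by (rule restrict_ext) (use discrete_cube_cases[OF s] in force)
    moreover have "(\<forall>l<n. (\<lambda>l\<in>{..<n}. 2 * s l - 1) l = 1) \<longleftrightarrow> s = top_vertex n"
      using eq_top_vertex_iff[OF s] by auto
    ultimately show "(\<lambda>s\<in>dc n. t (\<lambda>l\<in>{..<n}. 2 * s l - 1)) s =
        (if s = top_vertex n then c' (top_vertex n) else c (top_vertex n))"
      using s unfolding t_def by simp
  qed
qed

text \<open>In the tricube \<open>w \<mapsto> c(max(w, 0))\<close> the outer vertices form the cube \<open>c\<close>. The vertices with \<open>w = -1\<close> on \<open>L\<close>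
  lie only in subcubes on which \<open>c\<close> is taken on the face \<open>s = 0\<close> on \<open>L\<close>, and the last assumption
  says that there they may be changed to \<open>d\<close>.\<close>

theorem face_replacement:
  assumes c: "c \<in> C n" and L: "L \<subseteq> {..<n}"
    and e: "(\<lambda>s\<in>dc n. if \<forall>l\<in>L. s l = 1 then d (zero_on n L s) else c (zero_on n L s)) \<in> C n"
  shows "(\<lambda>s\<in>dc n. if \<forall>l\<in>L. s l = 0 then d s else c s) \<in> C n"
proof -
  define pos where "pos w = (\<lambda>l\<in>{..<n}. max (w l) 0)" for w :: "nat \<Rightarrow> int"
  define t where "t w = (if \<forall>l\<in>L. w l = - 1 then d (pos w) else c (pos w))" for w
  have "(\<lambda>s\<in>dc n. t (\<lambda>l\<in>{..<n}. 2 * s l - 1)) \<in> C n"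
  proof (rule tricube)
    fix \<sigma> :: "nat \<Rightarrow> int" assume \<sigma>: "\<And>l. l < n \<Longrightarrow> \<sigma> l = 1 \<or> \<sigma> l = - 1"
    have pos: "pos (\<lambda>l\<in>{..<n}. \<sigma> l * s l) = (\<lambda>l\<in>{..<n}. if \<sigma> l = 1 then s l else 0)" if "s \<in> dc n" for s
      unfolding pos_def by (rule restrict_ext) (use \<sigma> discrete_cube_cases[OF that] in force)
    show "(\<lambda>s\<in>dc n. t (\<lambda>l\<in>{..<n}. \<sigma> l * s l)) \<in> C n"
    proof (cases "\<forall>l\<in>L. \<sigma> l = - 1")
      case True
      define \<psi> where "\<psi> s l = (if l \<in> L \<or> \<sigma> l = 1 then s l else 0)" for s :: "nat \<Rightarrow> int" and l
      show ?thesis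
      proof (rule cube_compose_affine[OF e, where \<phi> = \<psi>])
        fix s l assume "s \<in> dc n" "l < n"
        then show "\<psi> s l = 0 \<or> \<psi> s l = 1"
          using discrete_cube_cases by (auto simp: \<psi>_def)
      next
        fix l assume "l < n"
        then show "affine_fun n (\<lambda>s. \<psi> s l)"
          by (cases "l \<in> L \<or> \<sigma> l = 1") (auto simp: \<psi>_def)
      next
        fix s assume s: "s \<in> dc n"
        have \<psi>: "(\<lambda>l\<in>{..<n}. \<psi> s l) \<in> dc n"
          using discrete_cube_cases[OF s] by (auto simp: \<psi>_def)
        have 1: "zero_on n L (\<lambda>l\<in>{..<n}. \<psi> s l) = pos (\<lambda>l\<in>{..<n}. \<sigma> l * s l)"
          unfolding pos[OF s] zero_on_def by (rule restrict_ext) (use True in \<open>auto simp: \<psi>_def\<close>)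
        have 2: "(\<forall>l\<in>L. (\<lambda>l\<in>{..<n}. \<sigma> l * s l) l = - 1) \<longleftrightarrow> (\<forall>l\<in>L. (\<lambda>l\<in>{..<n}. \<psi> s l) l = 1)"
          using True L by (auto simp: \<psi>_def)
        show "t (\<lambda>l\<in>{..<n}. \<sigma> l * s l) =
          (\<lambda>s\<in>dc n. if \<forall>l\<in>L. s l = 1 then d (zero_on n L s) else c (zero_on n L s)) (\<lambda>l\<in>{..<n}. \<psi> s l)"
          unfolding t_def 2 restrict_apply'[OF \<psi>] 1 ..
      qed
    next
      case False
      then obtain l0 where l0: "l0 \<in> L" "l0 < n" "\<sigma> l0 = 1"
        using \<sigma> L by blast
      show ?thesis
      proof (rule cube_compose_affine[OF c, where \<phi> = "\<lambda>s l. if \<sigma> l = 1 then s l else 0"])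
        fix s l assume "s \<in> dc n" "l < n"
        then show "(if \<sigma> l = 1 then s l else 0) = 0 \<or> (if \<sigma> l = 1 then s l else 0) = 1"
          using discrete_cube_cases by auto
      next
        fix l assume "l < n"
        then show "affine_fun n (\<lambda>s. if \<sigma> l = 1 then s l else 0)"
          by (cases "\<sigma> l = 1") auto
      next
        fix s assume s: "s \<in> dc n"
        have "(\<lambda>l\<in>{..<n}. \<sigma> l * s l) l0 \<noteq> - 1"
          using l0 discrete_cube_cases[OF s l0(2)] by auto
        then show "t (\<lambda>l\<in>{..<n}. \<sigma> l * s l) = c (\<lambda>l\<in>{..<n}. if \<sigma> l = 1 then s l else 0)"
          using l0(1) unfolding t_def pos[OF s] by meson
      qed
    qed
  qed
  then show ?thesis
  proof (rule restrict_cube)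
    fix s assume s: "s \<in> dc n"
    have "pos (\<lambda>l\<in>{..<n}. 2 * s l - 1) = s"
    proof (rule extensionalityI[of _ "{..<n}"])
      fix l assume "l \<in> {..<n}"
      then show "pos (\<lambda>l\<in>{..<n}. 2 * s l - 1) l = s l"
        using discrete_cube_cases[OF s, of l] by (auto simp: pos_def)
    qed (use s in \<open>auto simp: pos_def discrete_cube_iff\<close>)
    moreover have "(\<forall>l\<in>L. (\<lambda>l\<in>{..<n}. 2 * s l - 1) l = - 1) \<longleftrightarrow> (\<forall>l\<in>L. s l = 0)"
      using L by auto
    ultimately show "(\<lambda>s\<in>dc n. t (\<lambda>l\<in>{..<n}. 2 * s l - 1)) s = (if \<forall>l\<in>L. s l = 0 then d s else c s)"
      using s unfolding t_def by simp
  qed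
qed

section \<open>The equivalence relations \<open>\<sim>\<^sub>k\<close>\<close>

abbreviation rel :: "nat \<Rightarrow> ('a \<times> 'a) set" where
  "rel \<equiv> factor_rel X C"

lemma rel_iff:
  "(x, y) \<in> rel k \<longleftrightarrow> x \<in> X \<and> y \<in> X \<and>
     (\<lambda>v\<in>dc (k + 1). if v = top_vertex (k + 1) then y else x) \<in> C (k + 1)"
  by (auto simp: factor_rel_def)

lemma rel_refl: "x \<in> X \<Longrightarrow> (x, x) \<in> rel k"
  using const_cube[of x "k + 1"] by (simp add: rel_iff)

text \<open>The cube of \<open>top_swap\<close> is the one required by the definition. So \<open>\<sim>\<^sub>k\<close> relates exactly the pairs of completions
  of a \<open>(k+1)\<close>-corner.\<close>

lemma rel_topI:
  assumes "c \<in> C (k + 1)" "c' \<in> C (k + 1)"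
    "\<And>s. s \<in> dc (k + 1) \<Longrightarrow> s \<noteq> top_vertex (k + 1) \<Longrightarrow> c s = c' s"
  shows "(c (top_vertex (k + 1)), c' (top_vertex (k + 1))) \<in> rel k"
  unfolding rel_iff using top_swap[OF assms(1,2)] assms(3) cube_in[OF _ top_vertex_in] assms(1,2) by blast

text \<open>This is \<open>face_replacement\<close> for the face consisting of the origin only, transported to \<open>v\<close> by a reflection of
  the cube.\<close>

lemma replace_vertex:
  assumes c: "c \<in> C (k + 1)" and v: "v \<in> dc (k + 1)" and y: "(c v, y) \<in> rel k"
  shows "(\<lambda>s\<in>dc (k + 1). if s = v then y else c s) \<in> C (k + 1)"
proof -
  let ?n = "k + 1"
  define \<rho> where "\<rho> s l = (if v l = 1 then 1 - s l else s l)" for s :: "nat \<Rightarrow> int" and l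
  define c' where "c' = (\<lambda>s\<in>dc ?n. c (\<lambda>l\<in>{..<?n}. \<rho> s l))"
  have \<rho>01: "\<rho> s l = 0 \<or> \<rho> s l = 1" if "s \<in> dc ?n" "l < ?n" for s l
    using discrete_cube_cases[OF that] by (auto simp: \<rho>_def)
  have \<rho>aff: "affine_fun ?n (\<lambda>s. \<rho> s l)" if "l < ?n" for l
    using that by (cases "v l = 1") (auto simp: \<rho>_def)
  have c': "c' \<in> C ?n"
    unfolding c'_def by (rule cube_compose_affine[OF c \<rho>01 \<rho>aff]) auto
  have \<rho>v: "(\<lambda>l\<in>{..<?n}. \<rho> (\<lambda>l\<in>{..<?n}. 0) l) = v"
  proof (rule discrete_cube_eqI[OF _ v])
    fix j assume "j < k + 1"
    then show "(\<lambda>l\<in>{..<?n}. \<rho> (\<lambda>l\<in>{..<?n}. 0) l) j = v j"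
      using discrete_cube_cases[OF v, of j] by (auto simp: \<rho>_def)
  qed (auto simp: \<rho>_def)
  have zero: "zero_on ?n {..<?n} s = (\<lambda>l\<in>{..<?n}. 0)" for s
    by (auto simp: zero_on_def)
  have "(\<lambda>s\<in>dc ?n. if \<forall>l\<in>{..<?n}. s l = 0 then y else c' s) \<in> C ?n"
  proof (rule face_replacement[OF c' subset_refl])
    have "c' (\<lambda>l\<in>{..<?n}. 0) = c v"
      unfolding c'_def using \<rho>v by simp
    moreover have "(\<lambda>s\<in>dc ?n. if s = top_vertex ?n then y else c v) \<in> C ?n"
      using y by (simp add: rel_iff)
    ultimately show "(\<lambda>s\<in>dc ?n. if \<forall>l\<in>{..<?n}. s l = 1 then y else c' (zero_on ?n {..<?n} s)) \<in> C ?n"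
      unfolding zero by (elim restrict_cube) (auto simp: eq_top_vertex_iff)
  qed
  then show ?thesis
  proof (rule cube_compose_affine[OF _ \<rho>01 \<rho>aff])
    fix s assume s: "s \<in> dc (k + 1)"
    have 1: "(\<lambda>l\<in>{..<?n}. \<rho> s l) \<in> dc ?n" using \<rho>01[OF s] by simp
    have "(\<lambda>l\<in>{..<?n}. \<rho> (\<lambda>l\<in>{..<?n}. \<rho> s l) l) = s"
      by (rule discrete_cube_eqI[OF _ s]) (use discrete_cube_cases[OF s] in \<open>auto simp: \<rho>_def\<close>)
    moreover have "(\<forall>l\<in>{..<?n}. (\<lambda>l\<in>{..<?n}. \<rho> s l) l = 0) \<longleftrightarrow> s = v"
    proof
      assume *: "\<forall>l\<in>{..<?n}. (\<lambda>l\<in>{..<?n}. \<rho> s l) l = 0"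
      show "s = v"
      proof (rule discrete_cube_eqI[OF s v])
        fix j assume "j < ?n"
        then show "s j = v j"
          using *[rule_format, of j] discrete_cube_cases[OF v, of j] by (auto simp: \<rho>_def split: if_splits)
      qed
    next
      assume "s = v"
      then show "\<forall>l\<in>{..<?n}. (\<lambda>l\<in>{..<?n}. \<rho> s l) l = 0"
        using discrete_cube_cases[OF v] by (auto simp: \<rho>_def)
    qed
    ultimately show "(if s = v then y else c s) =
      (\<lambda>s\<in>dc ?n. if \<forall>l\<in>{..<?n}. s l = 0 then y else c' s) (\<lambda>l\<in>{..<?n}. \<rho> s l)"
      unfolding restrict_apply'[OF 1] c'_def using s 1 by auto
  qed
qed

lemma replace_vertices_full:
  assumes c: "c \<in> C (k + 1)" and g: "\<And>v. v \<in> dc (k + 1) \<Longrightarrow> (c v, g v) \<in> rel k"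
  shows "(\<lambda>s\<in>dc (k + 1). g s) \<in> C (k + 1)"
proof -
  have "S \<subseteq> dc (k + 1) \<Longrightarrow> (\<lambda>s\<in>dc (k + 1). if s \<in> S then g s else c s) \<in> C (k + 1)" if "finite S" for S
    using that
  proof (induction S)
    case empty
    show ?case by (rule restrict_cube[OF c]) auto
  next
    case (insert x S)
    then have x: "x \<in> dc (k + 1)" by simp
    have "(\<lambda>s\<in>dc (k + 1). if s = x then g x else
        (\<lambda>s\<in>dc (k + 1). if s \<in> S then g s else c s) s) \<in> C (k + 1)"
      by (rule replace_vertex[OF insert.IH x]) (use insert g[OF x] x in auto)
    then show ?case
      by (rule restrict_cube) auto
  qed
  from this[of "dc (k + 1)"] have "(\<lambda>s\<in>dc (k + 1). if s \<in> dc (k + 1) then g s else c s) \<in> C (k + 1)"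
    by simp
  then show ?thesis by (rule restrict_cube) auto
qed

text \<open>A cube of dimension \<open>n \<le> k + 1\<close> is a face of the \<open>(k+1)\<close>-cube which ignores the further coordinates.\<close>

theorem replace_vertices:
  assumes n: "n \<le> k + 1" and c: "c \<in> C n" and g: "\<And>v. v \<in> dc n \<Longrightarrow> (c v, g v) \<in> rel k"
  shows "(\<lambda>s\<in>dc n. g s) \<in> C n"
proof -
  have 0: "(\<lambda>l\<in>{..<n}. s l) \<in> dc n" if "s \<in> dc (k + 1)" for s
    using discrete_cube_cases[OF that] n by auto
  have 1: "(\<lambda>s\<in>dc (k + 1). c (\<lambda>l\<in>{..<n}. s l)) \<in> C (k + 1)"
    by (rule cube_compose_affine[OF c, where \<phi> = "\<lambda>s. s"]) (use n discrete_cube_cases in auto)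
  have "(\<lambda>s\<in>dc (k + 1). g (\<lambda>l\<in>{..<n}. s l)) \<in> C (k + 1)"
    by (rule replace_vertices_full[OF 1]) (use 0 g in auto)
  then show ?thesis
  proof (rule cube_compose_affine[where \<phi> = "\<lambda>s l. if l < n then s l else 0"])
    fix s l assume "s \<in> dc n" "l < k + 1"
    then show "(if l < n then s l else 0) = 0 \<or> (if l < n then s l else 0) = 1"
      using discrete_cube_cases by auto
  next
    fix l show "affine_fun n (\<lambda>s. if l < n then s l else 0)" by (cases "l < n") auto
  next
    fix s assume s: "s \<in> dc n"
    have 2: "(\<lambda>l\<in>{..<k + 1}. if l < n then s l else 0) \<in> dc (k + 1)"
      using discrete_cube_cases[OF s] by auto
    have "(\<lambda>l\<in>{..<n}. (\<lambda>l\<in>{..<k + 1}. if l < n then s l else 0) l) = s"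
      by (rule discrete_cube_eqI[OF _ s]) (use n discrete_cube_cases[OF s] in auto)
    then show "g s = (\<lambda>s\<in>dc (k + 1). g (\<lambda>l\<in>{..<n}. s l)) (\<lambda>l\<in>{..<k + 1}. if l < n then s l else 0)"
      unfolding restrict_apply'[OF 2] by (simp only:)
  qed
qed

lemma rel_sym: "(x, y) \<in> rel k \<Longrightarrow> (y, x) \<in> rel k"
proof -
  assume r: "(x, y) \<in> rel k"
  then have xy: "x \<in> X" "y \<in> X" by (auto simp: rel_iff)
  have "(\<lambda>s\<in>dc (k + 1). if s = top_vertex (k + 1) then x else y) \<in> C (k + 1)"
    by (rule replace_vertices_full[OF const_cube[OF xy(1)]]) (use r rel_refl[OF xy(1)] in auto)
  with xy show ?thesis by (simp add: rel_iff)
qed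

lemma rel_trans: "(x, y) \<in> rel k \<Longrightarrow> (y, z) \<in> rel k \<Longrightarrow> (x, z) \<in> rel k"
proof -
  assume r: "(x, y) \<in> rel k" "(y, z) \<in> rel k"
  then have X: "x \<in> X" "z \<in> X" by (auto simp: rel_iff)
  have "(\<lambda>v\<in>dc (k + 1). if v = top_vertex (k + 1) then y else x) \<in> C (k + 1)"
    using r(1) by (simp add: rel_iff)
  then have "(\<lambda>s\<in>dc (k + 1). if s = top_vertex (k + 1) then z else x) \<in> C (k + 1)"
    by (rule replace_vertices_full) (use r rel_refl[OF X(1)] in auto)
  with X show ?thesis by (simp add: rel_iff)
qed

lemma equiv_rel: "equiv X (rel k)"
proof (rule equivI)
  show "rel k \<subseteq> X \<times> X" by (auto simp: rel_iff)
  show "refl_on X (rel k)" using rel_refl by (auto simp: refl_on_def rel_iff)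
  show "sym (rel k)" using rel_sym by (rule symI)
  show "trans (rel k)" using rel_trans by (rule transI)
qed

lemma rel_mono: "j \<le> k \<Longrightarrow> (x, y) \<in> rel k \<Longrightarrow> (x, y) \<in> rel j"
proof -
  assume jk: "j \<le> k" and r: "(x, y) \<in> rel k"
  then have X: "x \<in> X" "y \<in> X"
    and c: "(\<lambda>v\<in>dc (k + 1). if v = top_vertex (k + 1) then y else x) \<in> C (k + 1)"
    by (auto simp: rel_iff)
  have "(\<lambda>s\<in>dc (j + 1). if s = top_vertex (j + 1) then y else x) \<in> C (j + 1)"
  proof (rule cube_compose_affine[OF c, where \<phi> = "\<lambda>s l. if l < j + 1 then s l else 1"])
    fix s l assume "s \<in> dc (j + 1)" "l < k + 1"
    then show "(if l < j + 1 then s l else 1) = 0 \<or> (if l < j + 1 then s l else 1) = 1"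
      using discrete_cube_cases by auto
  next
    fix l show "affine_fun (j + 1) (\<lambda>s. if l < j + 1 then s l else 1)" by (cases "l < j + 1") auto
  next
    fix s assume s: "s \<in> dc (j + 1)"
    have 2: "(\<lambda>l\<in>{..<k + 1}. if l < j + 1 then s l else 1) \<in> dc (k + 1)"
      using discrete_cube_cases[OF s] by auto
    have "(\<lambda>l\<in>{..<k + 1}. if l < j + 1 then s l else 1) = top_vertex (k + 1) \<longleftrightarrow> s = top_vertex (j + 1)"
      unfolding eq_top_vertex_iff[OF 2] eq_top_vertex_iff[OF s] using jk by auto
    then show "(if s = top_vertex (j + 1) then y else x) =
      (\<lambda>v\<in>dc (k + 1). if v = top_vertex (k + 1) then y else x) (\<lambda>l\<in>{..<k + 1}. if l < j + 1 then s l else 1)"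
      unfolding restrict_apply'[OF 2] by simp
  qed
  with X show ?thesis by (simp add: rel_iff)
qed

text \<open>Replacing the other vertices by \<open>x\<close> leaves a cube which is the definition of the claimed relation.\<close>

lemma rel_top_vertex:
  assumes c: "c \<in> C (k + 1)" and x: "x \<in> X"
    and r: "\<And>s. s \<in> dc (k + 1) \<Longrightarrow> s \<noteq> top_vertex (k + 1) \<Longrightarrow> (c s, x) \<in> rel k"
  shows "(x, c (top_vertex (k + 1))) \<in> rel k"
proof -
  have "(\<lambda>s\<in>dc (k + 1). if s = top_vertex (k + 1) then c (top_vertex (k + 1)) else x) \<in> C (k + 1)"
    by (rule replace_vertices_full[OF c]) (use r rel_refl cube_in[OF c] in auto)
  with x cube_in[OF c top_vertex_in] show ?thesis unfolding rel_iff by blast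
qed

lemma rel_in: "(x, y) \<in> rel k \<Longrightarrow> x \<in> X \<and> y \<in> X"
  by (simp add: rel_iff)

lemma rel_0: "x \<in> X \<Longrightarrow> y \<in> X \<Longrightarrow> (x, y) \<in> rel 0"
  unfolding rel_iff add_0 ergodicity by auto

end

section \<open>The factors are nilspaces\<close>

text \<open>The values \<open>0\<close> and \<open>1\<close> come first in the enumeration of \<open>\<int>\<close>.\<close>

lemma lattice_box_discrete_cube:
  assumes "b \<in> dc n"
  shows "u \<in> lattice_box n b \<longleftrightarrow> u \<in> dc n \<and> (\<forall>l<n. u l \<le> b l)"
proof
  assume u: "u \<in> lattice_box n b"
  have "(u l = 0 \<or> u l = 1) \<and> u l \<le> b l" if l: "l < n" for l
  proof -
    have le: "zrank (u l) \<le> zrank (b l)" using u l by (auto simp: lattice_box_def)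
    consider "b l = 0" | "b l = 1" using discrete_cube_cases[OF assms l] by blast
    then show ?thesis
    proof cases
      case 1
      then show ?thesis using le by simp
    next
      case 2
      then have "zrank (u l) \<le> 1" using le by simp
      then show ?thesis unfolding zrank_le_1_iff using 2 by auto
    qed
  qed
  moreover have "u \<in> extensional {..<n}"
    using u by (auto simp: lattice_box_def carrier_int_lattice PiE_iff)
  ultimately show "u \<in> dc n \<and> (\<forall>l<n. u l \<le> b l)"
    by (auto simp: discrete_cube_iff)
next
  assume u: "u \<in> dc n \<and> (\<forall>l<n. u l \<le> b l)"
  have "zrank (u l) \<le> zrank (b l)" if "l < n" for l
  proof -
    have "u l \<le> b l" "u l = 0 \<or> u l = 1" "b l = 0 \<or> b l = 1"
      using u that discrete_cube_cases assms by auto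
    then show ?thesis by auto
  qed
  then show "u \<in> lattice_box n b"
    using u dc_subset_lattice by (auto simp: lattice_box_def)
qed

definition ones :: "nat \<Rightarrow> (nat \<Rightarrow> int) \<Rightarrow> nat set" where
  "ones n v = {l. l < n \<and> v l = 1}"

lemma finite_ones [simp]: "finite (ones n v)"
  by (simp add: ones_def)

context nilspace
begin

text \<open>Modulo \<open>\<sim>\<^sub>k\<close>, being a cube can be tested on \<open>(k+1)\<close>-dimensional faces. Extend the values of \<open>g\<close> at the vertices
  having at most \<open>k + 1\<close> ones to a cube \<open>F\<close>. At a vertex \<open>w\<close> with more ones, both \<open>F\<close> and \<open>g\<close> complete the
  corner of a \<open>(k+1)\<close>-face with top vertex \<open>w\<close>, and these corners agree modulo \<open>\<sim>\<^sub>k\<close> by induction.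

  In the applications \<open>V\<close> is the whole cube, or the cube without its top vertex when a corner is to be lifted.\<close>

theorem pointwise_lift:
  assumes V: "V \<subseteq> dc n" "\<And>u w. w \<in> V \<Longrightarrow> u \<in> dc n \<Longrightarrow> (\<And>l. l < n \<Longrightarrow> u l \<le> w l) \<Longrightarrow> u \<in> V"
    and g: "\<And>v. v \<in> dc n \<Longrightarrow> g v \<in> X"
    and H: "\<And>\<phi> w. cube_morphism (k + 1) n \<phi> \<Longrightarrow> w \<in> V \<Longrightarrow>
      (\<And>s l. s \<in> dc (k + 1) \<Longrightarrow> l < n \<Longrightarrow> \<phi> s l \<le> w l) \<Longrightarrow>
      (\<lambda>s\<in>dc (k + 1). g (\<phi> s)) \<in> C (k + 1)"
  obtains c where "c \<in> C n" "\<And>v. v \<in> V \<Longrightarrow> (c v, g v) \<in> rel k"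
proof -
  define D where "D = {b \<in> V. card (ones n b) \<le> k + 1}"
  have dn: "lattice_box n b \<subseteq> D" if b: "b \<in> D" for b
  proof
    fix u assume u: "u \<in> lattice_box n b"
    have bdc: "b \<in> dc n" using b V by (auto simp: D_def)
    have u': "u \<in> dc n" "\<And>l. l < n \<Longrightarrow> u l \<le> b l"
      using u unfolding lattice_box_discrete_cube[OF bdc] by auto
    have "ones n u \<subseteq> ones n b"
      using u' discrete_cube_cases[OF bdc] unfolding ones_def by force
    then have "card (ones n u) \<le> card (ones n b)" by (intro card_mono) auto
    then show "u \<in> D" using b V(2)[of b u] u' by (auto simp: D_def)
  qed
  have good: "good_at C n g b" if b: "b \<in> D" for b
    unfolding good_at_def
  proof (intro allI impI)
    fix m a assume a: "a \<in> dc m \<rightarrow> lattice_box n b" and aff: "\<forall>l<n. affine_fun m (\<lambda>s. a s l)"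
    have bdc: "b \<in> dc n" using b V by (auto simp: D_def)
    define r where "r = card (ones n b)"
    have r: "r \<le> k + 1" using b by (simp add: D_def r_def)
    \<comment> \<open>The face below \<open>b\<close> has dimension \<open>r \<le> k + 1\<close>, so it is the image of a morphism from
      \<open>{0,1}\<^sup>k\<^sup>+\<^sup>1\<close>, on which \<open>g\<close> is known to be a cube.\<close>
    obtain e where e: "bij_betw e {0..<r} (ones n b)"
      unfolding r_def using ex_bij_betw_nat_finite[OF finite_ones] by blast
    define \<iota> where "\<iota> = inv_into {0..<r} e"
    have \<iota>: "\<iota> l < r \<and> e (\<iota> l) = l" if "l \<in> ones n b" for l
      using bij_betw_inv_into_right[OF e that] bij_betwE[OF bij_betw_inv_into[OF e]] that
      by (auto simp: \<iota>_def)
    have en: "e j < n" if "j < r" for j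
      using bij_betwE[OF e] that by (auto simp: ones_def)
    have \<iota>e: "\<iota> (e j) = j" if "j < r" for j
      unfolding \<iota>_def by (rule bij_betw_inv_into_left[OF e]) (use that in simp)
    define \<phi> where "\<phi> s = (\<lambda>l\<in>{..<n}. if l \<in> ones n b then s (\<iota> l) else 0)" for s :: "nat \<Rightarrow> int"
    have "(\<lambda>s\<in>dc (k + 1). g (\<phi> s)) \<in> C (k + 1)"
    proof (rule H)
      show "cube_morphism (k + 1) n \<phi>"
      proof (rule cube_morphismI)
        fix s assume s: "s \<in> dc (k + 1)"
        show "\<phi> s \<in> dc n"
          unfolding \<phi>_def restrict_in_discrete_cube
        proof (intro allI impI)
          fix l assume "l < n"
          show "(if l \<in> ones n b then s (\<iota> l) else 0) = 0 \<or> (if l \<in> ones n b then s (\<iota> l) else 0) = 1"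
            using discrete_cube_cases[OF s, of "\<iota> l"] \<iota>[of l] r by auto
        qed
      next
        fix l assume "l < n"
        then show "affine_fun (k + 1) (\<lambda>s. \<phi> s l)"
          using \<iota>[of l] r by (cases "l \<in> ones n b") (auto simp: \<phi>_def)
      qed
      show "b \<in> V" using b by (simp add: D_def)
    next
      fix s l assume s: "s \<in> dc (k + 1)" "l < n"
      show "\<phi> s l \<le> b l"
      proof (cases "l \<in> ones n b")
        case True
        then show ?thesis using s discrete_cube_cases[OF s(1), of "\<iota> l"] \<iota>[of l] r
          by (auto simp: \<phi>_def ones_def)
      next
        case False
        then show ?thesis using s(2) discrete_cube_cases[OF bdc s(2)] by (auto simp: \<phi>_def)
      qed
    qed
    then have "(\<lambda>s\<in>dc m. g (a s)) \<in> C m"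
    proof (rule cube_compose_affine[where \<phi> = "\<lambda>s j. if j < r then a s (e j) else 0"])
      fix s j assume s: "s \<in> dc m"
      then have "a s \<in> dc n"
        using a lattice_box_discrete_cube[OF bdc] by auto
      then show "(if j < r then a s (e j) else 0) = 0 \<or> (if j < r then a s (e j) else 0) = 1"
        using discrete_cube_cases[of "a s" n "e j"] en by auto
    next
      fix j assume "j < k + 1"
      show "affine_fun m (\<lambda>s. if j < r then a s (e j) else 0)"
        using aff en by (cases "j < r") auto
    next
      fix s assume s: "s \<in> dc m"
      then have as: "a s \<in> dc n" "\<And>l. l < n \<Longrightarrow> a s l \<le> b l"
        using a lattice_box_discrete_cube[OF bdc] by auto
      have in1: "(\<lambda>j\<in>{..<k + 1}. if j < r then a s (e j) else 0) \<in> dc (k + 1)"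
        unfolding restrict_in_discrete_cube using discrete_cube_cases[OF as(1)] en by auto
      have "\<phi> (\<lambda>j\<in>{..<k + 1}. if j < r then a s (e j) else 0) = a s"
      proof (rule extensionalityI[of _ "{..<n}"])
        fix l assume "l \<in> {..<n}"
        then have l: "l < n" by simp
        show "\<phi> (\<lambda>j\<in>{..<k + 1}. if j < r then a s (e j) else 0) l = a s l"
        proof (cases "l \<in> ones n b")
          case True
          then show ?thesis using l \<iota>[OF True] r by (auto simp: \<phi>_def)
        next
          case False
          then have "b l = 0" using discrete_cube_cases[OF bdc l] l by (auto simp: ones_def)
          then show ?thesis using l False as(2)[OF l] discrete_cube_cases[OF as(1) l] by (auto simp: \<phi>_def)
        qed
      qed (use as in \<open>auto simp: \<phi>_def discrete_cube_iff\<close>)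
      then show "g (a s) = (\<lambda>s\<in>dc (k + 1). g (\<phi> s)) (\<lambda>j\<in>{..<k + 1}. if j < r then a s (e j) else 0)"
        unfolding restrict_apply'[OF in1] by (simp only:)
    qed
    then show "restrict (g \<circ> a) (dc m) \<in> C m" by (simp add: comp_def)
  qed
  have "D \<subseteq> carrier (int_lattice n)"
    using V(1) dc_subset_lattice by (auto simp: D_def)
  then obtain F where F: "\<And>v. v \<in> D \<Longrightarrow> F v = g v"
    "\<And>m a. a \<in> dc m \<rightarrow> carrier (int_lattice n) \<Longrightarrow>
       (\<And>l. l < n \<Longrightarrow> affine_fun m (\<lambda>s. a s l)) \<Longrightarrow> (\<lambda>s\<in>dc m. F (a s)) \<in> C m"
    using lattice_extension[of D n g] dn good by blast
  have Fcube: "(\<lambda>s\<in>dc n. F s) \<in> C n"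
    using F(2)[of "\<lambda>s. s" n] dc_subset_lattice by auto
  have FX: "F v \<in> X" if "v \<in> dc n" for v
    using cube_in[OF Fcube that] that by simp
  have "(F w, g w) \<in> rel k" if "w \<in> V" for w
    using that
  proof (induction "card (ones n w)" arbitrary: w rule: less_induct)
    case less
    have wdc: "w \<in> dc n" using less.prems V by auto
    show ?case
    proof (cases "w \<in> D")
      case True
      then show ?thesis using F(1) rel_refl g[OF wdc] by simp
    next
      case False
      then have "k + 1 \<le> card (ones n w)" using less.prems by (simp add: D_def)
      then obtain T where T: "T \<subseteq> ones n w" "card T = k + 1" "finite T"
        using obtain_subset_with_card_n by metis
      obtain e where e: "bij_betw e {0..<k + 1} T"
        using ex_bij_betw_nat_finite[OF T(3)] unfolding T(2) by blast
      define \<iota> where "\<iota> = inv_into {0..<k + 1} e"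
      have \<iota>: "\<iota> l < k + 1 \<and> e (\<iota> l) = l" if "l \<in> T" for l
        using bij_betw_inv_into_right[OF e that] bij_betwE[OF bij_betw_inv_into[OF e]] that
        by (auto simp: \<iota>_def)
      have eT: "e j \<in> T" if "j < k + 1" for j
        using bij_betwE[OF e] that by auto
      have \<iota>e: "\<iota> (e j) = j" if "j < k + 1" for j
        unfolding \<iota>_def by (rule bij_betw_inv_into_left[OF e]) (use that in simp)
      have Tn: "l < n \<and> w l = 1" if "l \<in> T" for l using T(1) that by (auto simp: ones_def)
      define \<phi> where "\<phi> s = (\<lambda>l\<in>{..<n}. if l \<in> T then s (\<iota> l) else w l)" for s :: "nat \<Rightarrow> int"
      have mor: "cube_morphism (k + 1) n \<phi>"
      proof (rule cube_morphismI)
        fix s assume s: "s \<in> dc (k + 1)"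
        show "\<phi> s \<in> dc n"
          unfolding \<phi>_def restrict_in_discrete_cube
        proof (intro allI impI)
          fix l assume "l < n"
          then show "(if l \<in> T then s (\<iota> l) else w l) = 0 \<or> (if l \<in> T then s (\<iota> l) else w l) = 1"
            using discrete_cube_cases[OF s, of "\<iota> l"] \<iota>[of l] discrete_cube_cases[OF wdc] by auto
        qed
      next
        fix l assume "l < n"
        then show "affine_fun (k + 1) (\<lambda>s. \<phi> s l)"
          using \<iota>[of l] by (cases "l \<in> T") (auto simp: \<phi>_def)
      qed
      have \<phi>w: "\<phi> s l \<le> w l" if "s \<in> dc (k + 1)" "l < n" for s l
        using discrete_cube_cases[OF that(1), of "\<iota> l"] \<iota>[of l] Tn[of l] that(2) by (auto simp: \<phi>_def)
      have gc: "(\<lambda>s\<in>dc (k + 1). g (\<phi> s)) \<in> C (k + 1)"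
        by (rule H[OF mor less.prems \<phi>w])
      have Fc: "(\<lambda>s\<in>dc (k + 1). F (\<phi> s)) \<in> C (k + 1)"
        by (rule F(2)) (use mor dc_subset_lattice in \<open>auto simp: cube_morphism_iff\<close>)
      have top: "\<phi> (top_vertex (k + 1)) = w"
        by (rule discrete_cube_eqI[OF cube_morphism_in[OF mor top_vertex_in] wdc])
          (use \<iota> Tn in \<open>auto simp: \<phi>_def top_vertex_def\<close>)
      have lower: "(F (\<phi> s), g (\<phi> s)) \<in> rel k" if s: "s \<in> dc (k + 1)" "s \<noteq> top_vertex (k + 1)" for s
      proof (rule less.hyps)
        obtain j where j: "j < k + 1" "s j = 0"
          using s discrete_cube_cases[OF s(1)] eq_top_vertex_iff[OF s(1)] by blast
        have "ones n (\<phi> s) \<subseteq> ones n w"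
        proof
          fix l assume l: "l \<in> ones n (\<phi> s)"
          then have "l < n" "\<phi> s l = 1" by (auto simp: ones_def)
          with \<phi>w[OF s(1), of l] discrete_cube_cases[OF wdc, of l] show "l \<in> ones n w"
            by (auto simp: ones_def)
        qed
        moreover have "e j \<in> ones n w" using eT[OF j(1)] T(1) by auto
        moreover have "e j \<notin> ones n (\<phi> s)"
          using eT[OF j(1)] Tn \<iota>e[OF j(1)] j(2) by (auto simp: ones_def \<phi>_def)
        ultimately have "ones n (\<phi> s) \<subset> ones n w" by blast
        then show "card (ones n (\<phi> s)) < card (ones n w)" by (intro psubset_card_mono) auto
        show "\<phi> s \<in> V" by (rule V(2)[OF less.prems cube_morphism_in[OF mor s(1)] \<phi>w[OF s(1)]])
      qed
      have "(\<lambda>s\<in>dc (k + 1). if s = top_vertex (k + 1) then F w else g (\<phi> s)) \<in> C (k + 1)"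
      proof (rule replace_vertices_full[OF Fc])
        fix s assume s: "s \<in> dc (k + 1)"
        show "((\<lambda>s\<in>dc (k + 1). F (\<phi> s)) s, if s = top_vertex (k + 1) then F w else g (\<phi> s)) \<in> rel k"
          using s lower[OF s] top rel_refl[OF FX[OF wdc]] by simp
      qed
      from rel_topI[OF this gc] show ?thesis
        using top by simp
    qed
  qed
  moreover have "(\<lambda>s\<in>dc n. F s) v = F v" if "v \<in> V" for v using that V by auto
  ultimately show thesis
    using that[OF Fcube] by simp
qed

abbreviation proj :: "nat \<Rightarrow> 'a \<Rightarrow> 'a set" where
  "proj \<equiv> factor_map X C"

lemma proj_eq_iff: "x \<in> X \<Longrightarrow> y \<in> X \<Longrightarrow> proj k x = proj k y \<longleftrightarrow> (x, y) \<in> rel k"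
  unfolding factor_map_def by (rule eq_equiv_class_iff[OF equiv_rel])

lemma factor_eq: "factor X C k = proj k ` X"
  by (auto simp: factor_def quotient_def factor_map_def)

lemma proj_in: "x \<in> X \<Longrightarrow> proj k x \<in> factor X C k"
  by (simp add: factor_eq)

lemma proj_cube_iff:
  assumes g: "\<And>v. v \<in> dc n \<Longrightarrow> g v \<in> X"
  shows "(\<lambda>v\<in>dc n. proj k (g v)) \<in> factor_cubes X C k n \<longleftrightarrow>
    (\<exists>c\<in>C n. \<forall>v\<in>dc n. (c v, g v) \<in> rel k)" (is "?L \<longleftrightarrow> ?R")
proof
  assume ?L
  then obtain c where c: "c \<in> C n"
    and eq: "(\<lambda>v\<in>dc n. proj k (g v)) = restrict (proj k \<circ> c) (dc n)"
    unfolding factor_cubes_def by blast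
  have "(c v, g v) \<in> rel k" if "v \<in> dc n" for v
    using fun_cong[OF eq[symmetric], of v] that proj_eq_iff[OF cube_in[OF c that] g[OF that]] by simp
  with c show ?R by blast
next
  assume ?R
  then obtain c where c: "c \<in> C n" "\<And>v. v \<in> dc n \<Longrightarrow> (c v, g v) \<in> rel k" by blast
  have "(\<lambda>v\<in>dc n. proj k (g v)) = restrict (proj k \<circ> c) (dc n)"
    by (rule restrict_ext) (use c rel_sym proj_eq_iff cube_in[OF c(1)] g in auto)
  with c(1) show ?L unfolding factor_cubes_def by (intro image_eqI)
qed

text \<open>In dimensions up to \<open>k + 1\<close> the choice of representatives does not matter.\<close>

lemma proj_cube_low_iff:
  assumes g: "\<And>v. v \<in> dc n \<Longrightarrow> g v \<in> X" and n: "n \<le> k + 1"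
  shows "(\<lambda>v\<in>dc n. proj k (g v)) \<in> factor_cubes X C k n \<longleftrightarrow> (\<lambda>v\<in>dc n. g v) \<in> C n"
proof (subst proj_cube_iff)
  show "g v \<in> X" if "v \<in> dc n" for v by (rule g[OF that])
  show "(\<exists>c\<in>C n. \<forall>v\<in>dc n. (c v, g v) \<in> rel k) \<longleftrightarrow> (\<lambda>v\<in>dc n. g v) \<in> C n"
  proof
    assume "\<exists>c\<in>C n. \<forall>v\<in>dc n. (c v, g v) \<in> rel k"
    then show "(\<lambda>v\<in>dc n. g v) \<in> C n" using replace_vertices[OF n] by blast
  next
    assume "(\<lambda>v\<in>dc n. g v) \<in> C n"
    then show "\<exists>c\<in>C n. \<forall>v\<in>dc n. (c v, g v) \<in> rel k"
      by (rule bexI[rotated]) (use g rel_refl in auto)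
  qed
qed

lemma lift_map:
  assumes "\<And>v. v \<in> V \<Longrightarrow> q v \<in> factor X C k"
  obtains g where "\<And>v. g v \<in> X" "\<And>v. v \<in> V \<Longrightarrow> q v = proj k (g v)"
proof -
  have "\<exists>x. x \<in> X \<and> (v \<in> V \<longrightarrow> q v = proj k x)" for v
    using assms[of v] nonempty unfolding factor_eq by blast
  then obtain g where "\<And>v. g v \<in> X \<and> (v \<in> V \<longrightarrow> q v = proj k (g v))"
    using choice[of "\<lambda>v x. x \<in> X \<and> (v \<in> V \<longrightarrow> q v = proj k x)"] by blast
  then show thesis using that[of g] by blast
qed

text \<open>To complete a corner of \<open>X\<^sub>k\<close>, choose representatives of its values; on \<open>(k+1)\<close>-dimensional faces any choice is a
  cube, so \<open>pointwise_lift\<close> gives a cube of \<open>X\<close> over the corner.\<close>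

theorem factor_nilspace: "nilspace (factor X C k) (factor_cubes X C k)"
proof
  show "factor X C k \<noteq> {}" using nonempty by (simp add: factor_eq)
next
  fix n
  show "factor_cubes X C k n \<subseteq> dc n \<rightarrow>\<^sub>E factor X C k"
    using cube_in proj_in by (auto simp: factor_cubes_def)
next
  fix q n m \<phi> assume q: "q \<in> factor_cubes X C k n" and \<phi>: "cube_morphism m n \<phi>"
  then obtain c where c: "c \<in> C n" "q = restrict (proj k \<circ> c) (dc n)"
    unfolding factor_cubes_def by blast
  have "restrict (q \<circ> \<phi>) (dc m) = restrict (proj k \<circ> (\<lambda>s\<in>dc m. c (\<phi> s))) (dc m)"
    by (rule restrict_ext) (use cube_morphism_in[OF \<phi>] in \<open>auto simp: c(2)\<close>)
  then show "restrict (q \<circ> \<phi>) (dc m) \<in> factor_cubes X C k m"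
    unfolding factor_cubes_def by (rule image_eqI[OF _ cube_compose[OF c(1) \<phi>]])
next
  have "q \<in> factor_cubes X C k 1" if q: "q \<in> dc 1 \<rightarrow>\<^sub>E factor X C k" for q
  proof -
    obtain g where g: "\<And>v. g v \<in> X" "\<And>v. v \<in> dc 1 \<Longrightarrow> q v = proj k (g v)"
      using lift_map[of "dc 1" q] q by blast
    have "(\<lambda>v\<in>dc 1. g v) \<in> C 1" unfolding ergodicity using g by auto
    then have "(\<lambda>v\<in>dc 1. proj k (g v)) \<in> factor_cubes X C k 1"
      using proj_cube_low_iff[of 1 g k] g by simp
    moreover have "q = (\<lambda>v\<in>dc 1. proj k (g v))"
      by (rule extensionalityI[of _ "dc 1"]) (use q g in \<open>auto simp: PiE_iff\<close>)
    ultimately show ?thesis by simp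
  qed
  then show "factor_cubes X C k 1 = dc 1 \<rightarrow>\<^sub>E factor X C k"
    using cube_in proj_in by (auto simp: factor_cubes_def)
next
  fix n q assume q: "corner (factor X C k) (factor_cubes X C k) n q"
  let ?V = "dc n - {top_vertex n}"
  have qV: "q \<in> ?V \<rightarrow>\<^sub>E factor X C k"
    and qf: "\<And>l. l < n \<Longrightarrow> restrict (q \<circ> face_map n l) (dc (n - 1)) \<in> factor_cubes X C k (n - 1)"
    using q by (auto simp: corner_def)
  obtain g where g: "\<And>v. g v \<in> X" "\<And>v. v \<in> ?V \<Longrightarrow> q v = proj k (g v)"
    using lift_map[of ?V q] qV by blast
  have "\<exists>c. c \<in> C n \<and> (\<forall>v\<in>?V. (c v, g v) \<in> rel k)"
  proof (rule pointwise_lift[of ?V n g k])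
    fix u w assume w: "w \<in> ?V" and u: "u \<in> dc n" "\<And>l. l < n \<Longrightarrow> u l \<le> w l"
    then obtain l where "l < n" "w l = 0"
      using discrete_cube_cases eq_top_vertex_iff by blast
    then have "u l \<noteq> 1" using u(2)[of l] by auto
    then show "u \<in> ?V" using \<open>l < n\<close> u(1) eq_top_vertex_iff[OF u(1)] by blast
  next
    fix \<phi> w assume \<phi>: "cube_morphism (k + 1) n \<phi>" and w: "w \<in> ?V"
      and \<phi>w: "\<And>s l. s \<in> dc (k + 1) \<Longrightarrow> l < n \<Longrightarrow> \<phi> s l \<le> w l"
    obtain l where l: "l < n" "w l = 0"
      using w discrete_cube_cases eq_top_vertex_iff by blast
    have \<phi>l: "\<phi> s l = 0" if "s \<in> dc (k + 1)" for s
      using \<phi>w[OF that l(1)] l discrete_cube_cases[OF cube_morphism_in[OF \<phi> that] l(1)] by auto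
    obtain c where c: "c \<in> C (n - 1)"
        and qc: "restrict (q \<circ> face_map n l) (dc (n - 1)) = restrict (proj k \<circ> c) (dc (n - 1))"
      using qf[OF l(1)] unfolding factor_cubes_def by blast
    define \<delta> where "\<delta> s j = \<phi> s (if j < l then j else j + 1)" for s j
    have \<delta>01: "\<delta> s j = 0 \<or> \<delta> s j = 1" if "s \<in> dc (k + 1)" "j < n - 1" for s j
      using discrete_cube_cases[OF cube_morphism_in[OF \<phi> that(1)]] that(2) by (auto simp: \<delta>_def)
    have "(\<lambda>s\<in>dc (k + 1). c (\<lambda>j\<in>{..<n - 1}. \<delta> s j)) \<in> C (k + 1)"
    proof (rule cube_compose_affine[OF c \<delta>01])
      fix j assume "j < n - 1"
      then show "affine_fun (k + 1) (\<lambda>s. \<delta> s j)"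
        using \<phi> by (auto simp: \<delta>_def cube_morphism_iff)
    qed auto
    then show "(\<lambda>s\<in>dc (k + 1). g (\<phi> s)) \<in> C (k + 1)"
    proof (rule replace_vertices_full)
      fix s assume s: "s \<in> dc (k + 1)"
      have \<phi>s: "\<phi> s \<in> ?V"
        using cube_morphism_in[OF \<phi> s] \<phi>l[OF s] l(1) by (auto simp: top_vertex_def)
      have \<delta>in: "(\<lambda>j\<in>{..<n - 1}. \<delta> s j) \<in> dc (n - 1)"
        using \<delta>01[OF s] by simp
      have "face_map n l (\<lambda>j\<in>{..<n - 1}. \<delta> s j) = \<phi> s"
      proof (rule extensionalityI[of _ "{..<n}"])
        fix j assume "j \<in> {..<n}"
        then show "face_map n l (\<lambda>j\<in>{..<n - 1}. \<delta> s j) j = \<phi> s j"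
          using \<phi>l[OF s] l(1) by (cases j l rule: linorder_cases) (auto simp: face_map_def \<delta>_def)
      qed (use \<phi>s in \<open>auto simp: face_map_def discrete_cube_iff\<close>)
      then have "proj k (c (\<lambda>j\<in>{..<n - 1}. \<delta> s j)) = proj k (g (\<phi> s))"
        using fun_cong[OF qc, of "\<lambda>j\<in>{..<n - 1}. \<delta> s j"] \<delta>in g(2)[OF \<phi>s] by simp
      then show "((\<lambda>s\<in>dc (k + 1). c (\<lambda>j\<in>{..<n - 1}. \<delta> s j)) s, g (\<phi> s)) \<in> rel k"
        using proj_eq_iff[OF cube_in[OF c \<delta>in] g(1)] s by simp
    qed
  qed (use g in auto)
  then obtain c where c: "c \<in> C n" "\<And>v. v \<in> ?V \<Longrightarrow> (c v, g v) \<in> rel k" by blast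
  have "completes (factor_cubes X C k) n q (restrict (proj k \<circ> c) (dc n))"
    unfolding completes_def
  proof
    show "restrict (proj k \<circ> c) (dc n) \<in> factor_cubes X C k n"
      using c(1) by (auto simp: factor_cubes_def)
    show "restrict (restrict (proj k \<circ> c) (dc n)) ?V = q"
    proof (rule extensionalityI[of _ ?V])
      fix v assume v: "v \<in> ?V"
      then show "restrict (restrict (proj k \<circ> c) (dc n)) ?V v = q v"
        using g(2)[OF v] proj_eq_iff[of "c v" "g v" k] c(2)[OF v] cube_in[OF c(1)] g(1) by auto
    qed (use qV in \<open>auto simp: PiE_iff\<close>)
  qed
  then show "\<exists>d. completes (factor_cubes X C k) n q d" by blast
qed

theorem factor_step_nilspace: "step_nilspace k (factor X C k) (factor_cubes X C k)"
  unfolding step_nilspace_def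
proof (intro conjI allI impI factor_nilspace)
  fix q assume "corner (factor X C k) (factor_cubes X C k) (k + 1) q"
  then have ex: "\<exists>d. completes (factor_cubes X C k) (k + 1) q d"
    using nilspace.completion[OF factor_nilspace] by blast
  have "d = d'" if dd: "completes (factor_cubes X C k) (k + 1) q d"
    "completes (factor_cubes X C k) (k + 1) q d'" for d d'
  proof -
    let ?T = "top_vertex (k + 1)"
    obtain c where c: "c \<in> C (k + 1)" "d = restrict (proj k \<circ> c) (dc (k + 1))"
      using dd(1) unfolding completes_def factor_cubes_def by blast
    obtain c' where c': "c' \<in> C (k + 1)" "d' = restrict (proj k \<circ> c') (dc (k + 1))"
      using dd(2) unfolding completes_def factor_cubes_def by blast
    have eq: "restrict d (dc (k + 1) - {?T}) = restrict d' (dc (k + 1) - {?T})"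
      using dd unfolding completes_def by simp
    have off: "d s = d' s \<and> (c s, c' s) \<in> rel k" if s: "s \<in> dc (k + 1)" "s \<noteq> ?T" for s
      using fun_cong[OF eq, of s] s c(2) c'(2) proj_eq_iff[OF cube_in[OF c(1) s(1)] cube_in[OF c'(1) s(1)]]
      by simp
    have "(\<lambda>s\<in>dc (k + 1). if s = ?T then c ?T else c' s) \<in> C (k + 1)"
      by (rule replace_vertices_full[OF c(1)]) (use off rel_refl[OF cube_in[OF c(1) top_vertex_in]] in auto)
    from rel_topI[OF this c'(1)] have "(c ?T, c' ?T) \<in> rel k" by simp
    then have "d ?T = d' ?T"
      using c(2) c'(2) proj_eq_iff[OF cube_in[OF c(1) top_vertex_in] cube_in[OF c'(1) top_vertex_in]] by simp
    then have "d s = d' s" if "s \<in> dc (k + 1)" for s using off that by (cases "s = ?T") auto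
    then show "d = d'"
      unfolding c(2) c'(2) by (intro restrict_ext) auto
  qed
  with ex show "\<exists>!d. completes (factor_cubes X C k) (k + 1) q d" by blast
qed

lemma factor_rel_factor:
  assumes "x \<in> X" "y \<in> X" "j \<le> k"
  shows "(proj k x, proj k y) \<in> factor_rel (factor X C k) (factor_cubes X C k) j \<longleftrightarrow> (x, y) \<in> rel j"
proof -
  have "(\<lambda>v\<in>dc (j + 1). if v = top_vertex (j + 1) then proj k y else proj k x) =
      (\<lambda>v\<in>dc (j + 1). proj k (if v = top_vertex (j + 1) then y else x))"
    by (rule restrict_ext) simp
  moreover have "\<dots> \<in> factor_cubes X C k (j + 1) \<longleftrightarrow>
      (\<lambda>v\<in>dc (j + 1). if v = top_vertex (j + 1) then y else x) \<in> C (j + 1)"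
    by (rule proj_cube_low_iff) (use assms in auto)
  ultimately show ?thesis
    using assms proj_in by (simp add: factor_rel_def)
qed

text \<open>As \<open>\<sim>\<^sub>k\<close> refines \<open>\<sim>\<^sub>k\<^sub>-\<^sub>1\<close>, the map \<open>X\<^sub>k \<rightarrow> X\<^sub>k\<^sub>-\<^sub>1\<close> sends the class of \<open>x\<close> to the class of \<open>x\<close>.\<close>

lemma factor_proj_proj:
  assumes "x \<in> X" shows "factor_proj X C k (proj k x) = proj (k - 1) x"
proof -
  have "rel (k - 1) `` (rel k `` {x}) = rel (k - 1) `` {x}"
  proof (intro equalityI subsetI)
    fix z assume "z \<in> rel (k - 1) `` (rel k `` {x})"
    then obtain w where "(x, w) \<in> rel k" "(w, z) \<in> rel (k - 1)" by blast
    then show "z \<in> rel (k - 1) `` {x}"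
      using rel_trans[OF rel_mono[OF diff_le_self]] by blast
  qed (use rel_refl[OF assms] in blast)
  then show ?thesis by (simp add: factor_proj_def factor_map_def)
qed

text \<open>The constant map and the witness of \<open>x \<sim>\<^sub>k y\<close> complete the same corner.\<close>

lemma step_unique:
  assumes "step_nilspace k X C" "(x, y) \<in> rel k"
  shows "x = y"
proof -
  let ?T = "top_vertex (k + 1)"
  let ?c = "\<lambda>v\<in>dc (k + 1). x" and ?d = "\<lambda>v\<in>dc (k + 1). if v = ?T then y else x"
  have xy: "x \<in> X" "y \<in> X" and d: "?d \<in> C (k + 1)" using assms(2) by (auto simp: rel_iff)
  let ?q = "\<lambda>v\<in>dc (k + 1) - {?T}. x"
  have "corner X C (k + 1) ?q"
    unfolding corner_def
  proof (intro conjI allI impI)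
    fix l assume l: "l < k + 1"
    have "face_map (k + 1) l s \<in> dc (k + 1) - {?T}" if "s \<in> dc k" for s
    proof -
      have "face_map (k + 1) l s l = 0" "?T l = 1"
        using l by (auto simp: face_map_def top_vertex_def)
      then have "face_map (k + 1) l s \<noteq> ?T" using zero_neq_one by metis
      then show ?thesis
        using cube_morphism_in[OF face_map_morphism[OF l]] that by simp
    qed
    then have "restrict (?q \<circ> face_map (k + 1) l) (dc (k + 1 - 1)) = (\<lambda>v\<in>dc k. x)"
      by (auto intro!: restrict_ext)
    then show "restrict (?q \<circ> face_map (k + 1) l) (dc (k + 1 - 1)) \<in> C (k + 1 - 1)"
      using const_cube[OF xy(1), of k] by simp
  qed (use xy in auto)
  then have "\<exists>!c. completes C (k + 1) ?q c"
    using assms(1) by (simp add: step_nilspace_def)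
  moreover have "completes C (k + 1) ?q ?c" "completes C (k + 1) ?q ?d"
    using const_cube[OF xy(1)] d by (auto simp: completes_def)
  ultimately have "?c = ?d" by blast
  from fun_cong[OF this, of ?T] show ?thesis by simp
qed

end

section \<open>Alternating products over discrete cubes\<close>

definition vertex_sign :: "nat \<Rightarrow> (nat \<Rightarrow> int) \<Rightarrow> int" where
  "vertex_sign n v = (- 1) ^ nat (\<Sum>j<n. v j)"

definition alt_prod :: "('z, 'm) monoid_scheme \<Rightarrow> nat \<Rightarrow> ((nat \<Rightarrow> int) \<Rightarrow> 'z) \<Rightarrow> 'z" where
  "alt_prod A n f = (\<Otimes>\<^bsub>A\<^esub>v\<in>dc n. f v [^]\<^bsub>A\<^esub> vertex_sign n v)"

lemma D_cubes_iff:
  "c \<in> D_cubes l A n \<longleftrightarrow> c \<in> dc n \<rightarrow>\<^sub>E carrier A \<and>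
     (\<forall>\<phi>. cube_morphism (l + 1) n \<phi> \<longrightarrow> alt_prod A (l + 1) (\<lambda>v. c (\<phi> v)) = \<one>\<^bsub>A\<^esub>)"
  by (simp add: D_cubes_def alt_prod_def vertex_sign_def)

lemma vertex_sign_cases: "vertex_sign n v = 1 \<or> vertex_sign n v = - 1"
  unfolding vertex_sign_def by (metis neg_one_even_power neg_one_odd_power)

lemma discrete_cube_sum_nonneg: "v \<in> dc n \<Longrightarrow> 0 \<le> (\<Sum>j<n. v j)"
  using discrete_cube_cases by (intro sum_nonneg) force

lemma discrete_cube_Suc:
  "dc (Suc n) = (\<lambda>w. w(n := 0)) ` dc n \<union> (\<lambda>w. w(n := 1)) ` dc n"
proof (intro equalityI subsetI)
  fix v assume v: "v \<in> dc (Suc n)"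
  have w: "restrict v {..<n} \<in> dc n"
    using discrete_cube_cases[OF v] by simp
  have "v = (restrict v {..<n})(n := v n)"
    using v by (auto simp: fun_eq_iff discrete_cube_iff extensional_def restrict_def less_Suc_eq)
  moreover have "v n = 0 \<or> v n = 1" using discrete_cube_cases[OF v] by simp
  ultimately show "v \<in> (\<lambda>w. w(n := 0)) ` dc n \<union> (\<lambda>w. w(n := 1)) ` dc n"
    using w by (metis UnI1 UnI2 image_eqI)
next
  fix v assume "v \<in> (\<lambda>w. w(n := 0)) ` dc n \<union> (\<lambda>w. w(n := 1)) ` dc n"
  then show "v \<in> dc (Suc n)"
    by (auto simp: discrete_cube_iff extensional_def less_Suc_eq)
qed

lemma discrete_cube_upd_Suc: "w \<in> dc n \<Longrightarrow> a = 0 \<or> a = 1 \<Longrightarrow> w(n := a) \<in> dc (Suc n)"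
  unfolding discrete_cube_Suc by blast

lemma inj_on_upd_discrete_cube: "inj_on (\<lambda>w. w(n := a)) (dc n)"
proof (rule inj_onI)
  fix v w assume vw: "v \<in> dc n" "w \<in> dc n" "v(n := a) = w(n := a)"
  show "v = w"
  proof (rule discrete_cube_eqI[OF vw(1,2)])
    fix j assume "j < n"
    then show "v j = w j" using fun_cong[OF vw(3), of j] by simp
  qed
qed

lemma vertex_sign_upd:
  assumes "w \<in> dc n"
  shows "vertex_sign (Suc n) (w(n := 0)) = vertex_sign n w"
    "vertex_sign (Suc n) (w(n := 1)) = - vertex_sign n w"
  using discrete_cube_sum_nonneg[OF assms]
  by (auto simp: vertex_sign_def nat_add_distrib)

lemma vertex_sign_edge:
  assumes v: "v \<in> dc n" and j: "j < n"
  shows "vertex_sign n (v(j := 1)) = - vertex_sign n (v(j := 0))"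
proof -
  have "(\<Sum>i<n. (v(j := a)) i) = a + (\<Sum>i\<in>{..<n} - {j}. v i)" for a
    using j by (subst sum.remove[of _ j]) auto
  moreover have "0 \<le> (\<Sum>i\<in>{..<n} - {j}. v i)"
    using discrete_cube_cases[OF v] by (intro sum_nonneg) force
  ultimately show ?thesis by (simp add: vertex_sign_def nat_add_distrib)
qed

context comm_group
begin

lemma alt_prod_closed [simp]: "f \<in> dc n \<rightarrow> carrier G \<Longrightarrow> alt_prod G n f \<in> carrier G"
  unfolding alt_prod_def by (intro finprod_closed) auto

lemma alt_prod_cong:
  assumes "\<And>v. v \<in> dc n \<Longrightarrow> f v = g v" "g \<in> dc n \<rightarrow> carrier G"
  shows "alt_prod G n f = alt_prod G n g"
  unfolding alt_prod_def by (rule finprod_cong') (use assms in auto)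

lemma alt_prod_mult:
  assumes "f \<in> dc n \<rightarrow> carrier G" "g \<in> dc n \<rightarrow> carrier G"
  shows "alt_prod G n (\<lambda>v. f v \<otimes> g v) = alt_prod G n f \<otimes> alt_prod G n g"
proof -
  have "alt_prod G n (\<lambda>v. f v \<otimes> g v) =
      (\<Otimes>v\<in>dc n. f v [^] vertex_sign n v \<otimes> g v [^] vertex_sign n v)"
    unfolding alt_prod_def by (rule finprod_cong') (use assms in \<open>auto simp: int_pow_distrib Pi_iff\<close>)
  also have "\<dots> = alt_prod G n f \<otimes> alt_prod G n g"
    unfolding alt_prod_def by (rule finprod_multf) (use assms in auto)
  finally show ?thesis .
qed

lemma alt_prod_one: "alt_prod G n (\<lambda>v. \<one>) = \<one>"
  unfolding alt_prod_def by (rule finprod_one_eqI) simp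

lemma alt_prod_inv:
  assumes f: "f \<in> dc n \<rightarrow> carrier G"
  shows "alt_prod G n (\<lambda>v. inv (f v)) = inv (alt_prod G n f)"
proof -
  have g: "(\<lambda>v. inv (f v)) \<in> dc n \<rightarrow> carrier G" using f by auto
  have "alt_prod G n (\<lambda>v. inv (f v)) \<otimes> alt_prod G n f = alt_prod G n (\<lambda>v. \<one>)"
    unfolding alt_prod_mult[OF g f, symmetric] by (rule alt_prod_cong) (use f in \<open>auto simp: Pi_iff\<close>)
  then show ?thesis
    using inv_equality[OF _ alt_prod_closed[OF f] alt_prod_closed[OF g]] by (simp add: alt_prod_one)
qed

lemma alt_prod_Suc:
  assumes f: "f \<in> dc (Suc n) \<rightarrow> carrier G"
  shows "alt_prod G (Suc n) f =
    alt_prod G n (\<lambda>w. f (w(n := 0))) \<otimes> inv (alt_prod G n (\<lambda>w. f (w(n := 1))))"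
proof -
  let ?h = "\<lambda>v. f v [^] vertex_sign (Suc n) v"
  have fc: "f (w(n := a)) \<in> carrier G" if "w \<in> dc n" "a = 0 \<or> a = 1" for w a
    using f discrete_cube_upd_Suc[OF that] by blast
  have h: "?h \<in> (\<lambda>w. w(n := a)) ` dc n \<rightarrow> carrier G" if "a = 0 \<or> a = 1" for a
    using fc that by auto
  have "alt_prod G (Suc n) f = finprod G ?h ((\<lambda>w. w(n := 0)) ` dc n) \<otimes> finprod G ?h ((\<lambda>w. w(n := 1)) ` dc n)"
    unfolding alt_prod_def discrete_cube_Suc
  proof (rule finprod_Un_disjoint)
    have "v(n := 0) \<noteq> w(n := 1)" for v w :: "nat \<Rightarrow> int"
      by (metis fun_upd_same zero_neq_one)
    then show "(\<lambda>w. w(n := 0)) ` dc n \<inter> (\<lambda>w. w(n := 1)) ` dc n = {}" by blast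
  qed (use h in auto)
  also have "finprod G ?h ((\<lambda>w. w(n := 0)) ` dc n) = alt_prod G n (\<lambda>w. f (w(n := 0)))"
    unfolding finprod_reindex[OF h[of 0, simplified] inj_on_upd_discrete_cube] alt_prod_def
    by (rule finprod_cong') (use fc vertex_sign_upd in auto)
  also have "finprod G ?h ((\<lambda>w. w(n := 1)) ` dc n) = alt_prod G n (\<lambda>w. inv (f (w(n := 1))))"
    unfolding finprod_reindex[OF h[of 1, simplified] inj_on_upd_discrete_cube] alt_prod_def
    by (rule finprod_cong') (use fc vertex_sign_upd in \<open>auto simp: int_pow_neg int_pow_inv\<close>)
  also have "\<dots> = inv (alt_prod G n (\<lambda>w. f (w(n := 1))))"
    by (rule alt_prod_inv) (use fc in auto)
  finally show ?thesis .
qed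

lemma alt_prod_edge:
  assumes v: "v \<in> dc n" and j: "j < n" and a: "a \<in> carrier G"
  shows "alt_prod G n (\<lambda>s. if s = v(j := 0) \<or> s = v(j := 1) then a else \<one>) = \<one>"
proof -
  let ?h = "\<lambda>s. (if s = v(j := 0) \<or> s = v(j := 1) then a else \<one>) [^] vertex_sign n s"
  have ne: "v(j := 0) \<noteq> v(j := 1)" by (metis fun_upd_same zero_neq_one)
  have "finprod G ?h {v(j := 0), v(j := 1)} = finprod G ?h (dc n)"
    by (rule finprod_mono_neutral_cong_left) (use a discrete_cube_upd[OF v j] in auto)
  moreover have "finprod G ?h {v(j := 0), v(j := 1)} =
      a [^] vertex_sign n (v(j := 0)) \<otimes> a [^] vertex_sign n (v(j := 1))"
    using ne a by (subst finprod_insert) auto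
  moreover have "\<dots> = \<one>"
    unfolding vertex_sign_edge[OF v j] using a by (simp add: int_pow_neg)
  ultimately show ?thesis unfolding alt_prod_def by simp
qed

lemma alt_prod_top:
  assumes f: "f (top_vertex n) \<in> carrier G" "\<And>s. s \<in> dc n \<Longrightarrow> s \<noteq> top_vertex n \<Longrightarrow> f s = \<one>"
  shows "alt_prod G n f = f (top_vertex n) [^] vertex_sign n (top_vertex n)"
proof -
  have "finprod G (\<lambda>s. f s [^] vertex_sign n s) {top_vertex n} = alt_prod G n f"
    unfolding alt_prod_def
  proof (rule finprod_mono_neutral_cong_left)
    show "(\<lambda>s. f s [^] vertex_sign n s) \<in> dc n \<rightarrow> carrier G"
    proof
      fix s assume "s \<in> dc n"
      then show "f s [^] vertex_sign n s \<in> carrier G"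
        using f by (cases "s = top_vertex n") auto
    qed
  qed (use f in auto)
  then show ?thesis using f by simp
qed

lemma pow_vertex_sign_eq_one:
  assumes "x \<in> carrier G" "x [^] vertex_sign n v = \<one>"
  shows "x = \<one>"
  using vertex_sign_cases[of n v] assms by (auto simp: int_pow_neg)

end

section \<open>Existence of structure groups\<close>

text \<open>The situation of \<open>X\<^sub>k\<close> considered as a nilspace in its own right: \<open>\<sim>\<^sub>k\<close> is equality, hence
  \<open>(k+1)\<close>-corners have unique completions.\<close>

locale top_factor = nilspace X C for X :: "'a set" and C +
  fixes k :: nat
  assumes k_pos: "k > 0"
    and separated: "(x, y) \<in> rel k \<Longrightarrow> x = y"
begin

lemma unique_top:
  assumes "c \<in> C (k + 1)" "c' \<in> C (k + 1)"
    "\<And>s. s \<in> dc (k + 1) \<Longrightarrow> s \<noteq> top_vertex (k + 1) \<Longrightarrow> c s = c' s"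
  shows "c (top_vertex (k + 1)) = c' (top_vertex (k + 1))"
  using rel_topI[OF assms] separated by blast

lemma cube_by_faces:
  assumes g: "g \<in> dc n \<rightarrow>\<^sub>E X"
    and faces: "\<And>\<phi>. cube_morphism (k + 1) n \<phi> \<Longrightarrow> (\<lambda>s\<in>dc (k + 1). g (\<phi> s)) \<in> C (k + 1)"
  shows "g \<in> C n"
proof -
  have "\<exists>c. c \<in> C n \<and> (\<forall>v\<in>dc n. (c v, g v) \<in> rel k)"
    by (rule pointwise_lift[of "dc n" n g k]) (use g faces in auto)
  then obtain c where c: "c \<in> C n" "\<And>v. v \<in> dc n \<Longrightarrow> c v = g v"
    using separated by blast
  have "c = g"
    by (rule extensionalityI[OF cube_ext[OF c(1)]]) (use g c(2) in \<open>auto simp: PiE_iff\<close>)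
  with c(1) show ?thesis by simp
qed

text \<open>The maps on the faces \<open>s k = 0\<close> and \<open>s k = 1\<close> are the cubes witnessing \<open>x \<sim>\<^sub>k\<^sub>-\<^sub>1 x'\<close> and \<open>y \<sim>\<^sub>k\<^sub>-\<^sub>1 y'\<close>. Together
  they form a cube iff \<open>x'\<close> differs from \<open>x\<close> by the same element of the structure group as \<open>y'\<close> from \<open>y\<close>.\<close>

definition parallelogram :: "'a \<Rightarrow> 'a \<Rightarrow> 'a \<Rightarrow> 'a \<Rightarrow> bool" where
  "parallelogram x x' y y' \<longleftrightarrow>
     (\<lambda>s\<in>dc (k + 1). if \<forall>l<k. s l = 1 then (if s k = 0 then x' else y')
                     else (if s k = 0 then x else y)) \<in> C (k + 1)"

lemma all_less_k_top:
  assumes "s \<in> dc (k + 1)"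
  shows "s = top_vertex (k + 1) \<longleftrightarrow> (\<forall>l<k. s l = 1) \<and> s k = 1"
  unfolding eq_top_vertex_iff[OF assms] by (auto simp: less_Suc_eq)

lemma rel_pred_iff:
  "(x, y) \<in> rel (k - 1) \<longleftrightarrow> x \<in> X \<and> y \<in> X \<and> (\<lambda>s\<in>dc k. if \<forall>l<k. s l = 1 then y else x) \<in> C k"
proof -
  have "(\<lambda>s\<in>dc k. if s = top_vertex k then y else x) = (\<lambda>s\<in>dc k. if \<forall>l<k. s l = 1 then y else x)"
    by (rule restrict_ext) (simp add: eq_top_vertex_iff)
  then show ?thesis using k_pos by (simp add: rel_iff)
qed

lemma parallelogram_rel:
  assumes "parallelogram x x' y y'"
  shows "(x, x') \<in> rel (k - 1)" "(y, y') \<in> rel (k - 1)"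
proof -
  let ?c = "\<lambda>s\<in>dc (k + 1). if \<forall>l<k. s l = 1 then (if s k = 0 then x' else y')
                     else (if s k = 0 then x else y)"
  have c: "?c \<in> C (k + 1)" using assms by (simp add: parallelogram_def)
  have vals: "?c (\<lambda>l\<in>{..<k + 1}. if l < k then s l else a) =
      (if \<forall>l<k. s l = 1 then (if a = 0 then x' else y') else (if a = 0 then x else y))"
    if "s \<in> dc k" "a = 0 \<or> a = 1" for s a
  proof -
    have "(\<lambda>l\<in>{..<k + 1}. if l < k then s l else a) \<in> dc (k + 1)"
      using discrete_cube_cases[OF that(1)] that(2) by auto
    note * = restrict_apply'[OF this]
    show ?thesis unfolding * by auto
  qed
  have main: "(\<lambda>s\<in>dc k. if \<forall>l<k. s l = 1 then (if a = 0 then x' else y') else (if a = 0 then x else y)) \<in> C k"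
    if "a = 0 \<or> a = 1" for a :: int
  proof (rule cube_compose_affine[OF c, where \<phi> = "\<lambda>s l. if l < k then s l else a"])
    fix s l assume "s \<in> dc k" "l < k + 1"
    then show "(if l < k then s l else a) = 0 \<or> (if l < k then s l else a) = 1"
      using discrete_cube_cases that by auto
  next
    fix l show "affine_fun k (\<lambda>s. if l < k then s l else a)" by (cases "l < k") auto
  qed (rule vals[OF _ that, symmetric])
  obtain s0 :: "nat \<Rightarrow> int" where s0: "s0 \<in> dc k" "\<not> (\<forall>l<k. s0 l = 1)"
    using k_pos by (intro that[of "\<lambda>l\<in>{..<k}. 0"]) auto
  have top: "\<forall>l<k. top_vertex k l = 1" by (simp add: top_vertex_def)
  have "x \<in> X" "x' \<in> X" "y \<in> X" "y' \<in> X"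
    using cube_in[OF main[of 0] s0(1)] cube_in[OF main[of 0] top_vertex_in]
      cube_in[OF main[of 1] s0(1)] cube_in[OF main[of 1] top_vertex_in] s0 top
    by (simp_all del: not_all)
  moreover have "(\<lambda>s\<in>dc k. if \<forall>l<k. s l = 1 then x' else x) \<in> C k"
    by (rule restrict_cube[OF main[of 0]]) auto
  moreover have "(\<lambda>s\<in>dc k. if \<forall>l<k. s l = 1 then y' else y) \<in> C k"
    by (rule restrict_cube[OF main[of 1]]) auto
  ultimately show "(x, x') \<in> rel (k - 1)" "(y, y') \<in> rel (k - 1)"
    unfolding rel_pred_iff by auto
qed

lemma two_point_cube:
  assumes "x \<in> X" "y \<in> X" "j < n"
  shows "(\<lambda>s\<in>dc n. if s j = 0 then x else y) \<in> C n"
proof (rule cube_compose_affine[where \<phi> = "\<lambda>s l. s j" and n = 1])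
  show "(\<lambda>s\<in>dc 1. if s 0 = 0 then x else y) \<in> C 1"
    using assms unfolding ergodicity by auto
  fix s assume s: "s \<in> dc n"
  have "(\<lambda>l\<in>{..<1}. s j) \<in> dc 1" using discrete_cube_cases[OF s assms(3)] by auto
  note * = restrict_apply'[OF this]
  show "(if s j = 0 then x else y) = (\<lambda>s\<in>dc 1. if s 0 = 0 then x else y) (\<lambda>l\<in>{..<1}. s j)"
    unfolding * by simp
qed (use assms(3) discrete_cube_cases in auto)

lemma parallelogram_trivial: "x \<in> X \<Longrightarrow> y \<in> X \<Longrightarrow> parallelogram x x y y"
  unfolding parallelogram_def by (rule restrict_cube[OF two_point_cube[of x y k]]) auto

lemma parallelogram_same:
  assumes "(x, x') \<in> rel (k - 1)"
  shows "parallelogram x x' x x'"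
  unfolding parallelogram_def
proof (rule cube_compose_affine[where \<phi> = "\<lambda>s. s" and n = k])
  show "(\<lambda>s\<in>dc k. if \<forall>l<k. s l = 1 then x' else x) \<in> C k"
    using assms unfolding rel_pred_iff by simp
  fix s assume s: "s \<in> dc (k + 1)"
  have "(\<lambda>l\<in>{..<k}. s l) \<in> dc k" using discrete_cube_cases[OF s] by auto
  note * = restrict_apply'[OF this]
  show "(if \<forall>l<k. s l = 1 then if s k = 0 then x' else x' else if s k = 0 then x else x) =
     (\<lambda>s\<in>dc k. if \<forall>l<k. s l = 1 then x' else x) (\<lambda>l\<in>{..<k}. s l)"
    unfolding * by auto
qed (use discrete_cube_cases in auto)

lemma parallelogram_sym:
  assumes "parallelogram x x' y y'"
  shows "parallelogram y y' x x'"
  unfolding parallelogram_def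
proof (rule cube_compose_affine[OF assms[unfolded parallelogram_def],
      where \<phi> = "\<lambda>s l. if l = k then 1 - s k else s l"])
  fix s l assume "s \<in> dc (k + 1)" "l < k + 1"
  then show "(if l = k then 1 - s k else s l) = 0 \<or> (if l = k then 1 - s k else s l) = 1"
    using discrete_cube_cases[of s "k + 1" l] by auto
next
  fix l assume "l < k + 1"
  then show "affine_fun (k + 1) (\<lambda>s. if l = k then 1 - s k else s l)" by (cases "l = k") auto
next
  fix s assume s: "s \<in> dc (k + 1)"
  have "(\<lambda>l\<in>{..<k + 1}. if l = k then 1 - s k else s l) \<in> dc (k + 1)"
    using discrete_cube_cases[OF s] by force
  note * = restrict_apply'[OF this]
  show "(if \<forall>l<k. s l = 1 then if s k = 0 then y' else x' else if s k = 0 then y else x) =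
    (\<lambda>s\<in>dc (k + 1). if \<forall>l<k. s l = 1 then if s k = 0 then x' else y' else if s k = 0 then x else y)
      (\<lambda>l\<in>{..<k + 1}. if l = k then 1 - s k else s l)"
    unfolding * using discrete_cube_cases[OF s, of k] by auto
qed

text \<open>Glue the two cubes along the face \<open>(y, y')\<close> which they have in common.\<close>

lemma parallelogram_trans:
  assumes 1: "parallelogram x x' y y'" and 2: "parallelogram y y' z z'"
  shows "parallelogram x x' z z'"
proof -
  let ?c = "\<lambda>s\<in>dc (k + 1). if \<forall>l<k. s l = 1 then (if s k = 0 then y' else x')
                     else (if s k = 0 then y else x)"
  let ?d = "\<lambda>s. if \<forall>l<k. s l = 1 then z' else z"
  have c: "?c \<in> C (k + 1)"
    using parallelogram_sym[OF 1] by (simp add: parallelogram_def)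
  have "(\<lambda>s\<in>dc (k + 1). if \<forall>l\<in>{k}. s l = 0 then ?d s else ?c s) \<in> C (k + 1)"
  proof (rule face_replacement[OF c])
    show "(\<lambda>s\<in>dc (k + 1). if \<forall>l\<in>{k}. s l = 1 then ?d (zero_on (k + 1) {k} s)
        else ?c (zero_on (k + 1) {k} s)) \<in> C (k + 1)"
    proof (rule restrict_cube[OF 2[unfolded parallelogram_def]])
      fix s assume s: "s \<in> dc (k + 1)"
      have "zero_on (k + 1) {k} s \<in> dc (k + 1)"
        using discrete_cube_cases[OF s] by (auto simp: zero_on_def)
      note * = restrict_apply'[OF this]
      show "(\<lambda>s\<in>dc (k + 1). if \<forall>l<k. s l = 1 then (if s k = 0 then y' else z')
                     else (if s k = 0 then y else z)) s =
         (if \<forall>l\<in>{k}. s l = 1 then ?d (zero_on (k + 1) {k} s) else ?c (zero_on (k + 1) {k} s))"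
        unfolding * using s discrete_cube_cases[OF s, of k] by (auto simp: zero_on_def)
    qed
  qed auto
  then have "parallelogram z z' x x'"
    unfolding parallelogram_def by (rule restrict_cube) auto
  then show ?thesis by (rule parallelogram_sym)
qed

text \<open>The three given points form a corner, and \<open>y'\<close> completes it.\<close>

lemma parallelogram_exists:
  assumes r: "(x, x') \<in> rel (k - 1)" and y: "y \<in> X"
  shows "\<exists>y'. parallelogram x x' y y'"
proof -
  have X: "x \<in> X" "x' \<in> X" using r rel_in by auto
  have "\<exists>y'. (\<lambda>s\<in>dc (k + 1). if s = top_vertex (k + 1) then y'
      else (if s k = 0 then (if \<forall>l<k. s l = 1 then x' else x) else y)) \<in> C (k + 1)"
  proof (rule corner_completion)
    fix i assume i: "i < k + 1"
    show "(\<lambda>s\<in>dc (k + 1 - 1). if face_map (k + 1) i s k = 0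
        then (if \<forall>l<k. face_map (k + 1) i s l = 1 then x' else x) else y) \<in> C (k + 1 - 1)"
    proof (cases "i = k")
      case True
      have "(\<lambda>s\<in>dc k. if \<forall>l<k. s l = 1 then x' else x) \<in> C k"
        using r unfolding rel_pred_iff by simp
      then have "(\<lambda>s\<in>dc k. if face_map (k + 1) i s k = 0
        then (if \<forall>l<k. face_map (k + 1) i s l = 1 then x' else x) else y) \<in> C k"
        by (rule restrict_cube) (simp add: face_map_def True)
      then show ?thesis by simp
    next
      case False
      then have i: "i < k" using i by simp
      have "(\<lambda>s\<in>dc k. if face_map (k + 1) i s k = 0
        then (if \<forall>l<k. face_map (k + 1) i s l = 1 then x' else x) else y) \<in> C k"
      proof (rule restrict_cube[OF two_point_cube[OF X(1) y]])
        show "k - 1 < k" using k_pos by simp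
        fix s
        have "face_map (k + 1) i s i \<noteq> 1" "face_map (k + 1) i s k = s (k - 1)"
          using i by (auto simp: face_map_def)
        then show "s \<in> dc k \<Longrightarrow> (\<lambda>s\<in>dc k. if s (k - 1) = 0 then x else y) s =
            (if face_map (k + 1) i s k = 0
            then (if \<forall>l<k. face_map (k + 1) i s l = 1 then x' else x) else y)"
          using i by auto
      qed
      then show ?thesis by simp
    qed
  qed (use X y in auto)
  then obtain y' where "(\<lambda>s\<in>dc (k + 1). if s = top_vertex (k + 1) then y'
      else (if s k = 0 then (if \<forall>l<k. s l = 1 then x' else x) else y)) \<in> C (k + 1)" by blast
  then have "parallelogram x x' y y'"
    unfolding parallelogram_def
  proof (rule restrict_cube)
    fix s assume s: "s \<in> dc (k + 1)"
    show "(\<lambda>s\<in>dc (k + 1). if s = top_vertex (k + 1) then y'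
        else (if s k = 0 then (if \<forall>l<k. s l = 1 then x' else x) else y)) s =
      (if \<forall>l<k. s l = 1 then (if s k = 0 then x' else y') else (if s k = 0 then x else y))"
      using s all_less_k_top[OF s] discrete_cube_cases[OF s, of k] by auto
  qed
  then show ?thesis by blast
qed

lemma parallelogram_unique:
  assumes "parallelogram x x' y y1" "parallelogram x x' y y2"
  shows "y1 = y2"
proof -
  have T: "top_vertex (k + 1) k = 1" "\<forall>l<k. top_vertex (k + 1) l = 1"
    by (auto simp: top_vertex_def)
  have "(\<lambda>s\<in>dc (k + 1). if \<forall>l<k. s l = 1 then (if s k = 0 then x' else y1)
                     else (if s k = 0 then x else y)) (top_vertex (k + 1)) =
      (\<lambda>s\<in>dc (k + 1). if \<forall>l<k. s l = 1 then (if s k = 0 then x' else y2)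
                     else (if s k = 0 then x else y)) (top_vertex (k + 1))"
  proof (rule unique_top[OF assms[unfolded parallelogram_def]])
    fix s assume s: "s \<in> dc (k + 1)" "s \<noteq> top_vertex (k + 1)"
    then have "\<not> ((\<forall>l<k. s l = 1) \<and> s k = 1)" using all_less_k_top by blast
    then show "(\<lambda>s\<in>dc (k + 1). if \<forall>l<k. s l = 1 then (if s k = 0 then x' else y1)
                     else (if s k = 0 then x else y)) s =
      (\<lambda>s\<in>dc (k + 1). if \<forall>l<k. s l = 1 then (if s k = 0 then x' else y2)
                     else (if s k = 0 then x else y)) s"
      unfolding restrict_apply'[OF s(1)] using discrete_cube_cases[OF s(1), of k] by auto
  qed
  then show ?thesis
    unfolding restrict_apply'[OF top_vertex_in] using T by simp
qed

text \<open>This is \<open>face_replacement\<close> for an edge: the auxiliary cube required there is the parallelogram. A symmetry of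
  the cube moves the edge of \<open>v\<close> in direction \<open>j\<close> to the edge of the origin in direction \<open>k\<close>.\<close>

theorem parallelogram_edge:
  assumes c: "c \<in> C (k + 1)" and v: "v \<in> dc (k + 1)" and j: "j < k + 1"
    and par: "parallelogram (c (v(j := 0))) x' (c (v(j := 1))) y'"
  shows "(\<lambda>s\<in>dc (k + 1). if s = v(j := 0) then x' else if s = v(j := 1) then y' else c s) \<in> C (k + 1)"
proof -
  let ?n = "k + 1"
  \<comment> \<open>The symmetry exchanges the directions \<open>j\<close> and \<open>k\<close> and reflects the other directions in which
    \<open>v\<close> has coordinate \<open>1\<close>.\<close>
  define \<pi> where "\<pi> l = (if l = j then k else if l = k then j else l)" for l
  define fl where "fl l x = (if l \<noteq> j \<and> v l = 1 then 1 - x else x)" for l and x :: int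
  have \<pi>: "\<pi> (\<pi> l) = l" "l < ?n \<Longrightarrow> \<pi> l < ?n" "\<pi> l = k \<longleftrightarrow> l = j" "\<pi> l = j \<longleftrightarrow> l = k" for l
    using j by (auto simp: \<pi>_def)
  have flfl: "fl l (fl l x) = x" for l x by (simp add: fl_def)
  have fl01: "x = 0 \<or> x = 1 \<Longrightarrow> fl l x = 0 \<or> fl l x = 1" for l x by (auto simp: fl_def)
  have flaff: "affine_fun m f \<Longrightarrow> affine_fun m (\<lambda>s. fl l (f s))" for m f l
    by (cases "l = j"; cases "v l = 1"; simp add: fl_def)
  define c' where "c' = (\<lambda>s\<in>dc ?n. c (\<lambda>l\<in>{..<?n}. fl l (s (\<pi> l))))"
  have c': "c' \<in> C ?n"
    unfolding c'_def
  proof (rule cube_compose_affine[OF c, where \<phi> = "\<lambda>s l. fl l (s (\<pi> l))"])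
    fix s l assume "s \<in> dc ?n" "l < ?n"
    then show "fl l (s (\<pi> l)) = 0 \<or> fl l (s (\<pi> l)) = 1"
      using discrete_cube_cases \<pi>(2) fl01 by blast
  next
    fix l assume "l < ?n"
    then show "affine_fun ?n (\<lambda>s. fl l (s (\<pi> l)))"
      using \<pi>(2) by (intro flaff affine_fun_coord)
  qed auto
  define d where "d s = (if s k = 0 then x' else y')" for s :: "nat \<Rightarrow> int"
  have "(\<lambda>s\<in>dc ?n. if \<forall>l\<in>{..<k}. s l = 0 then d s else c' s) \<in> C ?n"
  proof (rule face_replacement[OF c'])
    show "(\<lambda>s\<in>dc ?n. if \<forall>l\<in>{..<k}. s l = 1 then d (zero_on ?n {..<k} s) else c' (zero_on ?n {..<k} s)) \<in> C ?n"
    proof (rule restrict_cube[OF par[unfolded parallelogram_def]])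
      fix s assume s: "s \<in> dc ?n"
      have sk: "s k = 0 \<or> s k = 1" using discrete_cube_cases[OF s] by simp
      have z: "zero_on ?n {..<k} s \<in> dc ?n"
        using discrete_cube_cases[OF s] by (auto simp: zero_on_def)
      have zk: "zero_on ?n {..<k} s k = s k" by (simp add: zero_on_def)
      have "(\<lambda>l\<in>{..<?n}. fl l (zero_on ?n {..<k} s (\<pi> l))) = v(j := s k)"
      proof (rule extensionalityI[of _ "{..<?n}"])
        show "v(j := s k) \<in> extensional {..<?n}" using v j by (auto simp: discrete_cube_iff extensional_def)
      next
        fix l assume "l \<in> {..<?n}"
        then have l: "l < ?n" by simp
        have "fl l (zero_on ?n {..<k} s (\<pi> l)) = (v(j := s k)) l"
        proof (cases "l = j")
          case True
          then show ?thesis using zk by (simp add: fl_def \<pi>_def)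
        next
          case False
          then have "\<pi> l < k" using \<pi>(2)[OF l] \<pi>(3)[of l] by simp
          then show ?thesis
            using False discrete_cube_cases[OF v l] by (auto simp: fl_def zero_on_def)
        qed
        then show "(\<lambda>l\<in>{..<?n}. fl l (zero_on ?n {..<k} s (\<pi> l))) l = (v(j := s k)) l"
          using l by simp
      qed simp
      then have "c' (zero_on ?n {..<k} s) = c (v(j := s k))"
        unfolding c'_def restrict_apply'[OF z] by (simp only:)
      then show "(\<lambda>s\<in>dc ?n. if \<forall>l<k. s l = 1 then (if s k = 0 then x' else y')
          else (if s k = 0 then c (v(j := 0)) else c (v(j := 1)))) s =
        (if \<forall>l\<in>{..<k}. s l = 1 then d (zero_on ?n {..<k} s) else c' (zero_on ?n {..<k} s))"
        unfolding d_def zk restrict_apply'[OF s] using sk by auto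
    qed
  qed auto
  then show ?thesis
  proof (rule cube_compose_affine[where \<phi> = "\<lambda>s l. fl (\<pi> l) (s (\<pi> l))"])
    fix s l assume "s \<in> dc ?n" "l < ?n"
    then show "fl (\<pi> l) (s (\<pi> l)) = 0 \<or> fl (\<pi> l) (s (\<pi> l)) = 1"
      using discrete_cube_cases \<pi>(2) fl01 by blast
  next
    fix l assume "l < ?n"
    then show "affine_fun ?n (\<lambda>s. fl (\<pi> l) (s (\<pi> l)))"
      using \<pi>(2) by (intro flaff affine_fun_coord)
  next
    fix s assume s: "s \<in> dc ?n"
    let ?u = "\<lambda>l\<in>{..<?n}. fl (\<pi> l) (s (\<pi> l))"
    have u: "?u \<in> dc ?n"
      unfolding restrict_in_discrete_cube using discrete_cube_cases[OF s] \<pi>(2) fl01 by blast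
    have inv: "(\<lambda>l\<in>{..<?n}. fl l (?u (\<pi> l))) = s"
    proof (rule extensionalityI[of _ "{..<?n}"])
      fix l assume "l \<in> {..<?n}"
      then show "(\<lambda>l\<in>{..<?n}. fl l (?u (\<pi> l))) l = s l"
        using \<pi>(1)[of l] \<pi>(2)[of l] flfl by simp
    qed (use s in \<open>auto simp: discrete_cube_iff\<close>)
    have uk: "?u k = s j" by (simp add: \<pi>_def fl_def)
    have "(\<forall>l\<in>{..<k}. ?u l = 0) \<longleftrightarrow> (\<forall>l<?n. l \<noteq> j \<longrightarrow> s l = v l)"
    proof
      assume L: "\<forall>l\<in>{..<k}. ?u l = 0"
      show "\<forall>l<?n. l \<noteq> j \<longrightarrow> s l = v l"
      proof (intro allI impI)
        fix l assume l: "l < ?n" "l \<noteq> j"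
        then have "\<pi> l < k" using \<pi>(2)[OF l(1)] \<pi>(3)[of l] by simp
        then have "fl l (s l) = 0" using L[rule_format, of "\<pi> l"] \<pi>(1)[of l] by simp
        then show "s l = v l"
          using l discrete_cube_cases[OF v l(1)] by (auto simp: fl_def split: if_splits)
      qed
    next
      assume R: "\<forall>l<?n. l \<noteq> j \<longrightarrow> s l = v l"
      show "\<forall>l\<in>{..<k}. ?u l = 0"
      proof
        fix l assume "l \<in> {..<k}"
        then have l: "l < k" by simp
        then have "\<pi> l < ?n" "\<pi> l \<noteq> j" using \<pi>(2,4)[of l] by auto
        then have "s (\<pi> l) = v (\<pi> l)" "v (\<pi> l) = 0 \<or> v (\<pi> l) = 1"
          using R discrete_cube_cases[OF v] by auto
        then show "?u l = 0" using l \<open>\<pi> l \<noteq> j\<close> by (auto simp: fl_def)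
      qed
    qed
    moreover have "(\<forall>l<?n. l \<noteq> j \<longrightarrow> s l = v l) \<longleftrightarrow> s = v(j := s j)"
    proof
      assume *: "\<forall>l<?n. l \<noteq> j \<longrightarrow> s l = v l"
      show "s = v(j := s j)"
        by (rule discrete_cube_eqI[OF s discrete_cube_upd[OF v j discrete_cube_cases[OF s j]]])
          (use * in auto)
    next
      assume "s = v(j := s j)"
      then show "\<forall>l<?n. l \<noteq> j \<longrightarrow> s l = v l" by (metis fun_upd_other)
    qed
    ultimately have iff: "(\<forall>l\<in>{..<k}. ?u l = 0) \<longleftrightarrow> s = v(j := s j)" by (rule trans)
    have v0: "s = v(j := 0) \<longleftrightarrow> s = v(j := s j) \<and> s j = 0"
      and v1: "s = v(j := 1) \<longleftrightarrow> s = v(j := s j) \<and> s j = 1"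
      by (metis fun_upd_same)+
    show "(if s = v(j := 0) then x' else if s = v(j := 1) then y' else c s) =
        (\<lambda>s\<in>dc ?n. if \<forall>l\<in>{..<k}. s l = 0 then d s else c' s) ?u"
      unfolding restrict_apply'[OF u] iff c'_def inv d_def uk v0 v1
      using discrete_cube_cases[OF s j] by auto
  qed
qed

text \<open>Replace the top edge \<open>(x', y')\<close> of the first cube by \<open>(x'', y'')\<close>.\<close>

lemma parallelogram_stack:
  assumes 1: "parallelogram x x' y y'" and 2: "parallelogram x' x'' y' y''"
  shows "parallelogram x x'' y y''"
proof -
  let ?n = "k + 1"
  let ?c = "\<lambda>s\<in>dc ?n. if \<forall>l<k. s l = 1 then (if s k = 0 then x' else y')
                     else (if s k = 0 then x else y)"
  let ?T = "top_vertex ?n"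
  have T: "?T(k := a) \<in> dc ?n" if "a = 0 \<or> a = 1" for a
    by (rule discrete_cube_upd) (use that in auto)
  have T01: "?T(k := 0) \<in> dc ?n" "?T(k := 1) \<in> dc ?n" by (rule T; simp)+
  have Tl: "\<forall>l<k. ?T l = 1" by (simp add: top_vertex_def)
  have "(\<lambda>s\<in>dc ?n. if s = ?T(k := 0) then x'' else if s = ?T(k := 1) then y'' else ?c s) \<in> C ?n"
  proof (rule parallelogram_edge[OF 1[unfolded parallelogram_def] top_vertex_in])
    have "?c (?T(k := 0)) = x'" "?c (?T(k := 1)) = y'"
      unfolding restrict_apply'[OF T01(1)] restrict_apply'[OF T01(2)] using Tl by auto
    then show "parallelogram (?c (?T(k := 0))) x'' (?c (?T(k := 1))) y''"
      using 2 by (simp only:)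
  qed simp
  then show ?thesis
    unfolding parallelogram_def
  proof (rule restrict_cube)
    fix s assume s: "s \<in> dc ?n"
    have iff: "s = ?T(k := a) \<longleftrightarrow> (\<forall>l<k. s l = 1) \<and> s k = a" if a: "a = 0 \<or> a = 1" for a
    proof
      assume "(\<forall>l<k. s l = 1) \<and> s k = a"
      then show "s = ?T(k := a)"
        by (intro discrete_cube_eqI[OF s T[OF a]]) (auto simp: top_vertex_def less_Suc_eq)
    qed (use Tl in auto)
    have *: "s = ?T(k := 0) \<longleftrightarrow> (\<forall>l<k. s l = 1) \<and> s k = 0" "s = ?T(k := 1) \<longleftrightarrow> (\<forall>l<k. s l = 1) \<and> s k = 1"
      by (rule iff; simp)+
    show "(\<lambda>s\<in>dc ?n. if s = ?T(k := 0) then x'' else if s = ?T(k := 1) then y'' else ?c s) s =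
      (if \<forall>l<k. s l = 1 then (if s k = 0 then x'' else y'') else (if s k = 0 then x else y))"
      unfolding restrict_apply'[OF s] * using discrete_cube_cases[OF s, of k] by auto
  qed
qed

end

context top_factor
begin

text \<open>Intuitively \<open>x + (a - e)\<close>. This makes the fibre of \<open>e\<close> a group with unit \<open>e\<close> which acts on all of \<open>X\<close>.\<close>

definition translate :: "'a \<Rightarrow> 'a \<Rightarrow> 'a \<Rightarrow> 'a" where
  "translate e a x = (THE x'. parallelogram e a x x')"

lemma translate_eqI: "parallelogram e a x x' \<Longrightarrow> translate e a x = x'"
  unfolding translate_def by (rule the_equality) (auto intro: parallelogram_unique)

lemma translate_parallelogram:
  assumes "(e, a) \<in> rel (k - 1)" "x \<in> X"
  shows "parallelogram e a x (translate e a x)"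
  using parallelogram_exists[OF assms] translate_eqI by metis

lemma translate_rel:
  "(e, a) \<in> rel (k - 1) \<Longrightarrow> x \<in> X \<Longrightarrow> (x, translate e a x) \<in> rel (k - 1)"
  using parallelogram_rel(2)[OF translate_parallelogram] .

lemma translate_in: "(e, a) \<in> rel (k - 1) \<Longrightarrow> x \<in> X \<Longrightarrow> translate e a x \<in> X"
  using translate_rel rel_in by blast

lemma translate_parallelogram2:
  assumes "(e, a) \<in> rel (k - 1)" "x \<in> X" "y \<in> X"
  shows "parallelogram x (translate e a x) y (translate e a y)"
  using parallelogram_trans[OF parallelogram_sym] translate_parallelogram assms by blast

lemma translate_base: "e \<in> X \<Longrightarrow> x \<in> X \<Longrightarrow> translate e e x = x"
  by (rule translate_eqI) (rule parallelogram_trivial)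

lemma translate_to_base: "(e, a) \<in> rel (k - 1) \<Longrightarrow> translate e a e = a"
  by (rule translate_eqI) (rule parallelogram_same)

lemma translate_closed:
  "(e, a) \<in> rel (k - 1) \<Longrightarrow> (e, b) \<in> rel (k - 1) \<Longrightarrow> (e, translate e a b) \<in> rel (k - 1)"
  using rel_trans translate_rel rel_in by blast

lemma translate_translate:
  assumes a: "(e, a) \<in> rel (k - 1)" and b: "(e, b) \<in> rel (k - 1)" and x: "x \<in> X"
  shows "translate e (translate e a b) x = translate e a (translate e b x)"
proof (rule translate_eqI)
  have bx: "translate e b x \<in> X" "b \<in> X" using translate_in[OF b x] rel_in[OF b] by auto
  show "parallelogram e (translate e a b) x (translate e a (translate e b x))"
    using parallelogram_stack[OF translate_parallelogram[OF b x]
        translate_parallelogram2[OF a bx(2) bx(1)]] .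
qed

text \<open>Parallel transport by \<open>a\<close> of the two ends of an edge gives a parallelogram.\<close>

lemma translate_edge:
  assumes a: "(e, a) \<in> rel (k - 1)" and c: "c \<in> C (k + 1)" and v: "v \<in> dc (k + 1)" and j: "j < k + 1"
  shows "(\<lambda>s\<in>dc (k + 1). if s = v(j := 0) \<or> s = v(j := 1) then translate e a (c s) else c s) \<in> C (k + 1)"
proof -
  have "v(j := 0) \<in> dc (k + 1)" "v(j := 1) \<in> dc (k + 1)"
    using discrete_cube_upd[OF v j] by auto
  then have "parallelogram (c (v(j := 0))) (translate e a (c (v(j := 0))))
      (c (v(j := 1))) (translate e a (c (v(j := 1))))"
    using translate_parallelogram2[OF a] cube_in[OF c] by blast
  from parallelogram_edge[OF c v j this] show ?thesis
    by (rule restrict_cube) auto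
qed

text \<open>In the constant cube \<open>x\<close> of dimension \<open>k + 1 \<ge> 2\<close>, translate one edge at the top vertex by \<open>a\<close> and another one
  by \<open>b\<close>. The order of the two operations only affects the top vertex, whose value is determined by the
  others.\<close>

lemma translate_commute:
  assumes a: "(e, a) \<in> rel (k - 1)" and b: "(e, b) \<in> rel (k - 1)" and x: "x \<in> X"
  shows "translate e a (translate e b x) = translate e b (translate e a x)"
proof -
  let ?n = "k + 1"
  let ?T = "top_vertex ?n"
  have T1: "?T(j := 1) = ?T" if "j < ?n" for j
    using that by (auto simp: top_vertex_def)
  have n: "0 < ?n" "k < ?n" by simp_all
  have T0: "?T(j := 0) \<in> dc ?n" if "j < ?n" for j
    by (rule discrete_cube_upd) (use that in auto)
  have ne: "?T(j := 0) \<noteq> ?T" if "j < ?n" for j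
  proof
    assume eq: "?T(j := 0) = ?T"
    show False using fun_cong[OF eq, of j] that by (simp add: top_vertex_def)
  qed
  have ne2: "?T(0 := 0) \<noteq> ?T(k := 0)"
  proof
    assume eq: "?T(0 := 0) = ?T(k := 0)"
    show False using fun_cong[OF eq, of k] k_pos by (simp add: top_vertex_def)
  qed
  define E where "E a j c = (\<lambda>s\<in>dc ?n. if s = ?T(j := 0) \<or> s = ?T(j := 1) then translate e a (c s) else c s)"
    for a j c
  have E: "E a j c \<in> C ?n" if "(e, a) \<in> rel (k - 1)" "j < ?n" "c \<in> C ?n" for a j c
    unfolding E_def by (rule translate_edge[OF that(1,3) top_vertex_in that(2)])
  have Eval: "E a j c s = (if s = ?T(j := 0) \<or> s = ?T then translate e a (c s) else c s)"
    if "s \<in> dc ?n" "j < ?n" for s a j c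
    unfolding E_def restrict_apply'[OF that(1)] T1[OF that(2)] ..
  let ?c = "\<lambda>s\<in>dc ?n. x"
  have c: "?c \<in> C ?n" by (rule const_cube[OF x])
  have "E a 0 (E b k ?c) ?T = E b k (E a 0 ?c) ?T"
  proof (rule unique_top)
    show "E a 0 (E b k ?c) \<in> C ?n" by (intro E a b c n)
    show "E b k (E a 0 ?c) \<in> C ?n" by (intro E a b c n)
    fix s assume s: "s \<in> dc ?n" "s \<noteq> ?T"
    show "E a 0 (E b k ?c) s = E b k (E a 0 ?c) s"
      unfolding Eval[OF s(1) n(1)] Eval[OF s(1) n(2)] using s ne2 by auto
  qed
  then show ?thesis
    unfolding Eval[OF top_vertex_in n(1)] Eval[OF top_vertex_in n(2)] by simp
qed

lemma translate_cancel:
  assumes "(e, a) \<in> rel (k - 1)" "x \<in> X" "translate e a x = x"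
  shows "a = e"
proof -
  have e: "e \<in> X" using assms(1) rel_in by blast
  have "parallelogram x x e a"
    using parallelogram_sym[OF translate_parallelogram[OF assms(1,2)]] assms(3) by simp
  then show ?thesis
    using parallelogram_unique[OF _ parallelogram_trivial[OF assms(2) e]] by blast
qed

lemma translate_transitive:
  assumes "(x, x') \<in> rel (k - 1)" "e \<in> X"
  obtains a where "(e, a) \<in> rel (k - 1)" "translate e a x = x'"
proof -
  obtain a where a: "parallelogram x x' e a" using parallelogram_exists[OF assms] by blast
  show thesis
    using that[OF parallelogram_rel(2)[OF a]] translate_eqI[OF parallelogram_sym[OF a]] by blast
qed

definition fibre_group :: "'a \<Rightarrow> 'a monoid" where
  "fibre_group e = \<lparr>carrier = {a. (e, a) \<in> rel (k - 1)}, monoid.mult = translate e, one = e\<rparr>"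

lemma fibre_group_simps [simp]:
  "carrier (fibre_group e) = {a. (e, a) \<in> rel (k - 1)}"
  "a \<otimes>\<^bsub>fibre_group e\<^esub> b = translate e a b"
  "\<one>\<^bsub>fibre_group e\<^esub> = e"
  by (simp_all add: fibre_group_def)

lemma fibre_comm_group:
  assumes e: "e \<in> X"
  shows "comm_group (fibre_group e)"
proof (rule comm_groupI)
  fix a b c
  assume a: "a \<in> carrier (fibre_group e)" and b: "b \<in> carrier (fibre_group e)"
  then have a': "(e, a) \<in> rel (k - 1)" and b': "(e, b) \<in> rel (k - 1)" by auto
  show "a \<otimes>\<^bsub>fibre_group e\<^esub> b \<in> carrier (fibre_group e)"
    using translate_closed[OF a' b'] by simp
  show "a \<otimes>\<^bsub>fibre_group e\<^esub> b = b \<otimes>\<^bsub>fibre_group e\<^esub> a"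
    using translate_commute[OF a' b' e] by (simp add: translate_to_base[OF a'] translate_to_base[OF b'])
  assume "c \<in> carrier (fibre_group e)"
  then show "a \<otimes>\<^bsub>fibre_group e\<^esub> b \<otimes>\<^bsub>fibre_group e\<^esub> c = a \<otimes>\<^bsub>fibre_group e\<^esub> (b \<otimes>\<^bsub>fibre_group e\<^esub> c)"
    using translate_translate[OF a' b'] rel_in by simp
next
  show "\<one>\<^bsub>fibre_group e\<^esub> \<in> carrier (fibre_group e)" using rel_refl[OF e] by simp
next
  fix a assume "a \<in> carrier (fibre_group e)"
  then have a: "(e, a) \<in> rel (k - 1)" by simp
  show "\<one>\<^bsub>fibre_group e\<^esub> \<otimes>\<^bsub>fibre_group e\<^esub> a = a"
    using translate_base[OF e] rel_in[OF a] by simp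
  obtain b where "(e, b) \<in> rel (k - 1)" "translate e b a = e"
    using translate_transitive[OF rel_sym[OF a] e] by blast
  then show "\<exists>b\<in>carrier (fibre_group e). b \<otimes>\<^bsub>fibre_group e\<^esub> a = \<one>\<^bsub>fibre_group e\<^esub>" by auto
qed

definition fibre_action :: "'a \<Rightarrow> 'a \<Rightarrow> 'a \<Rightarrow> 'a" where
  "fibre_action e a = (\<lambda>x\<in>X. translate e a x)"

lemma fibre_group_action:
  assumes e: "e \<in> X"
  shows "group_action (fibre_group e) X (fibre_action e)"
proof -
  interpret G: comm_group "fibre_group e" by (rule fibre_comm_group[OF e])
  have bij: "fibre_action e a \<in> Bij X" if a: "a \<in> carrier (fibre_group e)" for a
  proof -
    let ?b = "inv\<^bsub>fibre_group e\<^esub> a"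
    have b: "?b \<in> carrier (fibre_group e)" using a by (rule G.inv_closed)
    have ab: "translate e a ?b = e" "translate e ?b a = e"
      using G.r_inv[OF a] G.l_inv[OF a] by simp_all
    have "bij_betw (translate e a) X X"
    proof (rule bij_betw_byWitness[where f' = "translate e ?b"])
      show "\<forall>x\<in>X. translate e ?b (translate e a x) = x"
        using translate_translate[of e ?b a] ab a b translate_base[OF e] by simp
      show "\<forall>x\<in>X. translate e a (translate e ?b x) = x"
        using translate_translate[of e a ?b] ab a b translate_base[OF e] by simp
      show "translate e a ` X \<subseteq> X" "translate e ?b ` X \<subseteq> X"
        using a b translate_in by auto
    qed
    then have "bij_betw (fibre_action e a) X X"
      by (rule bij_betw_cong[THEN iffD1, rotated]) (simp add: fibre_action_def)
    then show ?thesis by (simp add: Bij_def fibre_action_def)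
  qed
  show ?thesis
  proof (rule group_action.intro)
    show "group_hom (fibre_group e) (BijGroup X) (fibre_action e)"
    proof (rule group_hom.intro[OF G.is_group group_BijGroup], rule group_hom_axioms.intro, rule homI)
      fix a assume "a \<in> carrier (fibre_group e)"
      then show "fibre_action e a \<in> carrier (BijGroup X)"
        using bij by (simp add: BijGroup_def)
    next
      fix a b assume a: "a \<in> carrier (fibre_group e)" and b: "b \<in> carrier (fibre_group e)"
      have "fibre_action e (translate e a b) = compose X (fibre_action e a) (fibre_action e b)"
      proof (rule extensionalityI[of _ X])
        fix x assume x: "x \<in> X"
        then show "fibre_action e (translate e a b) x = compose X (fibre_action e a) (fibre_action e b) x"
          using translate_translate[of e a b x] translate_in[of e b x] a b
          by (simp add: fibre_action_def compose_def)
      qed (auto simp: fibre_action_def compose_def)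
      then show "fibre_action e (a \<otimes>\<^bsub>fibre_group e\<^esub> b) = fibre_action e a \<otimes>\<^bsub>BijGroup X\<^esub> fibre_action e b"
        using bij[OF a] bij[OF b] by (simp add: BijGroup_def)
    qed
  qed
qed

text \<open>Translating the ends of an edge by \<open>a\<close> preserves cubes and does not change the alternating product. With such
  moves the values of \<open>\<zeta>\<close> are pushed along edges towards the top vertex, until \<open>\<zeta>\<close> is trivial at the other
  vertices. If its alternating product is trivial, it is then trivial everywhere. For the converse, correct
  \<open>\<zeta>\<close> at the top vertex so that the alternating product becomes trivial; by unique completion, and since the
  action is free, the correction was trivial.\<close>

theorem translate_cube_iff:
  assumes e: "e \<in> X" and c: "c \<in> C (k + 1)"
    and \<zeta>: "\<And>v. v \<in> dc (k + 1) \<Longrightarrow> \<zeta> v \<in> carrier (fibre_group e)"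
  shows "(\<lambda>v\<in>dc (k + 1). translate e (\<zeta> v) (c v)) \<in> C (k + 1) \<longleftrightarrow>
    alt_prod (fibre_group e) (k + 1) \<zeta> = \<one>\<^bsub>fibre_group e\<^esub>"
proof -
  let ?n = "k + 1" and ?G = "fibre_group e"
  let ?T = "top_vertex ?n"
  interpret G: comm_group ?G by (rule fibre_comm_group[OF e])
  have relD: "a \<in> carrier ?G \<Longrightarrow> (e, a) \<in> rel (k - 1)" for a by simp
  have tr: "translate e (a \<otimes>\<^bsub>?G\<^esub> b) x = translate e a (translate e b x)"
    if "a \<in> carrier ?G" "b \<in> carrier ?G" "x \<in> X" for a b x
    using translate_translate[OF relD relD] that by simp
  define supp where "supp \<zeta> = {v \<in> dc ?n. v \<noteq> ?T \<and> \<zeta> v \<noteq> \<one>\<^bsub>?G\<^esub>}" for \<zeta> :: "(nat \<Rightarrow> int) \<Rightarrow> 'a"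
  \<comment> \<open>Moving a value along an edge to a vertex with one more \<open>1\<close> halves its weight.\<close>
  define wt where "wt v = (2::nat) ^ (?n - card (ones ?n v))" for v
  have cube: "(\<lambda>v\<in>dc ?n. translate e (\<zeta> v) (c v)) \<in> C ?n"
    if "\<zeta> \<in> dc ?n \<rightarrow> carrier ?G" "alt_prod ?G ?n \<zeta> = \<one>\<^bsub>?G\<^esub>" "c \<in> C ?n" for \<zeta> c
    using that
  proof (induction "\<Sum>v\<in>supp \<zeta>. wt v" arbitrary: \<zeta> c rule: less_induct)
    case less
    note \<zeta> = less.prems(1) and c = less.prems(3)
    show ?case
    proof (cases "supp \<zeta> = {}")
      case True
      then have off: "\<zeta> s = \<one>\<^bsub>?G\<^esub>" if "s \<in> dc ?n" "s \<noteq> ?T" for s using that by (auto simp: supp_def)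
      have T: "\<zeta> ?T \<in> carrier ?G" using \<zeta> top_vertex_in by blast
      have "\<zeta> ?T [^]\<^bsub>?G\<^esub> vertex_sign ?n ?T = \<one>\<^bsub>?G\<^esub>"
        using G.alt_prod_top[where f = \<zeta>, OF T off] less.prems(2) by simp
      then have "\<zeta> ?T = \<one>\<^bsub>?G\<^esub>" by (rule G.pow_vertex_sign_eq_one[OF T])
      with off have "\<zeta> s = e" if "s \<in> dc ?n" for s using that by (cases "s = ?T") auto
      then show ?thesis
        by (intro restrict_cube[OF c]) (use translate_base[OF e] cube_in[OF c] in auto)
    next
      case False
      then obtain v where v: "v \<in> supp \<zeta>" by blast
      then have vdc: "v \<in> dc ?n" "v \<noteq> ?T" by (auto simp: supp_def)
      then obtain j where j: "j < ?n" "v j = 0"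
        using eq_top_vertex_iff[OF vdc(1)] discrete_cube_cases[OF vdc(1)] by blast
      have v0: "v(j := 0) = v" using j by auto
      let ?w = "v(j := 1)"
      have wdc: "?w \<in> dc ?n" by (rule discrete_cube_upd[OF vdc(1) j(1)]) simp
      have vw: "v \<noteq> ?w" using j by (metis fun_upd_same zero_neq_one)
      define a where "a = \<zeta> v"
      have a: "a \<in> carrier ?G" using \<zeta> vdc by (auto simp: a_def)
      define \<zeta>' where "\<zeta>' s = \<zeta> s \<otimes>\<^bsub>?G\<^esub> (if s = v(j := 0) \<or> s = v(j := 1) then inv\<^bsub>?G\<^esub> a else \<one>\<^bsub>?G\<^esub>)" for s
      have \<zeta>': "\<zeta>' \<in> dc ?n \<rightarrow> carrier ?G"
        unfolding \<zeta>'_def using \<zeta> a by (auto simp del: fibre_group_simps)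
      have alt': "alt_prod ?G ?n \<zeta>' = \<one>\<^bsub>?G\<^esub>"
      proof -
        have "alt_prod ?G ?n \<zeta>' = alt_prod ?G ?n \<zeta> \<otimes>\<^bsub>?G\<^esub>
            alt_prod ?G ?n (\<lambda>s. if s = v(j := 0) \<or> s = v(j := 1) then inv\<^bsub>?G\<^esub> a else \<one>\<^bsub>?G\<^esub>)"
          unfolding \<zeta>'_def[abs_def] by (rule G.alt_prod_mult) (use \<zeta> a in \<open>auto simp del: fibre_group_simps\<close>)
        then show ?thesis
          using G.alt_prod_edge[OF vdc(1) j(1) G.inv_closed[OF a]] less.prems(2)
          by (simp del: fibre_group_simps)
      qed
      have \<zeta>'v: "\<zeta>' v = \<one>\<^bsub>?G\<^esub>"
        using v0 a by (simp add: \<zeta>'_def a_def del: fibre_group_simps)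
      have \<zeta>'_other: "\<zeta>' s = \<zeta> s" if "s \<in> dc ?n" "s \<noteq> v" "s \<noteq> ?w" for s
        using that v0 \<zeta> by (auto simp: \<zeta>'_def Pi_iff simp del: fibre_group_simps)
      have sub: "supp \<zeta>' \<subseteq> insert ?w (supp \<zeta> - {v})"
      proof
        fix s assume "s \<in> supp \<zeta>'"
        then have s: "s \<in> dc ?n" "s \<noteq> ?T" "\<zeta>' s \<noteq> \<one>\<^bsub>?G\<^esub>" unfolding supp_def by blast+
        show "s \<in> insert ?w (supp \<zeta> - {v})"
        proof (cases "s = ?w")
          case False
          have "s \<noteq> v" using s(3) \<zeta>'v by blast
          then show ?thesis
            using s \<zeta>'_other[OF s(1) _ False] unfolding supp_def by simp
        qed simp
      qed
      have fin: "finite (supp \<zeta>)" by (simp add: supp_def)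
      have "ones ?n ?w = insert j (ones ?n v)" "j \<notin> ones ?n v"
        using j by (auto simp: ones_def)
      then have cw: "card (ones ?n ?w) = Suc (card (ones ?n v))" by simp
      have "card (ones ?n ?w) \<le> card {..<?n}"
        by (rule card_mono) (auto simp: ones_def)
      then have "?n - card (ones ?n v) = Suc (?n - card (ones ?n ?w))" using cw by simp
      then have wt: "wt ?w < wt v" unfolding wt_def by simp
      have "(\<Sum>v\<in>supp \<zeta>'. wt v) \<le> (\<Sum>v\<in>insert ?w (supp \<zeta> - {v}). wt v)"
        by (rule sum_mono2) (use sub fin in auto)
      also have "\<dots> \<le> wt ?w + (\<Sum>v\<in>supp \<zeta> - {v}. wt v)"
        using fin by (simp add: sum.insert_if)
      also have "\<dots> < wt v + (\<Sum>v\<in>supp \<zeta> - {v}. wt v)" using wt by simp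
      also have "\<dots> = (\<Sum>v\<in>supp \<zeta>. wt v)" by (rule sum.remove[OF fin v, symmetric])
      finally have dec: "(\<Sum>v\<in>supp \<zeta>'. wt v) < (\<Sum>v\<in>supp \<zeta>. wt v)" .
      let ?c' = "\<lambda>s\<in>dc ?n. if s = v(j := 0) \<or> s = v(j := 1) then translate e a (c s) else c s"
      have c': "?c' \<in> C ?n" by (rule translate_edge[OF relD[OF a] c vdc(1) j(1)])
      from less.hyps[OF dec \<zeta>' alt' c'] show ?thesis
      proof (rule restrict_cube)
        fix s assume s: "s \<in> dc ?n"
        have cs: "c s \<in> X" using cube_in[OF c s] .
        have \<zeta>s: "\<zeta> s \<in> carrier ?G" using \<zeta> s by blast
        show "(\<lambda>v\<in>dc ?n. translate e (\<zeta>' v) (?c' v)) s = translate e (\<zeta> s) (c s)"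
        proof (cases "s = v(j := 0) \<or> s = v(j := 1)")
          case True
          have "translate e (\<zeta>' s) (translate e a (c s)) = translate e (\<zeta>' s \<otimes>\<^bsub>?G\<^esub> a) (c s)"
            by (rule tr[symmetric]) (use \<zeta>' s a cs in blast)+
          also have "\<zeta>' s \<otimes>\<^bsub>?G\<^esub> a = \<zeta> s"
            using True a \<zeta>s by (auto simp: \<zeta>'_def G.m_assoc simp del: fibre_group_simps)
          finally show ?thesis using s True by auto
        next
          case False
          then have "\<zeta>' s = \<zeta> s" using \<zeta>s by (simp add: \<zeta>'_def del: fibre_group_simps)
          then show ?thesis using s False by auto
        qed
      qed
    qed
  qed
  show ?thesis
  proof
    assume "alt_prod ?G ?n \<zeta> = \<one>\<^bsub>?G\<^esub>"
    then show "(\<lambda>v\<in>dc ?n. translate e (\<zeta> v) (c v)) \<in> C ?n"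
      using cube[of \<zeta> c] \<zeta> c by blast
  next
    assume d: "(\<lambda>v\<in>dc ?n. translate e (\<zeta> v) (c v)) \<in> C ?n"
    have \<zeta>P: "\<zeta> \<in> dc ?n \<rightarrow> carrier ?G" using \<zeta> by blast
    define A where "A = alt_prod ?G ?n \<zeta>"
    have A: "A \<in> carrier ?G" unfolding A_def by (rule G.alt_prod_closed[OF \<zeta>P])
    define t where "t = (if vertex_sign ?n ?T = 1 then inv\<^bsub>?G\<^esub> A else A)"
    have t: "t \<in> carrier ?G" using A by (auto simp: t_def simp del: fibre_group_simps)
    have tpow: "t [^]\<^bsub>?G\<^esub> vertex_sign ?n ?T = inv\<^bsub>?G\<^esub> A"
      using vertex_sign_cases[of ?n ?T] A
      by (auto simp: t_def G.int_pow_neg simp del: fibre_group_simps)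
    define \<tau> where "\<tau> s = (if s = ?T then t else \<one>\<^bsub>?G\<^esub>)" for s
    have \<tau>P: "\<tau> \<in> dc ?n \<rightarrow> carrier ?G" using t by (auto simp: \<tau>_def simp del: fibre_group_simps)
    have alt\<tau>: "alt_prod ?G ?n \<tau> = inv\<^bsub>?G\<^esub> A"
      using G.alt_prod_top[of \<tau> ?n] t tpow by (simp add: \<tau>_def del: fibre_group_simps)
    have "alt_prod ?G ?n (\<lambda>s. \<tau> s \<otimes>\<^bsub>?G\<^esub> \<zeta> s) = \<one>\<^bsub>?G\<^esub>"
      unfolding G.alt_prod_mult[OF \<tau>P \<zeta>P] alt\<tau> A_def[symmetric] using A by (rule G.l_inv)
    then have d': "(\<lambda>v\<in>dc ?n. translate e (\<tau> v \<otimes>\<^bsub>?G\<^esub> \<zeta> v) (c v)) \<in> C ?n"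
      by (intro cube c) (use \<tau>P \<zeta>P in \<open>auto simp: Pi_iff simp del: fibre_group_simps\<close>)
    have "(\<lambda>v\<in>dc ?n. translate e (\<tau> v \<otimes>\<^bsub>?G\<^esub> \<zeta> v) (c v)) ?T = (\<lambda>v\<in>dc ?n. translate e (\<zeta> v) (c v)) ?T"
      by (rule unique_top[OF d' d]) (use \<zeta> in \<open>simp add: \<tau>_def del: fibre_group_simps\<close>)
    then have "translate e t (translate e (\<zeta> ?T) (c ?T)) = translate e (\<zeta> ?T) (c ?T)"
      using tr[OF t \<zeta>[OF top_vertex_in] cube_in[OF c top_vertex_in]]
      by (simp add: \<tau>_def del: fibre_group_simps)
    then have "t = \<one>\<^bsub>?G\<^esub>"
      using translate_cancel[OF relD[OF t]] translate_in[OF relD[OF \<zeta>[OF top_vertex_in]] cube_in[OF c top_vertex_in]]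
      by simp
    then have "inv\<^bsub>?G\<^esub> A = \<one>\<^bsub>?G\<^esub>" using tpow by (simp del: fibre_group_simps)
    then have "A = \<one>\<^bsub>?G\<^esub>" using A G.inv_eq_1_iff by blast
    then show "alt_prod ?G ?n \<zeta> = \<one>\<^bsub>?G\<^esub>" by (simp add: A_def)
  qed
qed

text \<open>Both the cubes of \<open>X\<close> and those of \<open>\<D>\<^sub>k(Z)\<close> are characterised by their composites with morphisms from
  \<open>{0,1}\<^sup>k\<^sup>+\<^sup>1\<close>, and in this dimension \<open>translate_cube_iff\<close> applies.\<close>

theorem fibre_action_cubes:
  assumes e: "e \<in> X" and c: "c \<in> C n"
  shows "{d \<in> C n. \<forall>v\<in>dc n. (c v, d v) \<in> rel (k - 1)} =
    {\<lambda>v\<in>dc n. fibre_action e (c' v) (c v) | c'. c' \<in> D_cubes k (fibre_group e) n}"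
proof (intro equalityI subsetI)
  fix d assume "d \<in> {d \<in> C n. \<forall>v\<in>dc n. (c v, d v) \<in> rel (k - 1)}"
  then have d: "d \<in> C n" "\<And>v. v \<in> dc n \<Longrightarrow> (c v, d v) \<in> rel (k - 1)" by auto
  have "\<forall>v\<in>dc n. \<exists>a. (e, a) \<in> rel (k - 1) \<and> translate e a (c v) = d v"
    using translate_transitive[OF d(2) e] by metis
  from bchoice[OF this] obtain z where
    z: "\<And>v. v \<in> dc n \<Longrightarrow> (e, z v) \<in> rel (k - 1) \<and> translate e (z v) (c v) = d v" by blast
  let ?z = "\<lambda>v\<in>dc n. z v"
  have "?z \<in> D_cubes k (fibre_group e) n"
    unfolding D_cubes_iff
  proof (intro conjI allI impI)
    fix \<phi> assume \<phi>: "cube_morphism (k + 1) n \<phi>"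
    note \<phi>in = cube_morphism_in[OF \<phi>]
    have "(\<lambda>s\<in>dc (k + 1). translate e (?z (\<phi> s)) ((\<lambda>s\<in>dc (k + 1). c (\<phi> s)) s)) \<in> C (k + 1)"
      by (rule restrict_cube[OF cube_compose[OF d(1) \<phi>]]) (use z \<phi>in in auto)
    then show "alt_prod (fibre_group e) (k + 1) (\<lambda>v. ?z (\<phi> v)) = \<one>\<^bsub>fibre_group e\<^esub>"
      by (subst (asm) translate_cube_iff[OF e cube_compose[OF c \<phi>]]) (use z \<phi>in in auto)
  qed (use z in auto)
  moreover have "d = (\<lambda>v\<in>dc n. fibre_action e (?z v) (c v))"
    by (rule extensionalityI[OF cube_ext[OF d(1)]])
      (use z cube_in[OF c] in \<open>auto simp: fibre_action_def\<close>)
  ultimately show "d \<in> {\<lambda>v\<in>dc n. fibre_action e (c' v) (c v) | c'. c' \<in> D_cubes k (fibre_group e) n}"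
    by blast
next
  fix d assume "d \<in> {\<lambda>v\<in>dc n. fibre_action e (c' v) (c v) | c'. c' \<in> D_cubes k (fibre_group e) n}"
  then obtain z where zD: "z \<in> D_cubes k (fibre_group e) n"
    and d: "d = (\<lambda>v\<in>dc n. fibre_action e (z v) (c v))" by blast
  have z: "v \<in> dc n \<Longrightarrow> z v \<in> carrier (fibre_group e)" for v
    using zD unfolding D_cubes_iff by blast
  have d': "d v = translate e (z v) (c v)" if "v \<in> dc n" for v
    using that cube_in[OF c] by (simp add: d fibre_action_def)
  have "d \<in> C n"
  proof (rule cube_by_faces)
    show "d \<in> dc n \<rightarrow>\<^sub>E X"
      using d' z translate_in cube_in[OF c] by (auto simp: d)
    fix \<phi> assume \<phi>: "cube_morphism (k + 1) n \<phi>"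
    note \<phi>in = cube_morphism_in[OF \<phi>]
    have "alt_prod (fibre_group e) (k + 1) (\<lambda>v. z (\<phi> v)) = \<one>\<^bsub>fibre_group e\<^esub>"
      using zD \<phi> unfolding D_cubes_iff by blast
    then have "(\<lambda>s\<in>dc (k + 1). translate e (z (\<phi> s)) ((\<lambda>s\<in>dc (k + 1). c (\<phi> s)) s)) \<in> C (k + 1)"
      by (subst translate_cube_iff[OF e cube_compose[OF c \<phi>]]) (use z \<phi>in in auto)
    then show "(\<lambda>s\<in>dc (k + 1). d (\<phi> s)) \<in> C (k + 1)"
      by (rule restrict_cube) (use d' \<phi>in in auto)
  qed
  moreover have "(c v, d v) \<in> rel (k - 1)" if "v \<in> dc n" for v
    using d'[OF that] translate_rel z[OF that] cube_in[OF c that] by simp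
  ultimately show "d \<in> {d \<in> C n. \<forall>v\<in>dc n. (c v, d v) \<in> rel (k - 1)}" by blast
qed

end

theorem (in nilspace) structure_group_exists:
  assumes k: "k \<ge> 1"
  shows "\<exists>(Z :: 'a set monoid) act. structure_group X C k Z act"
proof -
  let ?Y = "factor X C k" and ?D = "factor_cubes X C k"
  interpret Y: nilspace ?Y ?D by (rule factor_nilspace)
  interpret Y: top_factor ?Y ?D k
    by unfold_locales (use k Y.step_unique[OF factor_step_nilspace] in auto)
  obtain e where e: "e \<in> ?Y" using Y.nonempty by blast
  have proj_rel: "factor_proj X C k q' = factor_proj X C k q \<longleftrightarrow> (q, q') \<in> factor_rel ?Y ?D (k - 1)"
    if q: "q \<in> ?Y" "q' \<in> ?Y" for q q'
  proof -
    obtain x y where xy: "x \<in> X" "y \<in> X" "q = proj k x" "q' = proj k y"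
      using q unfolding factor_eq by blast
    have "factor_proj X C k q' = factor_proj X C k q \<longleftrightarrow> (y, x) \<in> rel (k - 1)"
      using xy by (simp add: factor_proj_proj proj_eq_iff del: One_nat_def)
    also have "\<dots> \<longleftrightarrow> (x, y) \<in> rel (k - 1)" using rel_sym by blast
    also have "\<dots> \<longleftrightarrow> (q, q') \<in> factor_rel ?Y ?D (k - 1)"
      unfolding xy(3,4) by (rule factor_rel_factor[OF xy(1,2) diff_le_self, symmetric])
    finally show ?thesis .
  qed
  have "structure_group X C k (Y.fibre_group e) (Y.fibre_action e)"
    unfolding structure_group_def
  proof (intro conjI ballI allI)
    show "comm_group (Y.fibre_group e)" by (rule Y.fibre_comm_group[OF e])
    show "group_action (Y.fibre_group e) ?Y (Y.fibre_action e)" by (rule Y.fibre_group_action[OF e])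
  next
    fix q assume q: "q \<in> ?Y"
    have "a = e" if "a \<in> carrier (Y.fibre_group e)" "Y.fibre_action e a q = q" for a
      using Y.translate_cancel[of e a q] that q by (simp add: Y.fibre_action_def)
    then show "stabilizer (Y.fibre_group e) (Y.fibre_action e) q = {\<one>\<^bsub>Y.fibre_group e\<^esub>}"
      using Y.translate_base[OF e q] Y.rel_refl[OF e] q
      by (auto simp: stabilizer_def Y.fibre_action_def)
    have "(q, q') \<in> factor_rel ?Y ?D (k - 1) \<longleftrightarrow> (\<exists>a. (e, a) \<in> factor_rel ?Y ?D (k - 1) \<and> q' = Y.translate e a q)" for q'
      using Y.translate_transitive[of q q' e] Y.translate_rel[of e _ q] q e by metis
    then have "orbit (Y.fibre_group e) (Y.fibre_action e) q = {q'. (q, q') \<in> factor_rel ?Y ?D (k - 1)}"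
      using q by (simp add: orbit_def Y.fibre_action_def) blast
    then show "orbit (Y.fibre_group e) (Y.fibre_action e) q =
        {q' \<in> ?Y. factor_proj X C k q' = factor_proj X C k q}"
      using proj_rel[OF q] Y.rel_in by blast
  next
    fix n c assume c: "c \<in> ?D n"
    have "{d \<in> ?D n. \<forall>v\<in>dc n. factor_proj X C k (d v) = factor_proj X C k (c v)} =
        {d \<in> ?D n. \<forall>v\<in>dc n. (c v, d v) \<in> factor_rel ?Y ?D (k - 1)}"
      using proj_rel Y.cube_in c by blast
    then show "{d \<in> ?D n. \<forall>v\<in>dc n. factor_proj X C k (d v) = factor_proj X C k (c v)} =
        {\<lambda>v\<in>dc n. Y.fibre_action e (c' v) (c v) | c'. c' \<in> D_cubes k (Y.fibre_group e) n}"
      unfolding Y.fibre_action_cubes[OF e c] .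
  qed
  then show ?thesis by blast
qed

section \<open>Cubes in \<open>\<int>\<^sup>n\<close> and \<open>\<int>\<^sub>p\<^sup>n\<close>\<close>

lemma comm_group_int_lattice: "comm_group (int_lattice n)"
proof -
  interpret group "int_lattice n"
    unfolding int_lattice_def by (rule product_group) simp
  show ?thesis
    by (rule group_comm_groupI) (auto simp: mult_int_lattice intro!: restrict_ext)
qed

lemma carrier_mod_lattice: "p > 0 \<Longrightarrow> carrier (mod_lattice p n) = {..<n} \<rightarrow>\<^sub>E {0..<int p}"
  by (simp add: mod_lattice_def carrier_integer_mod_group)

lemma mult_mod_lattice: "x \<otimes>\<^bsub>mod_lattice p n\<^esub> y = (\<lambda>l\<in>{..<n}. (x l + y l) mod int p)"
  by (simp add: mod_lattice_def)

lemma one_mod_lattice: "\<one>\<^bsub>mod_lattice p n\<^esub> = (\<lambda>l\<in>{..<n}. 0)"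
  by (simp add: mod_lattice_def)

lemma comm_group_mod_lattice: "comm_group (mod_lattice p n)"
proof -
  interpret group "mod_lattice p n"
    unfolding mod_lattice_def by (rule product_group) simp
  show ?thesis
    by (rule group_comm_groupI) (auto simp: mult_mod_lattice add.commute intro!: restrict_ext)
qed

lemma inv_int_lattice:
  "x \<in> carrier (int_lattice n) \<Longrightarrow> inv\<^bsub>int_lattice n\<^esub> x = (\<lambda>l\<in>{..<n}. - x l)"
  unfolding int_lattice_def by (subst inv_product_group) auto

lemma inv_mod_lattice:
  "x \<in> carrier (mod_lattice p n) \<Longrightarrow> inv\<^bsub>mod_lattice p n\<^esub> x = (\<lambda>l\<in>{..<n}. (- x l) mod int p)"
proof -
  assume x: "x \<in> carrier (mod_lattice p n)"
  then have "inv\<^bsub>mod_lattice p n\<^esub> x = (\<lambda>l\<in>{..<n}. inv\<^bsub>integer_mod_group p\<^esub> x l)"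
    unfolding mod_lattice_def by (intro inv_product_group) auto
  also have "\<dots> = (\<lambda>l\<in>{..<n}. (- x l) mod int p)"
    by (rule restrict_ext, rule inv_integer_mod_group) (use x in \<open>auto simp: mod_lattice_def\<close>)
  finally show ?thesis .
qed

lemma diff_mod_lattice:
  assumes "y \<in> carrier (mod_lattice p n)" "l < n"
  shows "(x \<otimes>\<^bsub>mod_lattice p n\<^esub> inv\<^bsub>mod_lattice p n\<^esub> y) l = (x l - y l) mod int p"
  using assms by (simp add: inv_mod_lattice mult_mod_lattice mod_add_right_eq)

definition vertex2 :: "int \<Rightarrow> int \<Rightarrow> nat \<Rightarrow> int" where
  "vertex2 a b = (\<lambda>l\<in>{..<2}. if l = 0 then a else b)"

lemma vertex2_in [simp]: "a = 0 \<or> a = 1 \<Longrightarrow> b = 0 \<or> b = 1 \<Longrightarrow> vertex2 a b \<in> dc 2"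
  by (auto simp: vertex2_def)

lemma vertex2_apply [simp]: "vertex2 a b 0 = a" "vertex2 a b (Suc 0) = b"
  by (auto simp: vertex2_def)

lemma (in comm_group) alt_prod_2:
  assumes f: "f \<in> dc 2 \<rightarrow> carrier G"
  shows "alt_prod G 2 f = (f (vertex2 0 0) \<otimes> inv (f (vertex2 1 0))) \<otimes>
    inv (f (vertex2 0 1) \<otimes> inv (f (vertex2 1 1)))"
proof -
  define u :: "nat \<Rightarrow> int" where "u = (\<lambda>_. undefined)"
  have u: "u(0 := a, Suc 0 := b) = vertex2 a b" for a b
    by (auto simp: u_def vertex2_def fun_eq_iff less_Suc_eq numeral_2_eq_2)
  have dc0: "dc 0 = {u}" by (simp add: discrete_cube_def u_def)
  have alt0: "alt_prod G 0 h = h u" if "h u \<in> carrier G" for h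
    using that by (simp add: alt_prod_def dc0 vertex_sign_def)
  have in1: "w(Suc 0 := a) \<in> dc 2" if "w \<in> dc 1" "a = 0 \<or> a = 1" for w a
    using discrete_cube_upd_Suc[OF that] by (simp add: numeral_2_eq_2)
  have in0: "w(0 := a) \<in> dc 1" if "w \<in> dc 0" "a = 0 \<or> a = 1" for w a
    using discrete_cube_upd_Suc[OF that] by simp
  have alt1: "alt_prod G 1 h = h (u(0 := 0)) \<otimes> inv (h (u(0 := 1)))" if h: "h \<in> dc 1 \<rightarrow> carrier G" for h
  proof -
    have "h (u(0 := a)) \<in> carrier G" if "a = 0 \<or> a = 1" for a
      using h in0[of u a] that dc0 by auto
    then show ?thesis
      using alt_prod_Suc[of h 0] h by (simp add: alt0)
  qed
  have B: "alt_prod G 2 f = alt_prod G 1 (\<lambda>w. f (w(Suc 0 := 0))) \<otimes> inv (alt_prod G 1 (\<lambda>w. f (w(Suc 0 := 1))))"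
    using alt_prod_Suc[of f 1] f by (simp add: numeral_2_eq_2 del: fun_upd_apply)
  have A: "alt_prod G 1 (\<lambda>w. f (w(Suc 0 := a))) = f (vertex2 0 a) \<otimes> inv (f (vertex2 1 a))"
    if "a = 0 \<or> a = 1" for a
    unfolding u[symmetric] by (rule alt1) (use f in1 that in auto)
  have A01: "alt_prod G 1 (\<lambda>w. f (w(Suc 0 := 0))) = f (vertex2 0 0) \<otimes> inv (f (vertex2 1 0))"
    "alt_prod G 1 (\<lambda>w. f (w(Suc 0 := 1))) = f (vertex2 0 1) \<otimes> inv (f (vertex2 1 1))"
    by (rule A; simp)+
  show ?thesis unfolding B A01 ..
qed

text \<open>The defining condition, applied to the square with vertices the origin, \<open>w\<close>, the \<open>j\<close>-th unit vector and
  their sum, says that switching on coordinate \<open>j\<close> changes \<open>c\<close> by the same amount at \<open>w\<close> as at the origin.\<close>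

lemma D1_cube_affine:
  assumes c: "c \<in> D_cubes 1 (int_lattice n) m" and l: "l < n"
  shows "affine_fun m (\<lambda>s. c s l)"
proof (rule affine_funI)
  let ?G = "int_lattice n"
  interpret G: comm_group ?G by (rule comm_group_int_lattice)
  fix w j assume w: "w \<in> dc m" "j < m" "w j = 0"
  define \<phi> where "\<phi> s = (\<lambda>i\<in>{..<m}. if i = j then s (Suc 0) else s 0 * w i)" for s :: "nat \<Rightarrow> int"
  have \<phi>: "cube_morphism (1 + 1) m \<phi>"
  proof (rule cube_morphismI)
    fix s assume s: "s \<in> dc (1 + 1)"
    show "\<phi> s \<in> dc m"
      unfolding \<phi>_def restrict_in_discrete_cube
    proof (intro allI impI)
      fix i assume "i < m"
      then show "(if i = j then s (Suc 0) else s 0 * w i) = 0 \<or> (if i = j then s (Suc 0) else s 0 * w i) = 1"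
        using discrete_cube_cases[OF s, of 0] discrete_cube_cases[OF s, of "Suc 0"]
          discrete_cube_cases[OF w(1), of i] by auto
    qed
  next
    fix i assume "i < m"
    then show "affine_fun (1 + 1) (\<lambda>s. \<phi> s i)" by (cases "i = j") (auto simp: \<phi>_def)
  qed
  have cP: "c s \<in> carrier ?G" if "s \<in> dc m" for s using c that unfolding D_cubes_iff by blast
  have c\<phi>: "(\<lambda>v. c (\<phi> v)) \<in> dc 2 \<rightarrow> carrier ?G"
    using cP cube_morphism_in[OF \<phi>] by (auto simp: numeral_2_eq_2)
  have "alt_prod ?G 2 (\<lambda>v. c (\<phi> v)) = \<one>\<^bsub>?G\<^esub>"
    using c \<phi> unfolding D_cubes_iff by (auto simp: numeral_2_eq_2)
  then have "(c (\<phi> (vertex2 0 0)) \<otimes>\<^bsub>?G\<^esub> inv\<^bsub>?G\<^esub> c (\<phi> (vertex2 1 0))) \<otimes>\<^bsub>?G\<^esub>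
      inv\<^bsub>?G\<^esub> (c (\<phi> (vertex2 0 1)) \<otimes>\<^bsub>?G\<^esub> inv\<^bsub>?G\<^esub> c (\<phi> (vertex2 1 1))) = \<one>\<^bsub>?G\<^esub>"
    unfolding G.alt_prod_2[OF c\<phi>] .
  from fun_cong[OF this, of l]
  have "c (\<phi> (vertex2 0 0)) l - c (\<phi> (vertex2 1 0)) l - (c (\<phi> (vertex2 0 1)) l - c (\<phi> (vertex2 1 1)) l) = 0"
    using l c\<phi> by (simp add: inv_int_lattice mult_int_lattice Pi_iff int_lattice_def)
  moreover have "\<phi> (vertex2 1 0) = w" "\<phi> (vertex2 1 1) = w(j := 1)"
    using w by (auto simp: \<phi>_def fun_eq_iff discrete_cube_iff extensional_def)
  moreover have "\<phi> (vertex2 0 0) = (\<lambda>i\<in>{..<m}. 0)" "\<phi> (vertex2 0 1) = (\<lambda>i\<in>{..<m}. if i = j then 1 else 0)"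
    by (auto simp: \<phi>_def)
  ultimately show "c (w(j := 1)) l = c w l + (c (\<lambda>i\<in>{..<m}. if i = j then 1 else 0) l - c (\<lambda>i\<in>{..<m}. 0) l)"
    by simp
qed

lemma affine_fun_square:
  assumes "affine_fun 2 g"
  shows "g (vertex2 0 0) - g (vertex2 1 0) - (g (vertex2 0 1) - g (vertex2 1 1)) = 0"
proof -
  obtain b h where "\<And>s. s \<in> dc 2 \<Longrightarrow> g s = b + (\<Sum>j<2. h j * s j)"
    using assms unfolding affine_fun_def by blast
  then have "g (vertex2 x y) = b + (\<Sum>j<2. h j * vertex2 x y j)" if "x = 0 \<or> x = 1" "y = 0 \<or> y = 1" for x y
    using vertex2_in[OF that] by blast
  then show ?thesis by (simp add: numeral_2_eq_2)
qed

lemma mod_affine_D1_cube: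
  assumes p: "p > 0" and g: "\<And>l. l < n \<Longrightarrow> affine_fun m (g l)"
  shows "(\<lambda>s\<in>dc m. \<lambda>l\<in>{..<n}. g l s mod int p) \<in> D_cubes 1 (mod_lattice p n) m"
proof -
  let ?G = "mod_lattice p n"
  let ?c = "\<lambda>s\<in>dc m. \<lambda>l\<in>{..<n}. g l s mod int p"
  interpret G: comm_group ?G by (rule comm_group_mod_lattice)
  have cP: "?c \<in> dc m \<rightarrow>\<^sub>E carrier ?G"
    using p by (auto simp: carrier_mod_lattice)
  moreover have "alt_prod ?G (1 + 1) (\<lambda>v. ?c (\<phi> v)) = \<one>\<^bsub>?G\<^esub>" if \<phi>: "cube_morphism (1 + 1) m \<phi>" for \<phi>
  proof -
    have \<phi>in: "\<phi> v \<in> dc m" if "v \<in> dc 2" for v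
      using cube_morphism_in[OF \<phi>] that by (simp add: numeral_2_eq_2)
    have c\<phi>: "(\<lambda>v. ?c (\<phi> v)) \<in> dc 2 \<rightarrow> carrier ?G" using cP \<phi>in by blast
    have sq: "g l (\<phi> (vertex2 0 0)) - g l (\<phi> (vertex2 1 0)) - (g l (\<phi> (vertex2 0 1)) - g l (\<phi> (vertex2 1 1))) = 0"
      if "l < n" for l
      by (rule affine_fun_square[OF affine_fun_compose[OF g[OF that]]])
        (use \<phi> in \<open>auto simp: cube_morphism_iff numeral_2_eq_2\<close>)
    define u where "u a b = ?c (\<phi> (vertex2 a b))" for a b
    have mem: "u a b \<in> carrier ?G" if "a = 0 \<or> a = 1" "b = 0 \<or> b = 1" for a b
      unfolding u_def using c\<phi> vertex2_in[OF that] by blast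
    have mem1: "u 1 0 \<in> carrier ?G" "u 1 1 \<in> carrier ?G" "u 0 1 \<in> carrier ?G"
      by (rule mem; simp)+
    have m2: "u 0 1 \<otimes>\<^bsub>?G\<^esub> inv\<^bsub>?G\<^esub> u 1 1 \<in> carrier ?G"
      using mem1 by (intro G.m_closed G.inv_closed)
    have "alt_prod ?G 2 (\<lambda>v. ?c (\<phi> v)) =
      (u 0 0 \<otimes>\<^bsub>?G\<^esub> inv\<^bsub>?G\<^esub> u 1 0) \<otimes>\<^bsub>?G\<^esub> inv\<^bsub>?G\<^esub> (u 0 1 \<otimes>\<^bsub>?G\<^esub> inv\<^bsub>?G\<^esub> u 1 1)"
      unfolding u_def by (rule G.alt_prod_2[OF c\<phi>])
    also have "\<dots> = \<one>\<^bsub>?G\<^esub>"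
    proof (rule ext)
      fix l
      show "((u 0 0 \<otimes>\<^bsub>?G\<^esub> inv\<^bsub>?G\<^esub> u 1 0) \<otimes>\<^bsub>?G\<^esub>
          inv\<^bsub>?G\<^esub> (u 0 1 \<otimes>\<^bsub>?G\<^esub> inv\<^bsub>?G\<^esub> u 1 1)) l = \<one>\<^bsub>?G\<^esub> l"
      proof (cases "l < n")
        case l: True
        define r where "r a b = g l (\<phi> (vertex2 a b))" for a b
        have c: "u a b l = r a b mod int p" if "a = 0 \<or> a = 1" "b = 0 \<or> b = 1" for a b
          unfolding u_def r_def using \<phi>in[OF vertex2_in[OF that]] l by simp
        have c4: "u 0 0 l = r 0 0 mod int p" "u 1 0 l = r 1 0 mod int p"
          "u 0 1 l = r 0 1 mod int p" "u 1 1 l = r 1 1 mod int p"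
          by (rule c; simp)+
        have "((r 0 0 mod int p - r 1 0 mod int p) mod int p -
            (r 0 1 mod int p - r 1 1 mod int p) mod int p) mod int p =
            (r 0 0 - r 1 0 - (r 0 1 - r 1 1)) mod int p"
          by (simp only: mod_simps)
        also have "\<dots> = 0" unfolding r_def sq[OF l] by simp
        finally show ?thesis
          unfolding diff_mod_lattice[OF m2 l] diff_mod_lattice[OF mem1(1) l]
            diff_mod_lattice[OF mem1(2) l] c4 one_mod_lattice restrict_apply'[of l "{..<n}", unfolded lessThan_iff, OF l] .
      next
        case False
        then show ?thesis unfolding mult_mod_lattice one_mod_lattice by simp
      qed
    qed
    finally show ?thesis by (simp add: numeral_2_eq_2)
  qed
  ultimately show ?thesis unfolding D_cubes_iff by blast
qed

section \<open>Structure groups of \<open>p\<close>-homogeneous nilspaces\<close>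

lemma structure_group_free:
  assumes sg: "structure_group X C k Z act" and q: "q \<in> factor X C k"
  shows "inj_on (\<lambda>a. act a q) (carrier Z)"
proof (rule inj_onI)
  interpret Z: comm_group Z using sg by (simp add: structure_group_def)
  interpret A: group_action Z "factor X C k" act using sg by (simp add: structure_group_def)
  have stab: "stabilizer Z act q = {\<one>\<^bsub>Z\<^esub>}" using sg q by (simp add: structure_group_def)
  fix a b assume ab: "a \<in> carrier Z" "b \<in> carrier Z" "act a q = act b q"
  have "act (inv\<^bsub>Z\<^esub> b \<otimes>\<^bsub>Z\<^esub> a) q = q"
    using A.composition_rule[OF q, of "inv\<^bsub>Z\<^esub> b" a] A.orbit_sym_aux[OF ab(2) q] ab by simp
  then have "inv\<^bsub>Z\<^esub> b \<otimes>\<^bsub>Z\<^esub> a \<in> stabilizer Z act q"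
    using ab unfolding stabilizer_def by simp
  then have "b \<otimes>\<^bsub>Z\<^esub> (inv\<^bsub>Z\<^esub> b \<otimes>\<^bsub>Z\<^esub> a) = b" unfolding stab using ab by simp
  then show "a = b" using ab by (simp add: Z.m_assoc[symmetric])
qed

context nilspace
begin

text \<open>The prescribed values, \<open>y\<close> at \<open>(1,\<dots>,1)\<close> and \<open>x\<close> at all vectors having a coordinate \<open>0\<close>, are compatible
  with cubes because \<open>x \<sim>\<^sub>k y\<close>. At a vector \<open>v\<close> all of whose coordinates are positive, the cube with edges of
  length \<open>1\<close> and top vertex \<open>v\<close> propagates \<open>\<sim>\<^sub>k\<close> from its smaller vertices to \<open>v\<close>.

  The numbers \<open>0\<close> and \<open>1\<close> in \<open>\<int>\<close> are the two of lowest rank, so these prescribed vectors form a set as required by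
  \<open>lattice_extension\<close>.\<close>

lemma spike_morphism:
  assumes xy: "(x, y) \<in> rel k"
  obtains F where "F \<in> nilspace_hom (carrier (int_lattice (k + 1))) (D_cubes 1 (int_lattice (k + 1))) X C"
    "F (top_vertex (k + 1)) = y"
    "\<And>v. v \<in> carrier (int_lattice (k + 1)) \<Longrightarrow> (\<exists>l<k + 1. v l = 0) \<Longrightarrow> F v = x"
    "\<And>v. v \<in> carrier (int_lattice (k + 1)) \<Longrightarrow> (\<And>l. l < k + 1 \<Longrightarrow> 0 \<le> v l) \<Longrightarrow> (x, F v) \<in> rel k"
proof -
  let ?n = "k + 1" and ?T = "top_vertex (k + 1)"
  let ?Z = "carrier (int_lattice ?n)"
  have X: "x \<in> X" "y \<in> X" and u: "(\<lambda>s\<in>dc ?n. if s = ?T then y else x) \<in> C ?n"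
    using xy by (auto simp: rel_iff)
  define f where "f v = (if v = ?T then y else x)" for v
  define D where "D = {v \<in> ?Z. v = ?T \<or> (\<exists>l<?n. v l = 0)}"
  have TZ: "?T \<in> ?Z" using dc_subset_lattice top_vertex_in by blast
  have Tl: "?T l = 1" if "l < ?n" for l using that by (simp add: top_vertex_def)
  have notT: "v \<noteq> ?T" if "l < ?n" "v l = 0" for v l using Tl[OF that(1)] that(2) by auto
  have dn: "lattice_box ?n v \<subseteq> D" if v: "v \<in> D" for v
  proof
    fix w assume w: "w \<in> lattice_box ?n v"
    then have wZ: "w \<in> ?Z" by (simp add: lattice_box_def)
    show "w \<in> D"
    proof (cases "v = ?T")
      case True
      then have "w \<in> dc ?n" using w lattice_box_discrete_cube[OF top_vertex_in] by blast
      then show ?thesis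
        using wZ eq_top_vertex_iff discrete_cube_cases unfolding D_def by blast
    next
      case False
      then obtain l where l: "l < ?n" "v l = 0" using v unfolding D_def by blast
      then have "zrank (w l) \<le> zrank (v l)" using w by (auto simp: lattice_box_def)
      then have "w l = 0" using l(2) by simp
      then show ?thesis using wZ l(1) unfolding D_def by blast
    qed
  qed
  have good: "good_at C ?n f v" if v: "v \<in> D" for v
    unfolding good_at_def
  proof (intro allI impI)
    fix m a assume a: "a \<in> dc m \<rightarrow> lattice_box ?n v" and aff: "\<forall>l<?n. affine_fun m (\<lambda>s. a s l)"
    show "restrict (f \<circ> a) (dc m) \<in> C m"
    proof (cases "v = ?T")
      case True
      have ain: "a s \<in> dc ?n" if "s \<in> dc m" for s
        using a that True lattice_box_discrete_cube[OF top_vertex_in] by blast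
      have "cube_morphism m ?n a" by (rule cube_morphismI) (use ain aff in auto)
      from cube_compose[OF u this] have "(\<lambda>s\<in>dc m. (f \<circ> a) s) \<in> C m"
        by (rule restrict_cube) (use ain in \<open>auto simp: f_def\<close>)
      then show ?thesis by (simp add: comp_def)
    next
      case False
      then obtain l where l: "l < ?n" "v l = 0" using v unfolding D_def by blast
      have "(\<lambda>s\<in>dc m. (f \<circ> a) s) \<in> C m"
      proof (rule restrict_cube[OF const_cube[OF X(1)]])
        fix s assume s: "s \<in> dc m"
        then have "a s \<in> lattice_box ?n v" using a by blast
        then have "zrank (a s l) \<le> zrank (v l)" using l(1) unfolding lattice_box_def by blast
        then have "a s \<noteq> ?T" using l(2) notT[where v = "a s", OF l(1)] by simp
        then show "(\<lambda>s\<in>dc m. x) s = (f \<circ> a) s" using s by (simp add: f_def)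
      qed
      then show ?thesis by (simp add: comp_def)
    qed
  qed
  have "D \<subseteq> ?Z" by (auto simp: D_def)
  then obtain F where F: "\<And>v. v \<in> D \<Longrightarrow> F v = f v"
    "\<And>m a. a \<in> dc m \<rightarrow> ?Z \<Longrightarrow> (\<And>l. l < ?n \<Longrightarrow> affine_fun m (\<lambda>s. a s l)) \<Longrightarrow> (\<lambda>s\<in>dc m. F (a s)) \<in> C m"
    using lattice_extension[of D ?n f] dn good by blast
  have FX: "F v \<in> X" if "v \<in> ?Z" for v
  proof -
    have "(\<lambda>s\<in>dc 0. F v) \<in> C 0" by (rule F(2)) (use that in auto)
    from cube_in[OF this top_vertex_in] show ?thesis by simp
  qed
  show thesis
  proof (rule that)
    show "F \<in> nilspace_hom ?Z (D_cubes 1 (int_lattice ?n)) X C"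
      unfolding nilspace_hom_def
    proof (intro CollectI conjI allI ballI)
      fix m c assume c: "c \<in> D_cubes 1 (int_lattice ?n) m"
      have "(\<lambda>s\<in>dc m. F (c s)) \<in> C m"
        by (rule F(2)) (use c D1_cube_affine[OF c] in \<open>auto simp: D_cubes_iff\<close>)
      then show "restrict (F \<circ> c) (dc m) \<in> C m" by (simp add: comp_def)
    qed (use FX in blast)
    show Fy: "F ?T = y" using F(1)[of ?T] TZ by (simp add: D_def f_def)
    show Fx: "F v = x" if "v \<in> ?Z" "\<exists>l<?n. v l = 0" for v
    proof -
      from that(2) obtain l where l: "l < ?n" "v l = 0" by blast
      have "v \<in> D" using that unfolding D_def by blast
      then show ?thesis using F(1)[of v] notT[where v = v, OF l] by (simp add: f_def)
    qed
    show "(x, F v) \<in> rel k" if "v \<in> ?Z" "\<And>l. l < ?n \<Longrightarrow> 0 \<le> v l" for v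
      using that
    proof (induction "nat (\<Sum>l<?n. v l)" arbitrary: v rule: less_induct)
      case less
      show ?case
      proof (cases "(\<exists>l<?n. v l = 0) \<or> v = ?T")
        case True
        then show ?thesis using Fx[OF less.prems(1)] Fy xy rel_refl[OF X(1)] by auto
      next
        case False
        then have v1: "1 \<le> v l" if "l < ?n" for l
          using less.prems(2)[OF that] that by (cases "v l = 0") auto
        define a where "a s = (\<lambda>l\<in>{..<?n}. v l - 1 + s l)" for s :: "nat \<Rightarrow> int"
        have aT: "a ?T = v"
          by (rule extensionalityI[of _ "{..<?n}"])
            (use less.prems(1) Tl in \<open>auto simp: a_def carrier_int_lattice PiE_iff\<close>)
        have aZ: "a s \<in> ?Z" for s by (simp add: a_def carrier_int_lattice)
        have ac: "(\<lambda>s\<in>dc ?n. F (a s)) \<in> C ?n"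
          by (rule F(2)) (use aZ in \<open>auto simp: a_def\<close>)
        have "(x, (\<lambda>s\<in>dc ?n. F (a s)) ?T) \<in> rel k"
        proof (rule rel_top_vertex[OF ac X(1)])
          fix s assume s: "s \<in> dc ?n" "s \<noteq> ?T"
          then obtain j where j: "j < ?n" "s j = 0"
            using eq_top_vertex_iff[OF s(1)] discrete_cube_cases[OF s(1)] by blast
          have nn: "0 \<le> a s l" if "l < ?n" for l
            using v1[OF that] discrete_cube_cases[OF s(1) that] that by (auto simp: a_def)
          have le: "a s l \<le> v l" if "l < ?n" for l
            using discrete_cube_cases[OF s(1) that] that by (auto simp: a_def)
          have "(\<Sum>l<?n. a s l) < (\<Sum>l<?n. v l)"
          proof (rule sum_strict_mono_ex1)
            show "\<exists>l\<in>{..<?n}. a s l < v l" by (rule bexI[of _ j]) (use j in \<open>auto simp: a_def\<close>)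
          qed (use le in auto)
          moreover have "0 \<le> (\<Sum>l<?n. a s l)" by (rule sum_nonneg) (use nn in auto)
          ultimately have "nat (\<Sum>l<?n. a s l) < nat (\<Sum>l<?n. v l)" by linarith
          from less.hyps[OF this aZ nn] have "(x, F (a s)) \<in> rel k" .
          then show "((\<lambda>s\<in>dc ?n. F (a s)) s, x) \<in> rel k" using s rel_sym by simp
        qed
        then show ?thesis using aT by simp
      qed
    qed
  qed
qed

text \<open>The argument about alternating sums on the cycle \<open>\<int>\<^sub>p\<close> explained at the beginning, for the group \<open>Z\<^sub>k\<^sub>+\<^sub>1(X)\<close>. The
  \<open>(k+2)\<close>-cubes used have edges in the first \<open>k\<close> directions and two edges in the last one, so they compare
  \<open>H(t)\<close>, \<open>H(t+1)\<close> and \<open>H(t+2)\<close>.\<close>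

theorem structure_group_exponent:
  fixes Z :: "'z monoid"
  assumes p: "p \<ge> 2" and hom: "p_homogeneous p X C"
    and sg: "structure_group X C (k + 1) Z act" and z: "z \<in> carrier Z"
  shows "z [^]\<^bsub>Z\<^esub> p = \<one>\<^bsub>Z\<^esub>"
proof -
  let ?n = "k + 1" and ?T = "top_vertex (k + 1)"
  let ?Y = "factor X C ?n" and ?D = "factor_cubes X C ?n"
  let ?M = "carrier (mod_lattice p ?n)"
  interpret Z: comm_group Z using sg by (simp add: structure_group_def)
  interpret A: group_action Z ?Y act using sg by (simp add: structure_group_def)
  interpret Y: nilspace ?Y ?D by (rule factor_nilspace)
  have stab: "\<And>q. q \<in> ?Y \<Longrightarrow> stabilizer Z act q = {\<one>\<^bsub>Z\<^esub>}"
    and orb: "\<And>q. q \<in> ?Y \<Longrightarrow> orbit Z act q = {q' \<in> ?Y. factor_proj X C ?n q' = factor_proj X C ?n q}"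
    and cub: "\<And>m c. c \<in> ?D m \<Longrightarrow> {d \<in> ?D m. \<forall>v \<in> dc m. factor_proj X C ?n (d v) = factor_proj X C ?n (c v)}
        = {\<lambda>v \<in> dc m. act (c' v) (c v) | c'. c' \<in> D_cubes ?n Z m}"
    using sg unfolding structure_group_def by blast+
  have fp: "factor_proj X C ?n (proj ?n x) = proj k x" if "x \<in> X" for x
    using factor_proj_proj[OF that, of ?n] by simp
  obtain x where x: "x \<in> X" using nonempty by blast
  define q where "q = proj ?n x"
  have q: "q \<in> ?Y" using x by (simp add: q_def proj_in)
  have free: "a = b" if "a \<in> carrier Z" "b \<in> carrier Z" "act a q = act b q" for a b
    using inj_onD[OF structure_group_free[OF sg q] that(3,1,2)] .
  have act1: "act \<one>\<^bsub>Z\<^esub> q = q" using stab[OF q] unfolding stabilizer_def by blast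
  have "act z q \<in> orbit Z act q" using z by (auto simp: orbit_def)
  then have zq: "act z q \<in> ?Y" "factor_proj X C ?n (act z q) = factor_proj X C ?n q"
    unfolding orb[OF q] by blast+
  obtain y where y: "y \<in> X" "act z q = proj ?n y" using zq(1) unfolding factor_eq by blast
  have "proj k y = proj k x"
    using zq(2)[unfolded y(2)] unfolding q_def fp[OF y(1)] fp[OF x] .
  then have xy: "(x, y) \<in> rel k"
    using proj_eq_iff[OF y(1) x, of k] rel_sym[of y x k] by simp
  obtain F where Fhom: "F \<in> nilspace_hom (carrier (int_lattice ?n)) (D_cubes 1 (int_lattice ?n)) X C"
    and Fy: "F ?T = y"
    and Fx: "\<And>v. v \<in> carrier (int_lattice ?n) \<Longrightarrow> (\<exists>l<?n. v l = 0) \<Longrightarrow> F v = x"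
    and Frel: "\<And>v. v \<in> carrier (int_lattice ?n) \<Longrightarrow> (\<And>l. l < ?n \<Longrightarrow> 0 \<le> v l) \<Longrightarrow> (x, F v) \<in> rel k"
    using spike_morphism[OF xy] by blast
  have M: "?M = {..<?n} \<rightarrow>\<^sub>E {0..<int p}" using p by (intro carrier_mod_lattice) simp
  have MZ: "?M \<subseteq> carrier (int_lattice ?n)" unfolding M carrier_int_lattice by auto
  have FM: "F v \<in> X \<and> (x, F v) \<in> rel k" if "v \<in> ?M" for v
  proof -
    have "0 \<le> v l" if "l < ?n" for l
      using \<open>v \<in> ?M\<close> that unfolding M by (auto simp: PiE_iff)
    then have "(x, F v) \<in> rel k" using Frel[of v] MZ \<open>v \<in> ?M\<close> by blast
    then show ?thesis using rel_in by blast
  qed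
  have Fcube: "(\<lambda>s\<in>dc m. F (c s)) \<in> C m" if c: "c \<in> D_cubes 1 (mod_lattice p ?n) m" for c m
  proof -
    have "restrict F ?M \<in> nilspace_hom ?M (D_cubes 1 (mod_lattice p ?n)) X C"
      using hom Fhom unfolding p_homogeneous_def by force
    then have "restrict (restrict F ?M \<circ> c) (dc m) \<in> C m"
      using c unfolding nilspace_hom_def by blast
    then show ?thesis
    proof (rule restrict_cube)
      fix s assume s: "s \<in> dc m"
      then have "c s \<in> ?M" using c unfolding D_cubes_iff by blast
      then show "restrict (restrict F ?M \<circ> c) (dc m) s = F (c s)" using s by simp
    qed
  qed
  have "\<forall>v\<in>?M. \<exists>a. a \<in> carrier Z \<and> act a q = proj ?n (F v)"
  proof
    fix v assume v: "v \<in> ?M"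
    have "proj ?n (F v) \<in> orbit Z act q"
      unfolding orb[OF q] using FM[OF v] proj_in fp proj_eq_iff[of "F v" x k] x rel_sym
      by (simp add: q_def)
    then show "\<exists>a. a \<in> carrier Z \<and> act a q = proj ?n (F v)" by (auto simp: orbit_def)
  qed
  from bchoice[OF this] obtain g where
    g: "\<And>v. v \<in> ?M \<Longrightarrow> g v \<in> carrier Z \<and> act (g v) q = proj ?n (F v)" by blast
  have g1: "g v = \<one>\<^bsub>Z\<^esub>" if "v \<in> ?M" "\<exists>l<?n. v l = 0" for v
    using free[of "g v" "\<one>\<^bsub>Z\<^esub>"] g[OF that(1)] Fx[of v] MZ that act1 by (auto simp: q_def)
  have TM: "?T \<in> ?M" unfolding M using p by (auto simp: top_vertex_def)
  have gT: "g ?T = z" using free[of "g ?T" z] g[OF TM] z y(2) Fy by simp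
  have galt: "alt_prod Z (?n + 1) (\<lambda>s. g (c s)) = \<one>\<^bsub>Z\<^esub>"
    if c: "c \<in> D_cubes 1 (mod_lattice p ?n) (?n + 1)" for c
  proof -
    let ?m = "?n + 1"
    have cM: "c s \<in> ?M" if "s \<in> dc ?m" for s using c that unfolding D_cubes_iff by blast
    have q0: "(\<lambda>s\<in>dc ?m. q) \<in> ?D ?m" by (rule Y.const_cube[OF q])
    have "(\<lambda>s\<in>dc ?m. proj ?n (F (c s))) = restrict (proj ?n \<circ> (\<lambda>s\<in>dc ?m. F (c s))) (dc ?m)"
      by (rule restrict_ext) simp
    then have d: "(\<lambda>s\<in>dc ?m. proj ?n (F (c s))) \<in> ?D ?m"
      unfolding factor_cubes_def by (rule image_eqI[OF _ Fcube[OF c]])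
    have "factor_proj X C ?n (proj ?n (F (c s))) = factor_proj X C ?n q" if "s \<in> dc ?m" for s
      using FM[OF cM[OF that]] fp x proj_eq_iff[of "F (c s)" x k] rel_sym by (simp add: q_def)
    with d have "(\<lambda>s\<in>dc ?m. proj ?n (F (c s))) \<in> {d \<in> ?D ?m. \<forall>v \<in> dc ?m.
        factor_proj X C ?n (d v) = factor_proj X C ?n ((\<lambda>s\<in>dc ?m. q) v)}" by simp
    then obtain c' where c': "c' \<in> D_cubes ?n Z ?m"
      and eq: "(\<lambda>s\<in>dc ?m. proj ?n (F (c s))) = (\<lambda>v \<in> dc ?m. act (c' v) ((\<lambda>s\<in>dc ?m. q) v))"
      unfolding cub[OF q0] by blast
    have c'Z: "c' s \<in> carrier Z" if "s \<in> dc ?m" for s using c' that unfolding D_cubes_iff by blast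
    have gc': "g (c s) = c' s" if "s \<in> dc ?m" for s
      by (rule free) (use g[OF cM[OF that]] c'Z[OF that] fun_cong[OF eq, of s] that in auto)
    have "cube_morphism ?m ?m (\<lambda>v. v)" by (rule cube_morphismI) auto
    then have "alt_prod Z ?m (\<lambda>v. c' v) = \<one>\<^bsub>Z\<^esub>" using c' unfolding D_cubes_iff by blast
    moreover have "alt_prod Z ?m (\<lambda>s. g (c s)) = alt_prod Z ?m (\<lambda>v. c' v)"
      by (rule Z.alt_prod_cong) (use gc' c'Z in auto)
    ultimately show ?thesis by simp
  qed
  \<comment> \<open>\<open>pt w t\<close> is the point \<open>(w, t)\<close> of \<open>\<int>\<^sub>p\<^sup>k \<times> \<int>\<^sub>p\<close>.\<close>
  define pt where "pt w t = (\<lambda>l\<in>{..<?n}. if l < k then w l else t mod int p)" for w :: "nat \<Rightarrow> int" and t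
  define H where "H t = alt_prod Z k (\<lambda>w. g (pt w t))" for t
  have ptM: "pt w t \<in> ?M" if "w \<in> dc k" for w t
    unfolding M using p discrete_cube_cases[OF that] by (force simp: pt_def)
  have gpt: "(\<lambda>w. g (pt w t)) \<in> dc k \<rightarrow> carrier Z" for t
    using g ptM by blast
  have HZ: "H t \<in> carrier Z" for t unfolding H_def by (rule Z.alt_prod_closed[OF gpt])
  have step: "(H t \<otimes>\<^bsub>Z\<^esub> inv\<^bsub>Z\<^esub> H (t + 1)) \<otimes>\<^bsub>Z\<^esub> inv\<^bsub>Z\<^esub> (H (t + 1) \<otimes>\<^bsub>Z\<^esub> inv\<^bsub>Z\<^esub> H (t + 2)) = \<one>\<^bsub>Z\<^esub>" for t
  proof -
    let ?c = "\<lambda>s\<in>dc (?n + 1). \<lambda>l\<in>{..<?n}. (if l < k then s l else t + s k + s (Suc k)) mod int p"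
    have c: "?c \<in> D_cubes 1 (mod_lattice p ?n) (?n + 1)"
    proof (rule mod_affine_D1_cube)
      fix l assume "l < ?n"
      show "affine_fun (?n + 1) (\<lambda>s. if l < k then s l else t + s k + s (Suc k))"
        by (cases "l < k") auto
    qed (use p in simp)
    let ?f = "\<lambda>s. g (?c s)"
    have cM: "?c s \<in> ?M" if "s \<in> dc (Suc (Suc k))" for s
      using c that unfolding D_cubes_iff by auto
    have f2: "?f \<in> dc (Suc (Suc k)) \<rightarrow> carrier Z" using g cM by blast
    have f1: "(\<lambda>w. ?f (w(Suc k := a))) \<in> dc (Suc k) \<rightarrow> carrier Z" if "a = 0 \<or> a = 1" for a
      using f2 discrete_cube_upd_Suc[OF _ that] by blast
    have val: "?c (w(k := a, Suc k := b)) = pt w (t + a + b)"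
      if "w \<in> dc k" "a = 0 \<or> a = 1" "b = 0 \<or> b = 1" for w a b
    proof -
      have "w(k := a, Suc k := b) \<in> dc (?n + 1)"
        using discrete_cube_upd_Suc[OF discrete_cube_upd_Suc[OF that(1,2)] that(3)] by simp
      note 1 = restrict_apply'[OF this]
      show ?thesis
        unfolding 1 pt_def by (rule restrict_ext) (use discrete_cube_cases[OF that(1)] p in force)
    qed
    have a1: "alt_prod Z (Suc k) (\<lambda>w. ?f (w(Suc k := b))) = H (t + b) \<otimes>\<^bsub>Z\<^esub> inv\<^bsub>Z\<^esub> H (t + 1 + b)"
      if b: "b = 0 \<or> b = 1" for b
    proof -
      have "alt_prod Z k (\<lambda>w. ?f (w(k := a, Suc k := b))) = H (t + a + b)" if "a = 0 \<or> a = 1" for a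
        unfolding H_def by (rule Z.alt_prod_cong[OF _ gpt]) (simp only: val[OF _ that b])
      from this[of 0] this[of 1] show ?thesis
        unfolding Z.alt_prod_Suc[OF f1[OF b]] by simp
    qed
    have "alt_prod Z (Suc (Suc k)) ?f = \<one>\<^bsub>Z\<^esub>" using galt[OF c] by simp
    then show ?thesis
      unfolding Z.alt_prod_Suc[OF f2] using a1[of 0] a1[of 1] by (simp add: add.commute add.left_commute)
  qed
  \<comment> \<open>In additive notation \<open>\<delta> t = H t - H (t + 1)\<close>.\<close>
  define \<delta> where "\<delta> t = H t \<otimes>\<^bsub>Z\<^esub> inv\<^bsub>Z\<^esub> H (t + 1)" for t
  have \<delta>Z: "\<delta> t \<in> carrier Z" for t unfolding \<delta>_def using HZ by simp
  have \<delta>_step: "\<delta> (t + 1) = \<delta> t" for t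
  proof -
    have "\<delta> t \<otimes>\<^bsub>Z\<^esub> inv\<^bsub>Z\<^esub> \<delta> (t + 1) = \<one>\<^bsub>Z\<^esub>" using step[of t] by (simp add: \<delta>_def add.assoc)
    then show ?thesis using \<delta>Z by (metis Z.inv_closed Z.inv_equality Z.inv_inv)
  qed
  have \<delta>_const: "\<delta> (int j) = \<delta> 0" for j
  proof (induction j)
    case (Suc j)
    then show ?case using \<delta>_step[of "int j"] by (simp add: add.commute)
  qed simp
  have pow: "H 0 = \<delta> 0 [^]\<^bsub>Z\<^esub> j \<otimes>\<^bsub>Z\<^esub> H (int j)" for j
  proof (induction j)
    case (Suc j)
    have "H (int j) = \<delta> (int j) \<otimes>\<^bsub>Z\<^esub> H (int j + 1)"
      unfolding \<delta>_def using HZ by (simp add: Z.m_assoc)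
    then show ?case
      using Suc HZ \<delta>Z by (simp add: \<delta>_const Z.m_assoc add.commute)
  qed (use HZ in simp)
  have "pt w (int p) = pt w 0" for w
    unfolding pt_def by (rule restrict_ext) simp
  then have "H (int p) = H 0" by (simp add: H_def)
  with pow[of p] HZ[of 0] \<delta>Z[of 0] have \<delta>p: "\<delta> 0 [^]\<^bsub>Z\<^esub> p = \<one>\<^bsub>Z\<^esub>"
    by (metis Z.nat_pow_closed Z.r_cancel_one')
  have H0: "H 0 = \<one>\<^bsub>Z\<^esub>"
  proof -
    have "H 0 = alt_prod Z k (\<lambda>w. \<one>\<^bsub>Z\<^esub>)"
      unfolding H_def
    proof (rule Z.alt_prod_cong)
      fix w assume "w \<in> dc k"
      moreover have "pt w 0 k = 0" by (simp add: pt_def)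
      ultimately show "g (pt w 0) = \<one>\<^bsub>Z\<^esub>" using g1[OF ptM] less_add_one by blast
    qed simp
    then show ?thesis by (simp add: Z.alt_prod_one)
  qed
  have pt1: "pt w 1 l = (if l < k then w l else 1)" if "l < ?n" for w l
    using that p by (simp add: pt_def)
  have ptT: "pt (top_vertex k) 1 = ?T"
    by (rule extensionalityI[of _ "{..<?n}"]) (use pt1 in \<open>auto simp: pt_def top_vertex_def\<close>)
  have "g (pt w 1) = \<one>\<^bsub>Z\<^esub>" if w: "w \<in> dc k" "w \<noteq> top_vertex k" for w
  proof (rule g1[OF ptM[OF w(1)]])
    obtain l where "l < k" "w l = 0"
      using w eq_top_vertex_iff[OF w(1)] discrete_cube_cases[OF w(1)] by blast
    then show "\<exists>l<?n. pt w 1 l = 0" using pt1 by (intro exI[of _ l]) auto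
  qed
  then have H1: "H 1 = z [^]\<^bsub>Z\<^esub> vertex_sign k (top_vertex k)"
    unfolding H_def using Z.alt_prod_top[of "\<lambda>w. g (pt w 1)" k] ptT gT z by simp
  have "\<delta> 0 = inv\<^bsub>Z\<^esub> (z [^]\<^bsub>Z\<^esub> vertex_sign k (top_vertex k))"
    unfolding \<delta>_def using H0 H1 z by simp
  then have "\<delta> 0 = z \<or> \<delta> 0 = inv\<^bsub>Z\<^esub> z"
    using vertex_sign_cases[of k "top_vertex k"] z by (auto simp: Z.int_pow_neg)
  then show ?thesis
    using \<delta>p z by (auto simp: Z.nat_pow_inv)
qed

end

section \<open>Compact Lie groups of finite exponent\<close>

text \<open>Neighbourhoods in \<open>\<real>\<^sup>m\<close> contain boxes, since the product topology constrains only finitely many coordinates and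
  those from \<open>m\<close> on vanish.\<close>

lemma Euclidean_space_box:
  assumes "openin (Euclidean_space m) Q" "a \<in> Q"
  obtains r where "r > 0"
    "\<And>x. x \<in> topspace (Euclidean_space m) \<Longrightarrow> (\<And>i. i < m \<Longrightarrow> \<bar>x i - a i\<bar> < r) \<Longrightarrow> x \<in> Q"
proof -
  obtain T where T: "openin (powertop_real UNIV) T" "Q = T \<inter> {x. \<forall>i\<ge>m. x i = 0}"
    using assms(1) unfolding Euclidean_space_def openin_subtopology by blast
  obtain V where V: "a \<in> Pi\<^sub>E UNIV V" "\<And>i. openin euclideanreal (V i)" "Pi\<^sub>E UNIV V \<subseteq> T"
    using product_topology_open_contains_basis[OF T(1)] assms(2) T(2) by blast
  have "\<exists>r>0. \<forall>y. \<bar>y - a i\<bar> < r \<longrightarrow> y \<in> V i" for i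
  proof -
    have "open (V i)" "a i \<in> V i" using V(1) V(2)[of i] by auto
    then obtain r where "r > 0" "\<forall>y. dist y (a i) < r \<longrightarrow> y \<in> V i" by (meson open_dist)
    then show ?thesis by (auto simp: dist_real_def)
  qed
  then obtain r where r: "\<And>i. r i > 0 \<and> (\<forall>y. \<bar>y - a i\<bar> < r i \<longrightarrow> y \<in> V i)" by metis
  define R where "R = Min (insert 1 (r ` {..<m}))"
  have "R > 0" using r by (simp add: R_def)
  moreover have "x \<in> Q" if x: "x \<in> topspace (Euclidean_space m)" "\<And>i. i < m \<Longrightarrow> \<bar>x i - a i\<bar> < R" for x
  proof -
    have "x i \<in> V i" for i
    proof (cases "i < m")
      case True
      then have "R \<le> r i" unfolding R_def by (intro Min_le) auto
      then show ?thesis using x(2)[OF True] r[of i] by auto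
    next
      case False
      then have "x i = a i" using x(1) assms(2) T(2) by (simp add: topspace_Euclidean_space)
      then show ?thesis using V(1) by auto
    qed
    then have "x \<in> T" using V(3) by auto
    then show ?thesis using x(1) T(2) by (simp add: topspace_Euclidean_space)
  qed
  ultimately show thesis using that by blast
qed

lemma continuous_map_Euclidean_coord:
  "continuous_map (Euclidean_space m) euclideanreal (\<lambda>x. x i)"
  unfolding Euclidean_space_def
  by (rule continuous_map_from_subtopology) (rule continuous_map_product_projection, simp)

definition join_halves :: "nat \<Rightarrow> (nat \<Rightarrow> real) \<Rightarrow> (nat \<Rightarrow> real) \<Rightarrow> (nat \<Rightarrow> real)" where
  "join_halves n x y = (\<lambda>i. if i < n then x i else if i < 2 * n then y (i - n) else 0)"

lemma join_halves_simps:
  assumes "x \<in> topspace (Euclidean_space n)" "y \<in> topspace (Euclidean_space n)"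
  shows "left_half n (join_halves n x y) = x" "right_half n (join_halves n x y) = y"
    "join_halves n x y \<in> topspace (Euclidean_space (2 * n))"
  using assms by (auto simp: left_half_def right_half_def join_halves_def topspace_Euclidean_space fun_eq_iff)

text \<open>The derivative of \<open>M\<close> in its first argument is the identity at \<open>(a, a)\<close>, because \<open>M (x, a) = x\<close>, and it is
  continuous. So it is close to the identity near \<open>(a, a)\<close>, and integrating from \<open>M (a, y) = y\<close> gives
  \<open>M (x, y) = y + (x - a) + o(|x - a|)\<close>, uniformly for \<open>y\<close> near \<open>a\<close>.\<close>

lemma local_group_law_estimate:
  fixes M :: "(nat \<Rightarrow> real) \<Rightarrow> (nat \<Rightarrow> real)"
  assumes Q: "openin (Euclidean_space (2 * n)) Q"
    and smooth: "smooth_map_on (2 * n) n Q M"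
    and a: "a \<in> topspace (Euclidean_space n)" "join_halves n a a \<in> Q"
    and left: "\<And>x. x \<in> topspace (Euclidean_space n) \<Longrightarrow> join_halves n x a \<in> Q \<Longrightarrow> M (join_halves n x a) = x"
    and right: "\<And>y. y \<in> topspace (Euclidean_space n) \<Longrightarrow> join_halves n a y \<in> Q \<Longrightarrow> M (join_halves n a y) = y"
    and \<epsilon>: "\<epsilon> > 0"
  obtains r where "r > 0"
    "\<And>x y j. x \<in> topspace (Euclidean_space n) \<Longrightarrow> y \<in> topspace (Euclidean_space n) \<Longrightarrow>
      (\<And>i. i < n \<Longrightarrow> \<bar>x i - a i\<bar> < r) \<Longrightarrow> (\<And>i. i < n \<Longrightarrow> \<bar>y i - a i\<bar> < r) \<Longrightarrow> j < n \<Longrightarrow>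
      join_halves n x y \<in> Q \<and>
      \<bar>M (join_halves n x y) j - y j - (x j - a j)\<bar> \<le> \<epsilon> * (\<Sum>i<n. \<bar>x i - a i\<bar>)"
proof -
  let ?E = "Euclidean_space n" and ?E2 = "Euclidean_space (2 * n)"
  let ?J = "join_halves n"
  have "\<forall>j<n. C_on (Suc 0) (2 * n) Q (\<lambda>x. M x j)"
    using smooth unfolding smooth_map_on_def by blast
  then have "\<forall>j. \<exists>g'. j < n \<longrightarrow> (\<forall>i<2*n. (\<forall>x\<in>Q. ((\<lambda>t. M (x(i := t)) j) has_real_derivative g' i x) (at (x i))) \<and>
      continuous_map (subtopology ?E2 Q) euclideanreal (g' i))"
    by auto
  from choice[OF this] obtain g' where
    g'0: "\<forall>j. j < n \<longrightarrow> (\<forall>i<2*n. (\<forall>x\<in>Q. ((\<lambda>t. M (x(i := t)) j) has_real_derivative g' j i x) (at (x i))) \<and>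
      continuous_map (subtopology ?E2 Q) euclideanreal (g' j i))" by blast
  then have deriv: "((\<lambda>t. M (x(i := t)) j) has_real_derivative g' j i x) (at (x i))"
    if "j < n" "i < 2 * n" "x \<in> Q" for i j x
    using that by blast
  have cont: "continuous_map (subtopology ?E2 Q) euclideanreal (g' j i)" if "j < n" "i < 2 * n" for i j
    using g'0 that by blast
  have QE: "Q \<subseteq> topspace ?E2" using Q by (rule openin_subset)
  have upd: "(?J x y)(i := t) = ?J (x(i := t)) y" if "i < n" for x y i t
    using that by (auto simp: join_halves_def)
  have updE: "x(i := t) \<in> topspace ?E" if "x \<in> topspace ?E" "i < n" for x i t
    using that by (auto simp: topspace_Euclidean_space)
  have JE: "?J x y \<in> topspace ?E2" for x y
    by (auto simp: topspace_Euclidean_space join_halves_def)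
  obtain r0 where r0: "r0 > 0"
    "\<And>x. x \<in> topspace ?E2 \<Longrightarrow> (\<And>i. i < 2 * n \<Longrightarrow> \<bar>x i - ?J a a i\<bar> < r0) \<Longrightarrow> x \<in> Q"
    using Euclidean_space_box[OF Q a(2)] by blast
  \<comment> \<open>At \<open>(a, a)\<close> the partial derivatives in the first \<open>n\<close> variables are those of the identity,
    since \<open>M (x, a) = x\<close>.\<close>
  have unit: "g' j i (?J a a) = (if i = j then 1 else 0)" if "i < n" "j < n" for i j
  proof -
    have "((\<lambda>t. M ((?J a a)(i := t)) j) has_real_derivative g' j i (?J a a)) (at (a i))"
      using deriv[OF that(2) _ a(2), of i] that by (simp add: join_halves_def)
    then have "((\<lambda>t. if i = j then t else a j) has_real_derivative g' j i (?J a a)) (at (a i))"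
    proof (rule has_field_derivative_transform_within_open[where S = "ball (a i) r0"])
      fix t assume t: "t \<in> ball (a i) r0"
      have "?J (a(i := t)) a \<in> Q"
        by (rule r0(2)[OF JE]) (use t r0(1) in \<open>auto simp: join_halves_def dist_real_def\<close>)
      then show "M ((?J a a)(i := t)) j = (if i = j then t else a j)"
        unfolding upd[OF that(1)] using left[OF updE[OF a(1) that(1)]] by simp
    qed (use r0(1) in auto)
    moreover have "((\<lambda>t. if i = j then t else a j) has_real_derivative (if i = j then 1 else 0)) (at (a i))"
      by (cases "i = j") auto
    ultimately show ?thesis by (rule DERIV_unique)
  qed
  define B where "B i j = {z \<in> Q. g' j i z \<in> ball (g' j i (?J a a)) \<epsilon>}" for i j
  have B: "openin ?E2 (B i j)" if "i < n" "j < n" for i j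
  proof -
    have "topspace (subtopology ?E2 Q) = Q" using QE by auto
    then have "openin (subtopology ?E2 Q) (B i j)"
      using openin_continuous_map_preimage[OF cont[OF that(2), of i], of "ball (g' j i (?J a a)) \<epsilon>"] that
      unfolding B_def by simp
    then show ?thesis by (rule openin_trans_full[OF _ Q])
  qed
  define W where "W = Q \<inter> (\<Inter>i\<in>{..<n}. \<Inter>j\<in>{..<n}. B i j)"
  have W: "openin ?E2 W"
  proof (cases "n = 0")
    case False
    have "openin ?E2 (\<Inter>i\<in>{..<n}. \<Inter>j\<in>{..<n}. B i j)"
      by (intro openin_INT2) (use False B in auto)
    then show ?thesis unfolding W_def by (rule openin_Int[OF Q])
  qed (use Q in \<open>simp add: W_def\<close>)
  have "?J a a \<in> W"
    using a(2) \<epsilon> by (auto simp: W_def B_def)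
  then obtain r where r: "r > 0"
    "\<And>x. x \<in> topspace ?E2 \<Longrightarrow> (\<And>i. i < 2 * n \<Longrightarrow> \<bar>x i - ?J a a i\<bar> < r) \<Longrightarrow> x \<in> W"
    using Euclidean_space_box[OF W] by blast
  have JW: "?J x y \<in> W" if "\<And>i. i < n \<Longrightarrow> \<bar>x i - a i\<bar> < r" "\<And>i. i < n \<Longrightarrow> \<bar>y i - a i\<bar> < r" for x y
    by (rule r(2)[OF JE]) (use that in \<open>auto simp: join_halves_def\<close>)
  have WQ: "z \<in> Q" if "z \<in> W" for z using that by (auto simp: W_def)
  have Wg: "\<bar>g' j i z - (if i = j then 1 else 0)\<bar> \<le> \<epsilon>" if "z \<in> W" "i < n" "j < n" for z i j
  proof -
    have "z \<in> B i j" using that by (auto simp: W_def)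
    then show ?thesis using unit[OF that(2,3)] by (simp add: B_def dist_real_def abs_minus_commute)
  qed
  show thesis
  proof (rule that[OF r(1)])
    fix x y j
    assume x: "x \<in> topspace ?E" "\<And>i. i < n \<Longrightarrow> \<bar>x i - a i\<bar> < r"
      and y: "y \<in> topspace ?E" "\<And>i. i < n \<Longrightarrow> \<bar>y i - a i\<bar> < r" and j: "j < n"
    define X where "X l = (\<lambda>i. if i < l then x i else a i)" for l
    have XE: "X l \<in> topspace ?E" for l
      using x(1) a(1) by (auto simp: X_def topspace_Euclidean_space)
    \<comment> \<open>Move from \<open>a\<close> to \<open>x\<close> one coordinate at a time and apply the mean value theorem to each step.\<close>
    have step: "\<bar>(M (?J (X (Suc l)) y) j - (if l = j then x l else 0)) - (M (?J (X l) y) j - (if l = j then a l else 0))\<bar>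
        \<le> \<epsilon> * \<bar>x l - a l\<bar>" if l: "l < n" for l
    proof -
      define h where "h t = M (?J ((X l)(l := t)) y) j - (if l = j then t else 0)" for t
      define I where "I = {t. \<bar>t - a l\<bar> < r}"
      have "I = ball (a l) r" by (auto simp: I_def dist_real_def abs_minus_commute)
      then have convex: "convex I" by simp
      have inW: "?J ((X l)(l := t)) y \<in> W" if "t \<in> I" for t
        by (rule JW) (use that x(2) y(2) r(1) in \<open>auto simp: X_def I_def\<close>)
      have "norm (h (x l) - h (a l)) \<le> \<epsilon> * norm (x l - a l)"
      proof (rule field_differentiable_bound[OF convex,
            where f' = "\<lambda>t. g' j l (?J ((X l)(l := t)) y) - (if l = j then 1 else 0)"])
        fix t assume t: "t \<in> I"
        have "((\<lambda>s. M ((?J ((X l)(l := t)) y)(l := s)) j) has_real_derivative g' j l (?J ((X l)(l := t)) y)) (at t)"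
          using deriv[OF j _ WQ[OF inW[OF t]], of l] l by (simp add: join_halves_def)
        then have "((\<lambda>s. M (?J ((X l)(l := s)) y) j) has_real_derivative g' j l (?J ((X l)(l := t)) y)) (at t)"
          unfolding upd[OF l] by simp
        moreover have "((\<lambda>s. if l = j then s else 0) has_real_derivative (if l = j then 1 else 0)) (at t)"
          by (cases "l = j") auto
        ultimately have "(h has_real_derivative g' j l (?J ((X l)(l := t)) y) - (if l = j then 1 else 0)) (at t)"
          unfolding h_def[abs_def] by (rule DERIV_diff)
        then show "(h has_field_derivative g' j l (?J ((X l)(l := t)) y) - (if l = j then 1 else 0)) (at t within I)"
          by (rule has_field_derivative_at_within)
        show "norm (g' j l (?J ((X l)(l := t)) y) - (if l = j then 1 else 0)) \<le> \<epsilon>"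
          using Wg[OF inW[OF t] l j] by simp
      qed (use x(2)[OF l] r(1) in \<open>auto simp: I_def\<close>)
      moreover have "(X l)(l := x l) = X (Suc l)" "(X l)(l := a l) = X l"
        by (auto simp: X_def fun_eq_iff less_Suc_eq)
      ultimately show ?thesis by (simp add: h_def)
    qed
    have "\<bar>(M (?J (X m) y) j - (if j < m then x j else a j)) - (M (?J (X 0) y) j - a j)\<bar>
        \<le> \<epsilon> * (\<Sum>l<m. \<bar>x l - a l\<bar>)" if "m \<le> n" for m
      using that
    proof (induction m)
      case (Suc m)
      then have "m < n" by simp
      note s = step[OF this]
      have "(if j < Suc m then x j else a j) - (if j < m then x j else a j) =
          (if m = j then x m else 0) - (if m = j then a m else 0)" by auto
      then show ?case using s Suc by (simp add: distrib_left split del: if_split)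
    qed simp
    from this[of n] have "\<bar>(M (?J (X n) y) j - x j) - (M (?J (X 0) y) j - a j)\<bar> \<le> \<epsilon> * (\<Sum>l<n. \<bar>x l - a l\<bar>)"
      using j by simp
    moreover have "X n = x" using x(1) a(1) by (auto simp: X_def topspace_Euclidean_space fun_eq_iff)
    moreover have "X 0 = a" by (auto simp: X_def)
    moreover have "M (?J a y) = y"
      using right[OF y(1)] WQ[OF JW[of a y]] y(2) r(1) by simp
    ultimately have "\<bar>(M (?J x y) j - x j) - (y j - a j)\<bar> \<le> \<epsilon> * (\<Sum>l<n. \<bar>x l - a l\<bar>)" by simp
    moreover have "(M (?J x y) j - x j) - (y j - a j) = M (?J x y) j - y j - (x j - a j)" by simp
    ultimately show "?J x y \<in> Q \<and> \<bar>M (?J x y) j - y j - (x j - a j)\<bar> \<le> \<epsilon> * (\<Sum>i<n. \<bar>x i - a i\<bar>)"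
      using WQ[OF JW[OF x(2) y(2)]] by simp
  qed
qed

lemma topological_group_pow_continuous:
  assumes "topological_group G S"
  shows "continuous_map S S (\<lambda>z. z [^]\<^bsub>G\<^esub> (m::nat))"
proof (induction m)
  case 0
  interpret group G using assms by (simp add: topological_group_def)
  show ?case using assms by (simp add: topological_group_def)
next
  case (Suc m)
  have "continuous_map S (prod_topology S S) (\<lambda>z. (z [^]\<^bsub>G\<^esub> m, z))"
    using Suc by (simp add: continuous_map_paired)
  moreover have "continuous_map (prod_topology S S) S (\<lambda>(a, b). a \<otimes>\<^bsub>G\<^esub> b)"
    using assms by (simp add: topological_group_def)
  ultimately have "continuous_map S S ((\<lambda>(a, b). a \<otimes>\<^bsub>G\<^esub> b) \<circ> (\<lambda>z. (z [^]\<^bsub>G\<^esub> m, z)))"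
    by (rule continuous_map_compose)
  then show ?case by (simp add: comp_def)
qed

text \<open>Left translations are continuous and carry any point to the unit.\<close>

lemma topological_group_discrete:
  assumes G: "topological_group G S" and one: "openin S {\<one>\<^bsub>G\<^esub>}"
  shows "S = discrete_topology (carrier G)"
proof -
  interpret group G using G by (simp add: topological_group_def)
  have carrier: "topspace S = carrier G" using G by (simp add: topological_group_def)
  have "openin S {g}" if g: "g \<in> carrier G" for g
  proof -
    have "continuous_map S (prod_topology S S) (\<lambda>x. (inv\<^bsub>G\<^esub> g, x))"
      using g carrier by (simp add: continuous_map_paired)
    moreover have "continuous_map (prod_topology S S) S (\<lambda>(a, b). a \<otimes>\<^bsub>G\<^esub> b)"
      using G by (simp add: topological_group_def)
    ultimately have "continuous_map S S ((\<lambda>(a, b). a \<otimes>\<^bsub>G\<^esub> b) \<circ> (\<lambda>x. (inv\<^bsub>G\<^esub> g, x)))"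
      by (rule continuous_map_compose)
    then have "openin S {x \<in> topspace S. inv\<^bsub>G\<^esub> g \<otimes>\<^bsub>G\<^esub> x \<in> {\<one>\<^bsub>G\<^esub>}}"
      using openin_continuous_map_preimage[OF _ one] by (auto simp: comp_def)
    moreover have "{x \<in> topspace S. inv\<^bsub>G\<^esub> g \<otimes>\<^bsub>G\<^esub> x \<in> {\<one>\<^bsub>G\<^esub>}} = {g}"
      using g by (auto simp: carrier) (metis inv_closed inv_equality inv_inv)
    ultimately show ?thesis by simp
  qed
  then show ?thesis
    using discrete_topology_unique[of "carrier G" S] carrier by auto
qed

text \<open>Let \<open>V\<close> be the open set of all \<open>z\<close> whose powers up to the \<open>p\<close>-th stay near the unit, and write \<open>x\<^sub>m\<close> for the
  coordinates of the \<open>m\<close>-th power of \<open>z \<in> V\<close>. By the estimate above, \<open>x\<^sub>m\<^sub>+\<^sub>1 = x\<^sub>m + (x\<^sub>1 - a)\<close> up to a small multiple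
  of \<open>|x\<^sub>1 - a|\<close>, hence \<open>0 = x\<^sub>p - a\<close> is \<open>p (x\<^sub>1 - a)\<close> up to such an error. This forces \<open>x\<^sub>1 = a\<close>, so \<open>V\<close> contains
  only the unit, and the group is discrete.\<close>

theorem compact_lie_group_exponent_finite:
  fixes G :: "'z monoid" and p :: nat
  assumes lie: "lie_group G S" and compact: "compact_space S"
    and p: "p \<ge> 1" "\<And>z. z \<in> carrier G \<Longrightarrow> z [^]\<^bsub>G\<^esub> p = \<one>\<^bsub>G\<^esub>"
  shows "finite (carrier G)"
proof -
  have tg: "topological_group G S" using lie by (simp add: lie_group_def)
  interpret group G using tg by (simp add: topological_group_def)
  have carrier: "topspace S = carrier G"
    and mult: "continuous_map (prod_topology S S) S (\<lambda>(a, b). a \<otimes>\<^bsub>G\<^esub> b)"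
    using tg by (auto simp: topological_group_def)
  obtain n \<A> where atlas: "smooth_atlas n S \<A>" and smult: "smooth_mult n G \<A>"
    using lie unfolding lie_group_def by blast
  let ?e = "\<one>\<^bsub>G\<^esub>"
  let ?E = "Euclidean_space n" and ?E2 = "Euclidean_space (2 * n)"
  let ?J = "join_halves n"
  have "?e \<in> (\<Union>(U, \<phi>) \<in> \<A>. U)" using atlas carrier by (simp add: smooth_atlas_def)
  then obtain U \<phi> where chart: "(U, \<phi>) \<in> \<A>" "?e \<in> U" by auto
  have U: "openin S U" and \<phi>U: "openin ?E (\<phi> ` U)"
    and hom: "homeomorphic_map (subtopology S U) (subtopology ?E (\<phi> ` U)) \<phi>"
    using atlas chart(1) unfolding smooth_atlas_def by fast+
  have US: "U \<subseteq> carrier G" using openin_subset[OF U] carrier by simp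
  have topU: "topspace (subtopology S U) = U" using US carrier by auto
  have \<phi>UE: "\<phi> ` U \<subseteq> topspace ?E" using openin_subset[OF \<phi>U] .
  define \<psi> where "\<psi> = inv_into U \<phi>"
  have inj: "inj_on \<phi> U" using hom topU by (metis homeomorphic_imp_injective_map)
  have \<psi>\<phi>: "\<psi> (\<phi> z) = z" if "z \<in> U" for z using inj that by (simp add: \<psi>_def)
  have \<phi>\<psi>: "\<phi> (\<psi> x) = x" "\<psi> x \<in> U" if "x \<in> \<phi> ` U" for x
    using that by (auto simp: \<psi>_def f_inv_into_f inv_into_into)
  have \<phi>cont: "continuous_map (subtopology S U) ?E \<phi>"
    using homeomorphic_imp_continuous_map[OF hom] continuous_map_in_subtopology by blast
  have \<psi>cont: "continuous_map (subtopology ?E (\<phi> ` U)) S \<psi>"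
  proof -
    obtain g where g: "homeomorphic_maps (subtopology S U) (subtopology ?E (\<phi> ` U)) \<phi> g"
      using hom unfolding homeomorphic_map_maps by blast
    then have gc: "continuous_map (subtopology ?E (\<phi> ` U)) (subtopology S U) g"
      and g\<phi>: "\<And>z. z \<in> U \<Longrightarrow> g (\<phi> z) = z"
      unfolding homeomorphic_maps_def topU by auto
    have "continuous_map (subtopology ?E (\<phi> ` U)) (subtopology S U) \<psi>"
    proof (rule continuous_map_eq[OF gc])
      fix x assume "x \<in> topspace (subtopology ?E (\<phi> ` U))"
      then obtain z where "z \<in> U" "x = \<phi> z" by auto
      then show "g x = \<psi> x" using g\<phi> \<psi>\<phi> by simp
    qed
    then show ?thesis using continuous_map_in_subtopology by blast
  qed
  define Q where "Q = {x \<in> topspace ?E2. left_half n x \<in> \<phi> ` U \<and> right_half n x \<in> \<phi> ` U \<and>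
      \<psi> (left_half n x) \<otimes>\<^bsub>G\<^esub> \<psi> (right_half n x) \<in> U}"
  define M where "M x = \<phi> (\<psi> (left_half n x) \<otimes>\<^bsub>G\<^esub> \<psi> (right_half n x))" for x
  have smooth: "smooth_map_on (2 * n) n Q M"
    using smult chart(1) unfolding smooth_mult_def Q_def M_def[abs_def] \<psi>_def by fast
  have lc: "continuous_map ?E2 ?E (left_half n)" and rc: "continuous_map ?E2 ?E (right_half n)"
    unfolding left_half_def[abs_def] right_half_def[abs_def] continuous_map_componentwise_Euclidean_space
    using continuous_map_Euclidean_coord by blast+
  have Q: "openin ?E2 Q"
  proof -
    define Q0 where "Q0 = {x \<in> topspace ?E2. left_half n x \<in> \<phi> ` U} \<inter> {x \<in> topspace ?E2. right_half n x \<in> \<phi> ` U}"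
    have Q0: "openin ?E2 Q0" unfolding Q0_def
      using openin_continuous_map_preimage[OF lc \<phi>U] openin_continuous_map_preimage[OF rc \<phi>U] by (rule openin_Int)
    have top0: "topspace (subtopology ?E2 Q0) = Q0" using openin_subset[OF Q0] by auto
    have "continuous_map (subtopology ?E2 Q0) (subtopology ?E (\<phi> ` U)) (left_half n)"
      "continuous_map (subtopology ?E2 Q0) (subtopology ?E (\<phi> ` U)) (right_half n)"
      by (rule continuous_map_into_subtopology; use lc rc continuous_map_from_subtopology in \<open>auto simp: Q0_def\<close>)+
    then have "continuous_map (subtopology ?E2 Q0) S (\<psi> \<circ> left_half n)"
      "continuous_map (subtopology ?E2 Q0) S (\<psi> \<circ> right_half n)"
      using continuous_map_compose[OF _ \<psi>cont] by blast+
    then have "continuous_map (subtopology ?E2 Q0) (prod_topology S S) (\<lambda>x. (\<psi> (left_half n x), \<psi> (right_half n x)))"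
      by (simp add: continuous_map_paired comp_def)
    then have "continuous_map (subtopology ?E2 Q0) S ((\<lambda>(a, b). a \<otimes>\<^bsub>G\<^esub> b) \<circ> (\<lambda>x. (\<psi> (left_half n x), \<psi> (right_half n x))))"
      by (rule continuous_map_compose[OF _ mult])
    from openin_continuous_map_preimage[OF this U]
    have "openin (subtopology ?E2 Q0) {x \<in> Q0. \<psi> (left_half n x) \<otimes>\<^bsub>G\<^esub> \<psi> (right_half n x) \<in> U}"
      unfolding top0 by simp
    then have "openin ?E2 {x \<in> Q0. \<psi> (left_half n x) \<otimes>\<^bsub>G\<^esub> \<psi> (right_half n x) \<in> U}"
      by (rule openin_trans_full[OF _ Q0])
    moreover have "{x \<in> Q0. \<psi> (left_half n x) \<otimes>\<^bsub>G\<^esub> \<psi> (right_half n x) \<in> U} = Q"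
      by (auto simp: Q_def Q0_def)
    ultimately show ?thesis by simp
  qed
  define a where "a = \<phi> ?e"
  have aU: "a \<in> \<phi> ` U" "a \<in> topspace ?E" "\<psi> a = ?e" using chart(2) \<phi>UE \<psi>\<phi> by (auto simp: a_def)
  have JQ: "?J x y \<in> Q \<longleftrightarrow> x \<in> \<phi> ` U \<and> y \<in> \<phi> ` U \<and> \<psi> x \<otimes>\<^bsub>G\<^esub> \<psi> y \<in> U"
    and MJ: "M (?J x y) = \<phi> (\<psi> x \<otimes>\<^bsub>G\<^esub> \<psi> y)"
    if "x \<in> topspace ?E" "y \<in> topspace ?E" for x y
    using join_halves_simps[OF that] by (auto simp: Q_def M_def)
  \<comment> \<open>The errors of the \<open>n\<close> coordinates add up to \<open>n \<epsilon>\<close> times the distance \<open>N\<close> below, so \<open>n \<epsilon> < 1\<close> is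
    needed.\<close>
  define \<epsilon> :: real where "\<epsilon> = 1 / (real n + 1)"
  have \<epsilon>: "\<epsilon> > 0" by (simp add: \<epsilon>_def)
  have aQ: "?J a a \<in> Q" using JQ[OF aU(2,2)] aU chart(2) by simp
  obtain r where r: "r > 0"
    "\<And>x y j. x \<in> topspace ?E \<Longrightarrow> y \<in> topspace ?E \<Longrightarrow>
      (\<And>i. i < n \<Longrightarrow> \<bar>x i - a i\<bar> < r) \<Longrightarrow> (\<And>i. i < n \<Longrightarrow> \<bar>y i - a i\<bar> < r) \<Longrightarrow> j < n \<Longrightarrow>
      ?J x y \<in> Q \<and> \<bar>M (?J x y) j - y j - (x j - a j)\<bar> \<le> \<epsilon> * (\<Sum>i<n. \<bar>x i - a i\<bar>)"
  proof (rule local_group_law_estimate[OF Q smooth aU(2) aQ _ _ \<epsilon>])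
    fix x assume x: "x \<in> topspace ?E" "?J x a \<in> Q"
    then have "x \<in> \<phi> ` U" using JQ[OF x(1) aU(2)] by blast
    then have "\<psi> x \<in> carrier G" "\<phi> (\<psi> x) = x" using \<phi>\<psi> US by blast+
    then show "M (?J x a) = x"
      using MJ[OF x(1) aU(2)] aU(3) by simp
  next
    fix y assume y: "y \<in> topspace ?E" "?J a y \<in> Q"
    then have "y \<in> \<phi> ` U" using JQ[OF aU(2) y(1)] by blast
    then have "\<psi> y \<in> carrier G" "\<phi> (\<psi> y) = y" using \<phi>\<psi> US by blast+
    then show "M (?J a y) = y"
      using MJ[OF aU(2) y(1)] aU(3) by simp
  qed blast
  define W where "W = {z \<in> U. \<forall>i\<in>{..<n}. \<phi> z i \<in> {a i - r <..< a i + r}}"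
  have Wopen: "openin S W"
  proof -
    have "openin (subtopology S U) {z \<in> topspace (subtopology S U). \<phi> z i \<in> {a i - r <..< a i + r}}" for i
    proof (rule openin_continuous_map_preimage)
      show "continuous_map (subtopology S U) euclideanreal (\<lambda>z. \<phi> z i)"
        using continuous_map_compose[OF \<phi>cont continuous_map_Euclidean_coord[of n i]] by (simp add: comp_def)
    qed (simp add: open_greaterThanLessThan)
    then have "openin S {z \<in> U. \<phi> z i \<in> {a i - r <..< a i + r}}" for i
      unfolding topU by (rule openin_trans_full[OF _ U])
    then have "openin S (\<Inter>i\<in>{..<n}. {z \<in> U. \<phi> z i \<in> {a i - r <..< a i + r}})" if "n \<noteq> 0"
      using that by (intro openin_INT2) (simp_all only: finite_lessThan lessThan_empty_iff bot_nat_def not_False_eq_True)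
    moreover have "W = (if n = 0 then U else (\<Inter>i\<in>{..<n}. {z \<in> U. \<phi> z i \<in> {a i - r <..< a i + r}}))"
      by (auto simp: W_def)
    ultimately show ?thesis using U by simp
  qed
  have eW: "?e \<in> W" using chart(2) r(1) by (auto simp: W_def a_def)
  define V where "V = (\<Inter>m\<in>{..p}. {z \<in> topspace S. z [^]\<^bsub>G\<^esub> m \<in> W})"
  have "openin S V"
    unfolding V_def
    by (rule openin_INT2)
      (use openin_continuous_map_preimage[OF topological_group_pow_continuous[OF tg] Wopen] in auto)
  moreover have "?e \<in> V" using eW by (auto simp: V_def carrier)
  moreover have "z = ?e" if z: "z \<in> V" for z
  proof -
    have zc: "z \<in> carrier G" and zW: "z [^]\<^bsub>G\<^esub> m \<in> W" if "m \<le> p" for m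
      using z that by (auto simp: V_def carrier)
    have z1: "z \<in> W" using zW[OF p(1)] zc[OF p(1)] by simp
    define x where "x m = \<phi> (z [^]\<^bsub>G\<^esub> m)" for m :: nat
    have \<phi>W: "\<phi> w \<in> topspace ?E" "\<And>i. i < n \<Longrightarrow> \<bar>\<phi> w i - a i\<bar> < r" if "w \<in> W" for w
      using that \<phi>UE by (force simp: W_def abs_less_iff)+
    define N where "N = (\<Sum>i<n. \<bar>\<phi> z i - a i\<bar>)"
    have step: "\<bar>x (Suc m) j - x m j - (\<phi> z j - a j)\<bar> \<le> \<epsilon> * N" if m: "Suc m \<le> p" and j: "j < n" for m j
    proof -
      have mW: "z [^]\<^bsub>G\<^esub> m \<in> W" "z [^]\<^bsub>G\<^esub> Suc m \<in> W" using zW[OF Suc_leD[OF m]] zW[OF m] .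
      have "z \<otimes>\<^bsub>G\<^esub> z [^]\<^bsub>G\<^esub> m = z [^]\<^bsub>G\<^esub> Suc m"
        using nat_pow_Suc2[OF zc[OF p(1)]] by simp
      then have "M (?J (\<phi> z) (x m)) = x (Suc m)"
        using MJ[OF \<phi>W(1)[OF z1] \<phi>W(1)[OF mW(1)]] \<psi>\<phi> z1 mW by (simp add: x_def W_def)
      then show ?thesis
        using r(2)[OF \<phi>W(1)[OF z1] \<phi>W(1)[OF mW(1)] \<phi>W(2)[OF z1] \<phi>W(2)[OF mW(1)] j]
        by (simp add: x_def N_def)
    qed
    have sum: "\<bar>x m j - a j - real m * (\<phi> z j - a j)\<bar> \<le> real m * (\<epsilon> * N)" if "m \<le> p" "j < n" for m j
      using that(1)
    proof (induction m)
      case 0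
      show ?case by (simp add: x_def a_def)
    next
      case (Suc m)
      then have "\<bar>x m j - a j - real m * (\<phi> z j - a j)\<bar> \<le> real m * (\<epsilon> * N)" by simp
      with step[OF Suc.prems that(2)] show ?case
        by (simp add: distrib_right distrib_left algebra_simps)
    qed
    have xp: "x p = a" using p(2)[OF zc[OF p(1)]] by (simp add: x_def a_def)
    have "\<bar>\<phi> z j - a j\<bar> \<le> \<epsilon> * N" if "j < n" for j
    proof -
      have "real p * \<bar>\<phi> z j - a j\<bar> \<le> real p * (\<epsilon> * N)"
        using sum[OF order_refl that] unfolding xp by (simp add: abs_mult)
      then show ?thesis using p(1) by simp
    qed
    then have "N \<le> (\<Sum>j<n. \<epsilon> * N)" unfolding N_def by (intro sum_mono) auto
    then have "N \<le> real n * (\<epsilon> * N)" by simp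
    then have "(real n + 1) * N \<le> real n * N" by (simp add: \<epsilon>_def field_simps)
    then have "N \<le> 0" by (simp add: algebra_simps)
    then have "N = 0" unfolding N_def by (simp add: antisym sum_nonneg)
    then have "\<phi> z i = a i" if "i < n" for i
      using that unfolding N_def by (subst (asm) sum_nonneg_eq_0_iff) auto
    moreover have "\<phi> z i = a i" if "\<not> i < n" for i
      using that \<phi>W(1)[OF z1] aU(2) by (simp add: topspace_Euclidean_space)
    ultimately have "\<phi> z = a" by (intro ext) blast
    then show "z = ?e" using \<psi>\<phi>[of z] z1 aU(3) by (simp add: W_def)
  qed
  ultimately have "openin S {?e}"
    by (metis (no_types, lifting) insert_absorb singleton_iff subsetI subset_antisym empty_subsetI insert_subset)
  then have "S = discrete_topology (carrier G)" by (rule topological_group_discrete[OF tg])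
  with compact show ?thesis by (simp add: compact_space_discrete_topology)
qed

section \<open>Finiteness and the compact finite-rank property\<close>

text \<open>The points are charts onto \<open>\<real>\<^sup>0\<close>, and maps into \<open>\<real>\<^sup>0\<close> are trivially smooth. Finiteness makes the topology second
  countable.\<close>

lemma lie_group_discrete:
  assumes G: "group G" and fin: "finite (carrier G)"
  shows "topological_group G (discrete_topology (carrier G))"
    "lie_group G (discrete_topology (carrier G))"
proof -
  interpret group G by fact
  let ?S = "discrete_topology (carrier G)"
  show tg: "topological_group G ?S"
    using G unfolding topological_group_def prod_topology_discrete_topology[symmetric] by auto
  define \<A> :: "('a set \<times> ('a \<Rightarrow> nat \<Rightarrow> real)) set" where "\<A> = {({z}, \<lambda>_ _. 0) | z. z \<in> carrier G}"
  have E0: "topspace (Euclidean_space 0) = {\<lambda>_. 0}"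
    by (auto simp: topspace_Euclidean_space)
  have "homeomorphic_map (subtopology ?S {z}) (subtopology (Euclidean_space 0) ((\<lambda>_ _. 0) ` {z})) (\<lambda>_ _. 0)"
    if z: "z \<in> carrier G" for z
    unfolding homeomorphic_map_maps
  proof (rule exI[of _ "\<lambda>_. z"])
    show "homeomorphic_maps (subtopology ?S {z}) (subtopology (Euclidean_space 0) ((\<lambda>_ _. 0) ` {z})) (\<lambda>_ _. 0) (\<lambda>_. z)"
      unfolding homeomorphic_maps_def using z E0 by (auto simp: topspace_subtopology)
  qed
  moreover have "openin (Euclidean_space 0) {\<lambda>_. 0}"
    using openin_topspace[of "Euclidean_space 0"] unfolding E0 .
  ultimately have "smooth_atlas 0 ?S \<A>"
    unfolding smooth_atlas_def \<A>_def smooth_map_on_def by auto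
  moreover have "smooth_mult 0 G \<A>" "smooth_inverse 0 G \<A>"
    by (auto simp: smooth_mult_def smooth_inverse_def smooth_map_on_def)
  ultimately show "lie_group G ?S"
    unfolding lie_group_def using tg fin
    by (auto simp: second_countable_discrete_topology countable_finite)
qed

lemma factor_topology_discrete:
  "factor_topology X C (discrete_topology X) i = discrete_topology (factor X C i)"
  unfolding topology_eq openin_factor_topology[OF topspace_discrete_topology] by auto

context nilspace
begin

text \<open>The action is free, so the group embeds into the space it acts on.\<close>

lemma finite_structure_group:
  assumes sg: "structure_group X C k Z act" and fin: "finite (factor X C k)"
  shows "finite (carrier Z)"
proof -
  interpret A: group_action Z "factor X C k" act using sg by (simp add: structure_group_def)
  obtain x where "x \<in> X" using nonempty by blast
  then have q: "proj k x \<in> factor X C k" by (rule proj_in)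
  let ?q = "proj k x"
  have "inj_on (\<lambda>a. act a ?q) (carrier Z)" by (rule structure_group_free[OF sg q])
  moreover have "(\<lambda>a. act a ?q) ` carrier Z \<subseteq> factor X C k"
    using A.element_image[OF _ q] by blast
  ultimately show ?thesis using fin by (meson finite_imageD finite_subset)
qed

lemma finite_factor_Suc:
  assumes sg: "structure_group X C (k + 1) Z act"
    and fin: "finite (carrier Z)" "finite (factor X C k)"
  shows "finite (factor X C (k + 1))"
proof -
  let ?Y = "factor X C (k + 1)" and ?f = "factor_proj X C (k + 1)"
  have "?f ` ?Y \<subseteq> factor X C k"
  proof
    fix q assume "q \<in> ?f ` ?Y"
    then obtain x where x: "x \<in> X" "q = ?f (proj (k + 1) x)" unfolding factor_eq by blast
    then show "q \<in> factor X C k" using factor_proj_proj[OF x(1), of "k + 1"] proj_in[OF x(1), of k] by simp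
  qed
  then have "finite (?f ` ?Y)" using fin(2) finite_subset by blast
  moreover have "finite {q' \<in> ?Y. ?f q' = ?f q}" if "q \<in> ?Y" for q
  proof -
    have "{q' \<in> ?Y. ?f q' = ?f q} = orbit Z act q" using sg that by (simp add: structure_group_def)
    also have "\<dots> = (\<lambda>z. act z q) ` carrier Z" by (auto simp: orbit_def)
    finally show ?thesis using fin(1) by simp
  qed
  then have "finite {q' \<in> ?Y. ?f q' = y}" if "y \<in> ?f ` ?Y" for y
    using that by blast
  ultimately have "finite (\<Union>y\<in>?f ` ?Y. {q' \<in> ?Y. ?f q' = y})" by blast
  moreover have "(\<Union>y\<in>?f ` ?Y. {q' \<in> ?Y. ?f q' = y}) = ?Y" by blast
  ultimately show ?thesis by simp
qed

lemma finite_factor_0: "finite (factor X C 0)"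
proof -
  obtain x where x: "x \<in> X" using nonempty by blast
  have "factor X C 0 \<subseteq> {proj 0 x}"
    unfolding factor_eq using proj_eq_iff[OF _ x] rel_0[OF _ x] by blast
  then show ?thesis using finite_subset by blast
qed

text \<open>Climb from the point \<open>X\<^sub>0\<close> to \<open>X\<^sub>k\<close>, which is \<open>X\<close> because \<open>\<sim>\<^sub>k\<close> is equality.\<close>

theorem cfr_p_homogeneous_finite:
  assumes p: "p \<ge> 2" and hom: "p_homogeneous p X C" and cfr: "cfr_nilspace k X C T"
  shows "finite X"
proof -
  have "finite (factor X C i)" if "i \<le> k" for i
    using that
  proof (induction i)
    case (Suc i)
    then obtain Z :: "'a set monoid" and act S where Z: "structure_group X C (i + 1) Z act"
      "compact_space S" "lie_group Z S"
      using cfr unfolding cfr_nilspace_def compact_structure_group_def by force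
    have "finite (carrier Z)"
    proof (rule compact_lie_group_exponent_finite[OF Z(3,2)])
      show "1 \<le> p" using p by simp
      show "z [^]\<^bsub>Z\<^esub> p = \<one>\<^bsub>Z\<^esub>" if "z \<in> carrier Z" for z
        by (rule structure_group_exponent[OF p hom Z(1) that])
    qed
    then show ?case using finite_factor_Suc[OF Z(1)] Suc by simp
  qed (rule finite_factor_0)
  moreover have "inj_on (proj k) X"
  proof (rule inj_onI)
    fix x y assume "x \<in> X" "y \<in> X" "proj k x = proj k y"
    then show "x = y"
      using step_unique[of k x y] cfr proj_eq_iff by (simp add: cfr_nilspace_def)
  qed
  ultimately show ?thesis
    using finite_imageD[of "proj k" X] by (simp add: factor_eq)
qed

theorem finite_compact_cfr:
  assumes step: "step_nilspace k X C" and T: "compact_nilspace X C T" and fin: "finite X"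
  shows "cfr_nilspace k X C T"
  unfolding cfr_nilspace_def
proof (intro conjI ballI step T)
  fix i assume i: "i \<in> {1..k}"
  have Td: "T = discrete_topology X"
    using T fin by (intro finite_topspace_imp_discrete_topology) (auto simp: compact_nilspace_def)
  obtain Z :: "'a set monoid" and act where sg: "structure_group X C i Z act"
    using structure_group_exists[of i] i by auto
  have finY: "finite (factor X C i)" using fin by (simp add: factor_eq)
  have finZ: "finite (carrier Z)" by (rule finite_structure_group[OF sg finY])
  have G: "group Z" using sg by (simp add: structure_group_def comm_group_def)
  let ?S = "discrete_topology (carrier Z)"
  have "act z q \<in> factor X C i" if "z \<in> carrier Z" "q \<in> factor X C i" for z q
    using sg that group_action.element_image[of Z "factor X C i" act] by (simp add: structure_group_def)
  then have "continuous_map (prod_topology ?S (factor_topology X C T i)) (factor_topology X C T i) (\<lambda>(z, q). act z q)"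
    unfolding Td factor_topology_discrete prod_topology_discrete_topology[symmetric] by auto
  then have "compact_structure_group X C T i Z act ?S"
    unfolding compact_structure_group_def
    using sg lie_group_discrete(1)[OF G finZ] finZ by (simp add: compact_space_discrete_topology)
  then show "\<exists>(Z :: 'a set monoid) act S. compact_structure_group X C T i Z act S \<and> lie_group Z S"
    using lie_group_discrete(2)[OF G finZ] by blast
qed

end

theorem proposition1p5:
  fixes p k :: nat
    and X :: "'a set"
    and C :: "nat \<Rightarrow> ((nat \<Rightarrow> int) \<Rightarrow> 'a) set"
  assumes "prime p"
    and "step_nilspace k X C"
    and "p_homogeneous p X C"
  shows "(\<forall>i \<in> {1..k}. \<forall>(Z :: 'z monoid) act.
            structure_group X C i Z act \<longrightarrow> elementary_abelian p Z) \<and>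
         (\<forall>T. compact_nilspace X C T \<longrightarrow> (cfr_nilspace k X C T \<longleftrightarrow> finite X))"
proof -
  interpret nilspace X C using assms(2) by (simp add: step_nilspace_def)
  have p: "p \<ge> 2" using prime_ge_2_nat[OF assms(1)] .
  have "elementary_abelian p Z" if i: "i \<in> {1..k}" and sg: "structure_group X C i Z act"
    for i and Z :: "'z monoid" and act
  proof -
    have "structure_group X C (i - 1 + 1) Z act" using i sg by simp
    then show ?thesis
      using structure_group_exponent[OF p assms(3), of "i - 1" Z act] sg
      by (simp add: elementary_abelian_def structure_group_def)
  qed
  moreover have "cfr_nilspace k X C T \<longleftrightarrow> finite X" if "compact_nilspace X C T" for T
    using cfr_p_homogeneous_finite[OF p assms(3)] finite_compact_cfr[OF assms(2) that] by blast
  ultimately show ?thesis by blast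
qed

end
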